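(* Given $\alpha$, $0<\alpha<n$, suppose exponents $p(\cdot),q(\cdot)\in\mathcal{P}$ are such that $p_+<n/\alpha$ and $\frac1{p(x)}-\frac1{q(x)}=\frac\alpha n$. Let $\sigma=(n/\alpha)'$. Then for every weight $w$ such that $(q(\cdot)/\sigma,w^\sigma)$ is an $M$-pair there is a constant $C$ such that, for all $f\in L^{p(\cdot)}(w)$, $$\|I_\alpha f\|_{L^{q(\cdot)}(w)}\le C\|f\|_{L^{p(\cdot)}(w)},\qquad\|M_\alpha f\|_{L^{q(\cdot)}(w)}\le C\|f\|_{L^{p(\cdot)}(w)}.$$
   Context: $\mathcal{P}$ is the set of measurable $p(\cdot):\mathbb{R}^n\to[1,\infty]$; $p_+=\operatorname{ess\,sup}p$. The conjugate exponent $p'(\cdot)$ is defined pointwise by $1/p(x)+1/p'(x)=1$, $1/\infty=0$ (same notation for constants). With $\mathbb{R}^n_\infty=\{x:p(x)=\infty\}$, $$\|f\|_{p(\cdot)}=\inf\Big\{\lambda>0:\int_{\mathbb{R}^n\setminus\mathbb{R}^n_\infty}\Big(\frac{|f(x)|}{\lambda}\Big)^{p(x)}dx+\lambda^{-1}\|f\|_{L^\infty(\mathbb{R}^n_\infty)}\le1\Big\}.$$ A weight $w$ is a non-negative measurable function, here with $0<w<\infty$ a.e. $L^{p(\cdot)}(w)$ is the set of measurable $f$ with $\|f\|_{L^{p(\cdot)}(w)}:=\|fw\|_{p(\cdot)}<\infty$. $Mf(x)=\sup_{B\ni x}\frac1{|B|}\int_B|f(y)|\,dy$ (balls $B$); $M$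 is bounded on $L^{r(\cdot)}(v)$ if $\|(Mf)v\|_{r(\cdot)}\le C\|fv\|_{r(\cdot)}$ for all $f\in L^{r(\cdot)}(v)$. $(r(\cdot),v)$, with $r(\cdot)\in\mathcal{P}$, is an $M$-pair if $M$ is bounded on both $L^{r(\cdot)}(v)$ and $L^{r'(\cdot)}(v^{-1})$. The fractional integral operator and fractional maximal operator are $I_\alpha f(x)=\int_{\mathbb{R}^n}\frac{f(y)}{|x-y|^{n-\alpha}}\,dy$ and $M_\alpha f(x)=\sup_{B\ni x}|B|^{\alpha/n}\frac1{|B|}\int_B|f(y)|\,dy$. *)

theory Defs
  imports "HOL-Probability.Essential_Supremum"
begin

text \<open>
  Euclidean space of dimension \<open>n\<close> is a type \<open>'a::euclidean_space\<close> with \<open>n = DIM('a)\<close>, and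
  measurability and integration refer to the completed measure \<open>lebesgue\<close>. Exponents, weights
  and maximal functions may take the value \<open>\<infinity>\<close> and have type \<open>'a \<Rightarrow> ennreal\<close>, where
  \<open>inverse 0 = \<infinity>\<close>, \<open>inverse \<infinity> = 0\<close> and \<open>0 * \<infinity> = 0\<close>. Functions \<open>f\<close> are real-valued.
\<close>

definition exponents :: "('a::euclidean_space \<Rightarrow> ennreal) set" where
  "exponents = {p \<in> borel_measurable lebesgue. \<forall>x. 1 \<le> p x}"

definition conj_exponent :: "ennreal \<Rightarrow> ennreal" where
  "conj_exponent p = inverse (1 - inverse p)"

text \<open>The defining relation \<open>1/p + 1/p' = 1\<close> holds and determines \<open>p'\<close>:\<close>

lemma conj_exponent_iff:
  assumes "1 \<le> p"
  shows "inverse p + inverse s = 1 \<longleftrightarrow> s = conj_exponent p"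
proof -
  have inv: "inverse (inverse a) = a" for a :: ennreal
  proof (cases a)
    case (real r)
    then show ?thesis
      by (cases "r = 0") (simp_all add: inverse_ennreal)
  qed simp
  have le: "inverse p \<le> 1"
  proof (cases p)
    case (real r)
    with assms have "1 \<le> r" by (simp flip: ennreal_1)
    with real show ?thesis by (simp add: inverse_ennreal inverse_le_1_iff flip: ennreal_1)
  qed simp
  have fin: "inverse p \<noteq> \<infinity>"
    using assms by auto
  have "inverse p + inverse s = 1 \<longleftrightarrow> inverse s = 1 - inverse p"
  proof
    assume h: "inverse p + inverse s = 1"
    show "inverse s = 1 - inverse p"
      unfolding h[symmetric] using fin by simp
  next
    assume "inverse s = 1 - inverse p"
    then show "inverse p + inverse s = 1"
      using le by (simp add: add_diff_self_ennreal)
  qed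
  also have "\<dots> \<longleftrightarrow> s = conj_exponent p"
    unfolding conj_exponent_def by (metis inv)
  finally show ?thesis .
qed

text \<open>Real powers of \<open>[0, \<infinity>]\<close>-valued quantities; only used for exponents \<open>a > 0\<close>.\<close>

definition ennpowr :: "ennreal \<Rightarrow> real \<Rightarrow> ennreal" where
  "ennpowr t a = (if t = \<infinity> then \<infinity> else ennreal (enn2real t powr a))"

text \<open>
  The norm of a function is expressed through its modulus \<open>g = \<bar>f\<bar>\<close>. It is \<open>\<infinity>\<close> if no \<open>l\<close> is
  admissible. The essential supremum over a null set is \<open>0\<close>.
\<close>

definition vnorm :: "('a::euclidean_space \<Rightarrow> ennreal) \<Rightarrow> ('a \<Rightarrow> ennreal) \<Rightarrow> ennreal" where
  "vnorm p g = Inf (ennreal ` {l :: real. 0 < l \<and>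
     (\<integral>\<^sup>+x\<in>{x. p x \<noteq> \<infinity>}. ennpowr (g x / ennreal l) (enn2real (p x)) \<partial>lebesgue)
       + inverse (ennreal l) * esssup (restrict_space lebesgue {x. p x = \<infinity>}) g \<le> 1})"

definition weight :: "('a::euclidean_space \<Rightarrow> ennreal) \<Rightarrow> bool" where
  "weight w \<longleftrightarrow> w \<in> borel_measurable lebesgue \<and> (AE x in lebesgue. 0 < w x \<and> w x < \<infinity>)"

definition wnorm :: "('a::euclidean_space \<Rightarrow> ennreal) \<Rightarrow> ('a \<Rightarrow> ennreal) \<Rightarrow> ('a \<Rightarrow> ennreal) \<Rightarrow> ennreal" where
  "wnorm p w g = vnorm p (\<lambda>x. g x * w x)"

definition Lspace :: "('a::euclidean_space \<Rightarrow> ennreal) \<Rightarrow> ('a \<Rightarrow> ennreal) \<Rightarrow> ('a \<Rightarrow> real) set" where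
  "Lspace p w = {f \<in> borel_measurable lebesgue. wnorm p w (\<lambda>x. ennreal \<bar>f x\<bar>) < \<infinity>}"

definition maximal :: "('a::euclidean_space \<Rightarrow> real) \<Rightarrow> 'a \<Rightarrow> ennreal" where
  "maximal f x = (SUP (c, r) \<in> {(c, r). 0 < r \<and> x \<in> ball c r}.
     (\<integral>\<^sup>+y\<in>ball c r. ennreal \<bar>f y\<bar> \<partial>lebesgue) / emeasure lebesgue (ball c r))"

definition fractional_maximal :: "real \<Rightarrow> ('a::euclidean_space \<Rightarrow> real) \<Rightarrow> 'a \<Rightarrow> ennreal" where
  "fractional_maximal \<alpha> f x = (SUP (c, r) \<in> {(c, r). 0 < r \<and> x \<in> ball c r}.
     ennpowr (emeasure lebesgue (ball c r)) (\<alpha> / real DIM('a)) *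
     ((\<integral>\<^sup>+y\<in>ball c r. ennreal \<bar>f y\<bar> \<partial>lebesgue) / emeasure lebesgue (ball c r)))"

definition fractional_kernel :: "real \<Rightarrow> ('a::euclidean_space \<Rightarrow> real) \<Rightarrow> 'a \<Rightarrow> 'a \<Rightarrow> real" where
  "fractional_kernel \<alpha> f x y = f y / norm (x - y) powr (real DIM('a) - \<alpha>)"

text \<open>
  The Bochner integral below is \<open>0\<close> by convention where the integrand is not absolutely
  integrable; statements about it have to exclude this case.
\<close>

definition fractional_integral :: "real \<Rightarrow> ('a::euclidean_space \<Rightarrow> real) \<Rightarrow> 'a \<Rightarrow> real" where
  "fractional_integral \<alpha> f x = (\<integral>y. fractional_kernel \<alpha> f x y \<partial>lebesgue)"

definition maximal_bounded :: "('a::euclidean_space \<Rightarrow> ennreal) \<Rightarrow> ('a \<Rightarrow> ennreal) \<Rightarrow> bool" where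
  "maximal_bounded r v \<longleftrightarrow> (\<exists>C::real. \<forall>f \<in> Lspace r v.
     wnorm r v (maximal f) \<le> ennreal C * wnorm r v (\<lambda>x. ennreal \<bar>f x\<bar>))"

definition M_pair :: "('a::euclidean_space \<Rightarrow> ennreal) \<Rightarrow> ('a \<Rightarrow> ennreal) \<Rightarrow> bool" where
  "M_pair r v \<longleftrightarrow> r \<in> exponents \<and> maximal_bounded r v \<and>
     maximal_bounded (\<lambda>x. conj_exponent (r x)) (\<lambda>x. inverse (v x))"

end

theory Submission
  imports Defs
begin

text \<open>
  Let \<open>n\<close> be the dimension, \<open>1/\<sigma> = 1 - \<alpha>/n\<close> and \<open>1/\<sigma>' = \<alpha>/n\<close>, and put \<open>r = q/\<sigma>\<close>, \<open>v = w\<^sup>\<sigma>\<close>. The exponents are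
  related by \<open>1/p = 1/(\<sigma> r) + 1/\<sigma>'\<close> and, for the conjugates, \<open>1/q' = 1/(\<sigma> r') + 1/\<sigma>'\<close>.

  Let \<open>f \<ge> 0\<close> be normalised so that \<open>\<phi> = (f w)\<^sup>p\<close> has integral at most \<open>1\<close>. The first relation says that
  \<open>f = F\<^sup>1\<^sup>/\<^sup>\<sigma> \<phi>\<^sup>1\<^sup>/\<^sup>\<sigma>'\<close> with \<open>F = \<phi>\<^sup>1\<^sup>/\<^sup>r / v\<close>, and \<open>F\<close> is bounded in \<open>L\<^sup>r(v)\<close>. So all variable exponents are absorbed
  in a pointwise factorization, and Hoelder's inequality with the constant exponents \<open>\<sigma>\<close>, \<open>\<sigma>'\<close> on a ball gives
  \<open>M\<^sub>\<alpha> f \<le> (M F)\<^sup>1\<^sup>/\<^sup>\<sigma>\<close> pointwise. The boundedness of \<open>M\<close> on \<open>L\<^sup>r(v)\<close> is then the estimate for \<open>M\<^sub>\<alpha>\<close>.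

  For \<open>I\<^sub>\<alpha>\<close> one pairs with a function \<open>g\<close> for which \<open>\<psi> = (g/w)\<^sup>q'\<close> has integral at most \<open>1\<close>
  (\<open>modular_le_1_of_dual_bound\<close>). By the second relation \<open>g = G\<^sup>1\<^sup>/\<^sup>\<sigma> \<psi>\<^sup>1\<^sup>/\<^sup>\<sigma>'\<close> with \<open>G\<close> bounded in \<open>L\<^sup>r'(v\<^sup>-\<^sup>1)\<close>. The
  Rubio de Francia algorithm (\<open>Rubio_de_Francia\<close>, \<open>factor_through_A1_weight\<close>) replaces \<open>F\<close> and \<open>G\<close> by majorants
  \<open>u\<close> and \<open>z\<close> with \<open>M u \<le> A u\<close> and \<open>M z \<le> A z\<close>; the integral of \<open>u z\<close> is bounded because the two spaces are dual.
  What remains is the statement \<open>riesz_form_bounded\<close> about two such weights, without variable exponents.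

  There, the kernel \<open>|x - y|\<^sup>\<alpha>\<^sup>-\<^sup>n\<close> is a sum over dyadic scales, which bounds the form by the sum over \<open>k\<close> of
  \<open>2\<^sup>k\<^sup>\<alpha>\<close> times the integral of the product of the means \<open>f\<^sub>k\<close>, \<open>g\<^sub>k\<close> over balls of radius \<open>2\<^sup>k\<close>. Hoelder's inequality
  gives \<open>f\<^sub>k \<le> C u\<^sup>1\<^sup>/\<^sup>\<sigma> 2\<^sup>-\<^sup>k\<^sup>\<alpha>\<close>. On the other hand \<open>f = a u\<close> with \<open>a = (\<phi>/u)\<^sup>1\<^sup>/\<^sup>\<sigma>'\<close>, and the means of \<open>f\<close> are at most
  \<open>A u\<close> times the maximal function of \<open>a\<close> with respect to the measure \<open>u dx\<close>. That measure is doubling, so this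
  maximal operator is bounded on its \<open>L\<^sup>\<sigma>'\<close> (\<open>dyadic_maxop_strong_type\<close>). Hence \<open>f\<^sub>k \<le> C u\<^sup>1\<^sup>/\<^sup>\<sigma> min(P, 2\<^sup>-\<^sup>k\<^sup>\<alpha>)\<close> where
  \<open>P\<^sup>\<sigma>'\<close> is integrable, and likewise for \<open>g\<^sub>k\<close> with some \<open>Q\<close>. The minimum makes the sum over the scales geometric
  in both directions, with value at most \<open>C (u z)\<^sup>1\<^sup>/\<^sup>\<sigma> max(P, Q)\<close>, which is integrable by Young's inequality.
\<close>

section \<open>Powers of extended non-negative numbers\<close>

lemma ennreal_divide_mult_cancel:
  assumes "b \<noteq> 0" "b \<noteq> top"
  shows "a / b * b = (a :: ennreal)"
proof -
  have "a / b * b = a * b / b" by (simp add: ennreal_times_divide mult.commute)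
  also have "\<dots> = a" using assms by (rule ennreal_mult_divide_eq)
  finally show ?thesis .
qed

lemma ennreal_add_le_imp_le: "a + b \<le> c \<Longrightarrow> a \<le> c" "a + b \<le> c \<Longrightarrow> b \<le> c" for a b c :: ennreal
  by (auto elim: order_trans[rotated])

lemma ennpowr_0 [simp]: "ennpowr 0 a = 0"
  by (simp add: ennpowr_def)

lemma ennpowr_top [simp]: "ennpowr \<infinity> a = \<infinity>" "ennpowr top a = top"
  by (simp_all add: ennpowr_def)

lemma ennpowr_ennreal: "0 \<le> t \<Longrightarrow> ennpowr (ennreal t) a = ennreal (t powr a)"
  by (simp add: ennpowr_def)

lemma ennpowr_one [simp]: "ennpowr 1 a = 1"
  by (simp add: ennpowr_def)

lemma ennpowr_exponent_1 [simp]: "ennpowr t 1 = t"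
  by (cases t) (auto simp: ennpowr_ennreal)

lemma ennpowr_eq_0_iff [simp]: "ennpowr t a = 0 \<longleftrightarrow> t = 0"
  by (cases t) (auto simp: ennpowr_ennreal ennreal_eq_0_iff)

lemma ennpowr_eq_top_iff [simp]: "ennpowr t a = top \<longleftrightarrow> t = top"
  by (cases t) (auto simp: ennpowr_ennreal)

lemma ennpowr_mono:
  assumes "s \<le> t" "0 \<le> a"
  shows "ennpowr s a \<le> ennpowr t a"
proof (cases t)
  case (real y)
  moreover from real assms(1) obtain x where "s = ennreal x" "0 \<le> x"
    by (cases s) (auto simp: top_unique)
  ultimately show ?thesis
    using assms by (auto simp: ennpowr_ennreal intro!: ennreal_leI powr_mono2)
qed simp

lemma ennpowr_mult:
  assumes "0 < a"
  shows "ennpowr (s * t) a = ennpowr s a * ennpowr t a"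
proof -
  consider "s = 0" | "t = 0" | "s \<noteq> 0" "t \<noteq> 0" "s = top \<or> t = top"
    | x y where "s = ennreal x" "0 \<le> x" "t = ennreal y" "0 \<le> y"
    by (cases s; cases t) auto
  then show ?thesis
  proof cases
    case 3
    then show ?thesis by (auto simp: ennreal_mult_eq_top_iff ennreal_top_mult ennreal_mult_top)
  next
    case 4
    then show ?thesis by (simp add: ennpowr_ennreal powr_mult flip: ennreal_mult)
  qed auto
qed

lemma ennpowr_add: "ennpowr t (a + b) = ennpowr t a * ennpowr t b"
  by (cases t) (auto simp: ennpowr_ennreal powr_add ennreal_mult ennreal_top_mult)

lemma ennpowr_ennpowr: "ennpowr (ennpowr t a) b = ennpowr t (a * b)"
  by (cases t) (auto simp: ennpowr_ennreal powr_powr)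

lemma ennpowr_inverse:
  assumes "0 < a"
  shows "ennpowr (inverse t) a = inverse (ennpowr t a)"
proof -
  consider "t = 0" | "t = top" | x where "t = ennreal x" "0 < x"
    by (cases t) (auto simp: less_le)
  then show ?thesis
    by cases (auto simp: ennpowr_ennreal inverse_ennreal inverse_powr powr_minus)
qed

lemma ennpowr_divide:
  assumes "0 < a"
  shows "ennpowr (s / t) a = ennpowr s a / ennpowr t a"
  by (simp add: divide_ennreal_def ennpowr_mult ennpowr_inverse assms)

lemma measurable_ennpowr [measurable]:
  assumes [measurable]: "g \<in> borel_measurable M" "a \<in> borel_measurable M"
  shows "(\<lambda>x. ennpowr (g x) (a x)) \<in> borel_measurable M"
  unfolding ennpowr_def by measurable

lemma ennpowr_cmult_le:
  assumes "c \<le> 1" "1 \<le> a"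
  shows "ennpowr (c * t) a \<le> c * ennpowr t a"
proof -
  have "ennpowr c a \<le> c"
  proof (cases c)
    case (real r)
    moreover from this assms have "r \<le> 1" by (metis ennreal_le_1)
    ultimately show ?thesis
      using assms powr_mono'[of 1 a r] by (auto simp: ennpowr_ennreal intro!: ennreal_leI)
  qed (use assms in auto)
  then show ?thesis
    using assms by (simp add: ennpowr_mult mult_right_mono)
qed

text \<open>An average is at most the supremum of its terms, and the power of the supremum is at most the sum
  of the powers. This crude bound replaces convexity in the summation of the iterated maximal functions.\<close>

lemma ennpowr_dyadic_average_le_suminf:
  fixes b :: "nat \<Rightarrow> ennreal"
  assumes "0 < a"
  shows "ennpowr (\<Sum>k. ennreal ((1/2) ^ Suc k) * b k) a \<le> (\<Sum>k. ennpowr (b k) a)"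
proof -
  let ?s = "SUP k. b k"
  have half: "(\<Sum>k. ennreal ((1/2) ^ Suc k)) = 1"
    using power_half_series by (simp add: sums_unique[symmetric] suminf_ennreal_eq)
  have "(\<Sum>k. ennreal ((1/2) ^ Suc k) * b k) \<le> (\<Sum>k. ennreal ((1/2) ^ Suc k) * ?s)"
    by (intro suminf_le mult_left_mono SUP_upper) auto
  also have "\<dots> = ?s" by (simp add: half del: power_Suc)
  finally have 1: "(\<Sum>k. ennreal ((1/2) ^ Suc k) * b k) \<le> ?s" .
  have bound: "b k \<le> ennpowr (\<Sum>k. ennpowr (b k) a) (1/a)" for k
  proof -
    have "ennpowr (b k) a \<le> (\<Sum>k. ennpowr (b k) a)"
      using sum_le_suminf[of "\<lambda>k. ennpowr (b k) a" "{k}"] by simp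
    from ennpowr_mono[OF this, of "1/a"] assms show ?thesis
      by (simp add: ennpowr_ennpowr)
  qed
  then have "?s \<le> ennpowr (\<Sum>k. ennpowr (b k) a) (1/a)" by (rule SUP_least)
  with 1 have "ennpowr (\<Sum>k. ennreal ((1/2) ^ Suc k) * b k) a \<le> ennpowr (ennpowr (\<Sum>k. ennpowr (b k) a) (1/a)) a"
    using assms by (intro ennpowr_mono) auto
  also have "\<dots> = (\<Sum>k. ennpowr (b k) a)"
    using assms by (simp add: ennpowr_ennpowr)
  finally show ?thesis .
qed

lemma ennpowr_weighted_AM_GM:
  assumes "1 < a" "1/a + 1/b = 1"
  shows "ennpowr s (1/a) * ennpowr t (1/b) \<le> ennreal (1/a) * s + ennreal (1/b) * t"
proof -
  have b: "0 < b"
  proof -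
    have "1/b = 1 - 1/a" "1/a < 1" using assms by (auto simp: field_simps)
    then have "1/b > 0" by linarith
    then show ?thesis by simp
  qed
  consider "s = top" | "t = top" | x y where "s = ennreal x" "0 \<le> x" "t = ennreal y" "0 \<le> y"
    by (cases s; cases t) auto
  then show ?thesis
  proof cases
    case 3
    have "x powr (1/a) * y powr (1/b) \<le> 1/a * x + 1/b * y"
    proof (cases "x = 0 \<or> y = 0")
      case True
      then show ?thesis using 3 assms b by auto
    next
      case False
      then have pos: "x > 0" "y > 0" using 3 by auto
      have *: "1 - 1/b = 1/a" using assms by linarith
      moreover have "0 \<le> 1/a" "0 \<le> 1/b" using assms b by auto
      moreover from this * have "1/b \<le> 1" by linarith
      ultimately
      have "exp (1/a * ln x + 1/b * ln y) \<le> 1/a * exp (ln x) + 1/b * exp (ln y)"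
        using convex_onD[OF exp_convex, of "1/b" "ln x" "ln y"] by simp
      then show ?thesis using pos by (simp add: powr_def exp_add)
    qed
    then show ?thesis using 3 assms b
      by (simp add: ennpowr_ennreal ennreal_leI flip: ennreal_mult ennreal_plus)
  qed (use assms b in \<open>auto simp: ennreal_mult_top\<close>)
qed

lemma ennreal_Young:
  assumes "1 < a" "1/a + 1/b = 1"
  shows "s * t \<le> ennpowr s a + ennpowr t b"
proof -
  have b: "1 < b"
  proof -
    have *: "1/b = 1 - 1/a" "1/a < 1" "1/a > 0" using assms by (auto simp: field_simps)
    then have "1/b > 0" "1/b < 1" by linarith+
    then show ?thesis by (auto simp: divide_less_eq split: if_splits)
  qed
  have "s * t = ennpowr (ennpowr s a) (1/a) * ennpowr (ennpowr t b) (1/b)"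
    using assms b by (simp add: ennpowr_ennpowr)
  also have "\<dots> \<le> ennreal (1/a) * ennpowr s a + ennreal (1/b) * ennpowr t b"
    by (rule ennpowr_weighted_AM_GM[OF assms])
  also have "\<dots> \<le> 1 * ennpowr s a + 1 * ennpowr t b"
    using assms b by (intro add_mono mult_right_mono) auto
  finally show ?thesis by simp
qed

text \<open>Hoelder's inequality, after rescaling \<open>f\<close> to integral \<open>1\<close>, is the integrated inequality of the
  weighted arithmetic and geometric means.\<close>

lemma nn_integral_Hoelder_le:
  assumes [measurable]: "f \<in> borel_measurable M" "g \<in> borel_measurable M"
    and ab: "1 < a" "1/a + 1/b = 1" and g: "(\<integral>\<^sup>+x. g x \<partial>M) \<le> 1"
  shows "(\<integral>\<^sup>+x. ennpowr (f x) (1/a) * ennpowr (g x) (1/b) \<partial>M) \<le> ennpowr (\<integral>\<^sup>+x. f x \<partial>M) (1/a)"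
proof -
  have b: "0 < 1/b" using ab by (smt (verit) divide_less_eq_1_pos)
  consider "integral\<^sup>N M f = 0" | "integral\<^sup>N M f = top" | T where "integral\<^sup>N M f = ennreal T" "0 < T"
    by (cases "integral\<^sup>N M f") (auto simp: less_le)
  then show ?thesis
  proof cases
    case 1
    then have "AE x in M. f x = 0" by (simp add: nn_integral_0_iff_AE)
    then have "(\<integral>\<^sup>+x. ennpowr (f x) (1/a) * ennpowr (g x) (1/b) \<partial>M) = (\<integral>\<^sup>+x. 0 \<partial>M)"
      by (intro nn_integral_cong_AE) auto
    then show ?thesis by simp
  next
    case 3
    let ?c = "ennpowr (ennreal T) (1/a)"
    have T: "ennreal T / ennreal T = 1" using 3 by (simp add: divide_ennreal)
    have eq: "ennpowr y (1/a) = ?c * ennpowr (y / ennreal T) (1/a)" for y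
    proof -
      have "y = ennreal T * (y / ennreal T)"
        using T by (metis ennreal_times_divide ennreal_divide_times mult.right_neutral mult.commute)
      then show ?thesis using ab by (metis ennpowr_mult zero_less_divide_1_iff less_trans zero_less_one)
    qed
    have "(\<integral>\<^sup>+x. ennpowr (f x) (1/a) * ennpowr (g x) (1/b) \<partial>M)
      = (\<integral>\<^sup>+x. ?c * (ennpowr (f x / ennreal T) (1/a) * ennpowr (g x) (1/b)) \<partial>M)"
      by (intro nn_integral_cong) (subst eq, simp add: mult.assoc)
    also have "\<dots> = ?c * (\<integral>\<^sup>+x. ennpowr (f x / ennreal T) (1/a) * ennpowr (g x) (1/b) \<partial>M)"
      by (intro nn_integral_cmult) measurable
    also have "\<dots> \<le> ?c * (\<integral>\<^sup>+x. ennreal (1/a) * (f x / ennreal T) + ennreal (1/b) * g x \<partial>M)"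
      by (intro mult_left_mono nn_integral_mono ennpowr_weighted_AM_GM ab) auto
    also have "\<dots> = ?c * (ennreal (1/a) * (integral\<^sup>N M f / ennreal T) + ennreal (1/b) * integral\<^sup>N M g)"
      by (simp add: nn_integral_add nn_integral_cmult nn_integral_divide)
    also have "\<dots> \<le> ?c * (ennreal (1/a) * 1 + ennreal (1/b) * 1)"
      using g 3 T by (intro mult_left_mono add_mono) auto
    also have "\<dots> = ?c" using ab b by (simp flip: ennreal_plus)
    finally show ?thesis using 3 by simp
  qed simp
qed

section \<open>The maximal operator on extended non-negative functions\<close>

definition maxop :: "('a::euclidean_space \<Rightarrow> ennreal) \<Rightarrow> 'a \<Rightarrow> ennreal" where
  "maxop g x = (SUP (c, r) \<in> {(c, r). 0 < r \<and> x \<in> ball c r}.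
     (\<integral>\<^sup>+y\<in>ball c r. g y \<partial>lborel) / emeasure lborel (ball c r))"

lemma ball_borel [measurable]: "ball c r \<in> sets borel" for c :: "'a::euclidean_space"
  by simp

lemma emeasure_ball_pos: "0 < r \<Longrightarrow> emeasure lborel (ball c r) > 0"
  by (simp add: emeasure_ball content_ball_pos)

lemma maximal_eq_maxop: "maximal f = maxop (\<lambda>y. ennreal \<bar>f y\<bar>)"
  by (simp add: fun_eq_iff maximal_def maxop_def nn_integral_completion)

lemma maxop_upper:
  assumes "0 < r" "x \<in> ball c r"
  shows "(\<integral>\<^sup>+y\<in>ball c r. g y \<partial>lborel) \<le> emeasure lborel (ball c r) * maxop g x"
proof -
  have le: "(\<integral>\<^sup>+y\<in>ball c r. g y \<partial>lborel) / emeasure lborel (ball c r) \<le> maxop g x"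
    unfolding maxop_def using assms by (intro SUP_upper2[of "(c, r)"]) auto
  have "emeasure lborel (ball c r) \<noteq> 0" "emeasure lborel (ball c r) \<noteq> top"
    using emeasure_ball_pos[OF assms(1), of c] emeasure_lborel_ball_finite[of c r] by auto
  then have "(\<integral>\<^sup>+y\<in>ball c r. g y \<partial>lborel)
      = emeasure lborel (ball c r) * ((\<integral>\<^sup>+y\<in>ball c r. g y \<partial>lborel) / emeasure lborel (ball c r))"
    by (simp add: ennreal_times_divide mult.commute[of "emeasure lborel (ball c r)"] ennreal_mult_divide_eq)
  also have "\<dots> \<le> emeasure lborel (ball c r) * maxop g x"
    using le by (rule mult_left_mono) simp
  finally show ?thesis .
qed

lemma maxop_least:
  assumes "\<And>c r. 0 < r \<Longrightarrow> x \<in> ball c r \<Longrightarrow>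
    (\<integral>\<^sup>+y\<in>ball c r. g y \<partial>lborel) / emeasure lborel (ball c r) \<le> b"
  shows "maxop g x \<le> b"
  unfolding maxop_def using assms by (intro SUP_least) auto

text \<open>The balls are open and their centres are arbitrary, so the maximal function is lower
  semicontinuous: its superlevel sets are unions of balls.\<close>

lemma borel_measurable_maxop [measurable]: "maxop g \<in> borel_measurable borel"
proof (rule borel_measurableI_greater)
  fix a :: ennreal
  have "{x. a < maxop g x} = (\<Union>(c, r) \<in> {(c, r). 0 < r \<and>
      a < (\<integral>\<^sup>+y\<in>ball c r. g y \<partial>lborel) / emeasure lborel (ball c r)}. ball c r)"
    by (auto simp: maxop_def less_SUP_iff) blast
  then have "open {x. a < maxop g x}" by auto
  then show "{x \<in> space borel. a < maxop g x} \<in> sets borel" by simp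
qed

lemma maxop_cong_AE:
  assumes "AE y in lborel. g y = h y"
  shows "maxop g = maxop h"
proof -
  have "(\<integral>\<^sup>+y\<in>ball c r. g y \<partial>lborel) = (\<integral>\<^sup>+y\<in>ball c r. h y \<partial>lborel)" for c r
    using assms by (intro nn_integral_cong_AE) auto
  then show ?thesis by (simp add: maxop_def fun_eq_iff)
qed

lemma maxop_suminf_le:
  fixes c :: "nat \<Rightarrow> ennreal"
  assumes [measurable]: "\<And>k. g k \<in> borel_measurable borel"
  shows "maxop (\<lambda>y. \<Sum>k. c k * g k y) x \<le> (\<Sum>k. c k * maxop (g k) x)"
proof (rule maxop_least)
  fix z r assume r: "0 < r" "x \<in> ball z r"
  let ?V = "emeasure lborel (ball z r)"
  have "(\<integral>\<^sup>+y\<in>ball z r. (\<Sum>k. c k * g k y) \<partial>lborel)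
      = (\<integral>\<^sup>+y. (\<Sum>k. c k * (g k y * indicator (ball z r) y)) \<partial>lborel)"
    by (intro nn_integral_cong) (auto simp: indicator_def)
  also have "\<dots> = (\<Sum>k. c k * (\<integral>\<^sup>+y\<in>ball z r. g k y \<partial>lborel))"
    by (subst nn_integral_suminf) (measurable, simp add: nn_integral_cmult)
  finally have "(\<integral>\<^sup>+y\<in>ball z r. (\<Sum>k. c k * g k y) \<partial>lborel) / ?V
      = (\<Sum>k. c k * (\<integral>\<^sup>+y\<in>ball z r. g k y \<partial>lborel)) / ?V" by simp
  also have "\<dots> = (\<Sum>k. c k * ((\<integral>\<^sup>+y\<in>ball z r. g k y \<partial>lborel) / ?V))"
    by (simp add: divide_ennreal_def mult.assoc flip: ennreal_suminf_multc)
  also have "\<dots> \<le> (\<Sum>k. c k * maxop (g k) x)"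
    using r by (intro suminf_le mult_left_mono) (auto simp: maxop_def intro!: SUP_upper2[of "(z, r)"])
  finally show "(\<integral>\<^sup>+y\<in>ball z r. (\<Sum>k. c k * g k y) \<partial>lborel) / ?V \<le> (\<Sum>k. c k * maxop (g k) x)" .
qed

section \<open>Variable exponent norms\<close>

text \<open>The closed unit ball of the norm, with the essential supremum replaced by an arbitrary
  almost everywhere bound. In this form the condition makes sense without any measurability of
  \<open>h\<close> and passes to pointwise smaller functions.\<close>

definition unit_ball :: "('a::euclidean_space \<Rightarrow> ennreal) \<Rightarrow> ('a \<Rightarrow> ennreal) \<Rightarrow> bool" where
  "unit_ball s h \<longleftrightarrow> (\<exists>E. (\<integral>\<^sup>+x\<in>{x. s x \<noteq> \<infinity>}. ennpowr (h x) (enn2real (s x)) \<partial>lebesgue) + E \<le> 1 \<and>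
     (AE x in lebesgue. s x = \<infinity> \<longrightarrow> h x \<le> E))"

lemma unit_ball_mono:
  assumes "unit_ball s h" "AE x in lebesgue. g x \<le> h x"
  shows "unit_ball s g"
proof -
  obtain E where E: "(\<integral>\<^sup>+x\<in>{x. s x \<noteq> \<infinity>}. ennpowr (h x) (enn2real (s x)) \<partial>lebesgue) + E \<le> 1"
     "AE x in lebesgue. s x = \<infinity> \<longrightarrow> h x \<le> E"
    using assms unfolding unit_ball_def by blast
  have "(\<integral>\<^sup>+x\<in>{x. s x \<noteq> \<infinity>}. ennpowr (g x) (enn2real (s x)) \<partial>lebesgue)
    \<le> (\<integral>\<^sup>+x\<in>{x. s x \<noteq> \<infinity>}. ennpowr (h x) (enn2real (s x)) \<partial>lebesgue)"
    using assms(2) by (intro nn_integral_mono_AE) (auto intro!: mult_right_mono ennpowr_mono)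
  then have "(\<integral>\<^sup>+x\<in>{x. s x \<noteq> \<infinity>}. ennpowr (g x) (enn2real (s x)) \<partial>lebesgue) + E \<le> 1"
    using E(1) by (meson add_right_mono order_trans)
  moreover have "AE x in lebesgue. s x = \<infinity> \<longrightarrow> g x \<le> E"
    using E(2) assms(2) by eventually_elim auto
  ultimately show ?thesis unfolding unit_ball_def by blast
qed

lemma exponents_measurable [measurable_dest]: "s \<in> exponents \<Longrightarrow> s \<in> borel_measurable lebesgue"
  and exponents_ge_1: "s \<in> exponents \<Longrightarrow> 1 \<le> s x"
  by (auto simp: exponents_def)

lemma sets_exponent_finite:
  assumes [measurable]: "s \<in> borel_measurable lebesgue"
  shows "{x. s x \<noteq> (\<infinity> :: ennreal)} \<in> sets lebesgue" "{x. s x = (\<infinity> :: ennreal)} \<in> sets lebesgue"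
proof -
  have "{x \<in> space lebesgue. s x \<noteq> \<infinity>} \<in> sets lebesgue" "{x \<in> space lebesgue. s x = \<infinity>} \<in> sets lebesgue"
    by measurable
  then show "{x. s x \<noteq> \<infinity>} \<in> sets lebesgue" "{x. s x = \<infinity>} \<in> sets lebesgue" by simp_all
qed

lemma unit_ball_iff_vnorm_condition:
  assumes [measurable]: "s \<in> borel_measurable lebesgue" "g \<in> borel_measurable lebesgue" and l: "0 < l"
  shows "(\<integral>\<^sup>+x\<in>{x. s x \<noteq> \<infinity>}. ennpowr (g x / ennreal l) (enn2real (s x)) \<partial>lebesgue)
       + inverse (ennreal l) * esssup (restrict_space lebesgue {x. s x = \<infinity>}) g \<le> 1
     \<longleftrightarrow> unit_ball s (\<lambda>x. g x / ennreal l)" (is "?I + inverse ?l * ?e \<le> 1 \<longleftrightarrow> _")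
proof
  have set: "{x. s x = \<infinity>} \<inter> space lebesgue \<in> sets lebesgue"
    using sets_exponent_finite(2)[OF assms(1)] by simp
  have AE_restrict: "(AE x in restrict_space lebesgue {x. s x = \<infinity>}. P x) \<longleftrightarrow> (AE x in lebesgue. s x = \<infinity> \<longrightarrow> P x)" for P
    using set by (subst AE_restrict_space_iff) auto
  have div: "a / ?l = inverse ?l * a" for a by (simp add: divide_ennreal_def mult.commute)
  have ll: "inverse ?l * ?l = 1"
    using l by (simp add: inverse_ennreal flip: ennreal_mult)
  {
    assume "?I + inverse ?l * ?e \<le> 1"
    moreover have "AE x in lebesgue. s x = \<infinity> \<longrightarrow> g x / ?l \<le> inverse ?l * ?e"
      using esssup_AE[where M = "restrict_space lebesgue {x. s x = \<infinity>}" and f = g] unfolding AE_restrict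
      by eventually_elim (auto simp: div intro!: mult_left_mono)
    ultimately show "unit_ball s (\<lambda>x. g x / ?l)" unfolding unit_ball_def by blast
  }
  assume "unit_ball s (\<lambda>x. g x / ?l)"
  then obtain E where E: "?I + E \<le> 1" "AE x in lebesgue. s x = \<infinity> \<longrightarrow> g x / ?l \<le> E"
    unfolding unit_ball_def by blast
  have "AE x in restrict_space lebesgue {x. s x = \<infinity>}. g x \<le> ?l * E"
    unfolding AE_restrict using E(2)
  proof eventually_elim
    case (elim x)
    show ?case
    proof
      assume "s x = \<infinity>"
      with elim have "?l * (inverse ?l * g x) \<le> ?l * E" by (intro mult_left_mono) (auto simp: div)
      then show "g x \<le> ?l * E" using ll by (metis mult.assoc mult.commute mult_1)
    qed
  qed
  then have "?e \<le> ?l * E"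
    by (intro esssup_I) (auto intro: measurable_restrict_space1)
  then have "inverse ?l * ?e \<le> inverse ?l * (?l * E)" by (rule mult_left_mono) simp
  also have "\<dots> = E" using ll by (simp flip: mult.assoc)
  finally show "?I + inverse ?l * ?e \<le> 1" using E(1) by (meson add_left_mono order_trans)
qed

lemma vnorm_eq_Inf_unit_ball:
  assumes "s \<in> borel_measurable lebesgue" "g \<in> borel_measurable lebesgue"
  shows "vnorm s g = Inf (ennreal ` {l. 0 < l \<and> unit_ball s (\<lambda>x. g x / ennreal l)})"
  unfolding vnorm_def using unit_ball_iff_vnorm_condition[OF assms]
  by (intro arg_cong[where f = Inf] arg_cong[where f = "image ennreal"]) auto

lemma vnorm_le:
  assumes "s \<in> borel_measurable lebesgue" "g \<in> borel_measurable lebesgue"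
    and "0 < l" "unit_ball s (\<lambda>x. g x / ennreal l)"
  shows "vnorm s g \<le> ennreal l"
  unfolding vnorm_eq_Inf_unit_ball[OF assms(1,2)] using assms by (intro Inf_lower) auto

lemma unit_ball_of_vnorm_less:
  assumes "s \<in> borel_measurable lebesgue" "g \<in> borel_measurable lebesgue"
    and "vnorm s g < ennreal l"
  shows "unit_ball s (\<lambda>x. g x / ennreal l)"
proof -
  obtain l0 where l0: "0 < l0" "unit_ball s (\<lambda>x. g x / ennreal l0)" "ennreal l0 < ennreal l"
    using assms(3) unfolding vnorm_eq_Inf_unit_ball[OF assms(1,2)] by (auto simp: Inf_less_iff)
  have "g x / ennreal l \<le> g x / ennreal l0" for x
  proof -
    have "0 < l" "l0 \<le> l" using l0 by (auto simp: ennreal_less_iff)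
    then show ?thesis using l0 unfolding divide_ennreal_def
      by (intro mult_left_mono) (auto simp: inverse_ennreal intro!: ennreal_leI le_imp_inverse_le)
  qed
  then show ?thesis by (intro unit_ball_mono[OF l0(2)]) auto
qed

lemma vnorm_cong_AE:
  assumes "s \<in> borel_measurable lebesgue" "g \<in> borel_measurable lebesgue" "h \<in> borel_measurable lebesgue"
    and ae: "AE x in lebesgue. g x = h x"
  shows "vnorm s g = vnorm s h"
proof -
  have "unit_ball s (\<lambda>x. g x / ennreal l) \<longleftrightarrow> unit_ball s (\<lambda>x. h x / ennreal l)" for l
    using ae by (auto elim!: unit_ball_mono eventually_mono)
  then show ?thesis by (simp add: vnorm_eq_Inf_unit_ball assms)
qed

lemma unit_ball_finite_AE:
  assumes [measurable]: "s \<in> borel_measurable lebesgue" "h \<in> borel_measurable lebesgue" and "unit_ball s h"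
  shows "AE x in lebesgue. h x < \<infinity>"
proof -
  obtain E where E: "(\<integral>\<^sup>+x\<in>{x. s x \<noteq> \<infinity>}. ennpowr (h x) (enn2real (s x)) \<partial>lebesgue) + E \<le> 1"
     "AE x in lebesgue. s x = \<infinity> \<longrightarrow> h x \<le> E"
    using assms unfolding unit_ball_def by blast
  have "E \<le> 1" "(\<integral>\<^sup>+x\<in>{x. s x \<noteq> \<infinity>}. ennpowr (h x) (enn2real (s x)) \<partial>lebesgue) \<le> 1"
    using ennreal_add_le_imp_le[OF E(1)] by auto
  then have fin: "(\<integral>\<^sup>+x\<in>{x. s x \<noteq> \<infinity>}. ennpowr (h x) (enn2real (s x)) \<partial>lebesgue) \<noteq> \<infinity>" and "E < \<infinity>"
    by (auto simp: less_top intro: le_less_trans)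
  note [measurable] = sets_exponent_finite(1)[OF assms(1)]
  have "AE x in lebesgue. ennpowr (h x) (enn2real (s x)) * indicator {x. s x \<noteq> \<infinity>} x \<noteq> \<infinity>"
    by (rule nn_integral_noteq_infinite[OF _ fin]) measurable
  with E(2) show ?thesis
  proof eventually_elim
    case (elim x)
    then show ?case using \<open>E < \<infinity>\<close> by (cases "h x = top"; cases "s x = \<infinity>") (auto simp: less_top[symmetric] top_unique)
  qed
qed

lemma wnorm_finite_AE:
  assumes [measurable]: "s \<in> borel_measurable lebesgue" "g \<in> borel_measurable lebesgue"
    and w: "weight v" and fin: "wnorm s v g < \<infinity>"
  shows "AE x in lebesgue. g x < \<infinity>"
proof -
  from w have [measurable]: "v \<in> borel_measurable lebesgue" by (simp add: weight_def)
  obtain l where l: "wnorm s v g < ennreal l"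
  proof (cases "wnorm s v g")
    case (real a)
    then have "wnorm s v g < ennreal (a + 1)" by (simp add: ennreal_lessI)
    then show ?thesis by (rule that)
  qed (use fin in auto)
  then have "AE x in lebesgue. g x * v x / ennreal l < \<infinity>"
    unfolding wnorm_def by (intro unit_ball_finite_AE[of s] unit_ball_of_vnorm_less) auto
  with w[unfolded weight_def, THEN conjunct2] show ?thesis
  proof eventually_elim
    case (elim x)
    show ?case
    proof (rule ccontr)
      assume "\<not> g x < \<infinity>"
      then have "g x * v x / ennreal l = \<infinity>"
        using elim by (auto simp: less_top[symmetric] ennreal_top_mult divide_ennreal_def ennreal_mult_eq_top_iff)
      with elim show False by simp
    qed
  qed
qed

text \<open>Boundedness of the maximal operator is only postulated for finite functions; a function of
  finite norm is finite almost everywhere, so it carries over to extended functions.\<close>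

lemma maximal_bounded_imp_maxop_bounded:
  assumes bd: "maximal_bounded s v" and [measurable]: "s \<in> borel_measurable lebesgue" and w: "weight v"
  obtains N :: real where "1 \<le> N"
    "\<And>g. g \<in> borel_measurable lebesgue \<Longrightarrow> wnorm s v g < \<infinity> \<Longrightarrow> wnorm s v (maxop g) \<le> ennreal N * wnorm s v g"
proof -
  from w have [measurable]: "v \<in> borel_measurable lebesgue" by (simp add: weight_def)
  obtain C where C: "\<And>f. f \<in> Lspace s v \<Longrightarrow> wnorm s v (maximal f) \<le> ennreal C * wnorm s v (\<lambda>x. ennreal \<bar>f x\<bar>)"
    using bd unfolding maximal_bounded_def by blast
  show ?thesis
  proof (rule that[of "max 1 C"])
    fix g :: "'a \<Rightarrow> ennreal" assume [measurable]: "g \<in> borel_measurable lebesgue" and fin: "wnorm s v g < \<infinity>"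
    let ?f = "\<lambda>x. enn2real (g x)"
    have ae: "AE x in lebesgue. ennreal \<bar>?f x\<bar> = g x"
      using wnorm_finite_AE[OF _ _ w fin] by (auto simp: abs_of_nonneg)
    then have eq: "wnorm s v (\<lambda>x. ennreal \<bar>?f x\<bar>) = wnorm s v g"
      unfolding wnorm_def by (intro vnorm_cong_AE) (auto elim: eventually_mono)
    moreover have "AE x in lborel. ennreal \<bar>?f x\<bar> = g x"
      using ae by (simp add: AE_completion_iff)
    then have "maximal ?f = maxop g"
      unfolding maximal_eq_maxop by (rule maxop_cong_AE)
    moreover have "?f \<in> Lspace s v" using fin eq by (simp add: Lspace_def)
    ultimately have "wnorm s v (maxop g) \<le> ennreal C * wnorm s v g" using C[of ?f] by simp
    also have "\<dots> \<le> ennreal (max 1 C) * wnorm s v g" by (intro mult_right_mono ennreal_leI) auto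
    finally show "wnorm s v (maxop g) \<le> ennreal (max 1 C) * wnorm s v g" .
  qed simp
qed

lemma conj_exponent_simps:
  "conj_exponent 1 = \<infinity>" "conj_exponent \<infinity> = 1" "conj_exponent top = 1"
  by (simp_all add: conj_exponent_def)

lemma conj_exponent_ennreal:
  assumes "1 < s"
  shows "conj_exponent (ennreal s) = ennreal (s / (s - 1))"
proof -
  have "1 - inverse (ennreal s) = ennreal (1 - inverse s)"
    using assms by (simp add: inverse_ennreal ennreal_minus flip: ennreal_1)
  moreover have "1 - inverse s > 0" using assms by (simp add: field_simps)
  moreover have "inverse (1 - inverse s) = s / (s - 1)" using assms by (simp add: field_simps)
  ultimately show ?thesis by (simp add: conj_exponent_def inverse_ennreal)
qed

lemma conj_exponent_measurable [measurable (raw)]: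
  assumes [measurable]: "s \<in> borel_measurable M"
  shows "(\<lambda>x. conj_exponent (s x)) \<in> borel_measurable M"
  unfolding conj_exponent_def by measurable

lemma ge_1_cases:
  fixes s :: ennreal
  assumes "1 \<le> s"
  obtains "s = 1" | "s = \<infinity>" | r where "s = ennreal r" "1 < r"
proof (cases s)
  case (real r)
  then have "1 \<le> r" using assms by (metis ennreal_le_iff ennreal_1 le_cases order.trans)
  then show ?thesis using real that by (cases "r = 1") auto
qed (use that in auto)

text \<open>The Hoelder inequality between a variable exponent and its conjugate follows from Young's
  inequality in every point where both exponents are finite, and from the essential bound on one
  factor where the exponent is \<open>1\<close> or \<open>\<infinity>\<close>.\<close>

lemma nn_integral_mult_le_of_unit_balls:
  assumes s: "s \<in> exponents"
    and a: "a \<in> borel_measurable lebesgue" "unit_ball s a"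
    and b: "b \<in> borel_measurable lebesgue" "unit_ball (\<lambda>x. conj_exponent (s x)) b"
  shows "(\<integral>\<^sup>+x. a x * b x \<partial>lebesgue) \<le> 2"
proof -
  note [measurable] = a(1) b(1) exponents_measurable[OF s]
  let ?A = "\<lambda>x. ennpowr (a x) (enn2real (s x)) * indicator {x. s x \<noteq> \<infinity>} x"
  let ?B = "\<lambda>x. ennpowr (b x) (enn2real (conj_exponent (s x))) * indicator {x. conj_exponent (s x) \<noteq> \<infinity>} x"
  have [measurable]: "{x. s x \<noteq> \<infinity>} \<in> sets lebesgue" "{x. conj_exponent (s x) \<noteq> \<infinity>} \<in> sets lebesgue"
    by (rule sets_exponent_finite, measurable)+
  obtain E where E: "integral\<^sup>N lebesgue ?A + E \<le> 1" "AE x in lebesgue. s x = \<infinity> \<longrightarrow> a x \<le> E"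
    using a(2) unfolding unit_ball_def by blast
  obtain E' where E': "integral\<^sup>N lebesgue ?B + E' \<le> 1" "AE x in lebesgue. conj_exponent (s x) = \<infinity> \<longrightarrow> b x \<le> E'"
    using b(2) unfolding unit_ball_def by blast
  have le1: "E \<le> 1" "E' \<le> 1" "integral\<^sup>N lebesgue ?A \<le> 1" "integral\<^sup>N lebesgue ?B \<le> 1"
    using ennreal_add_le_imp_le[OF E(1)] ennreal_add_le_imp_le[OF E'(1)] by auto
  have "AE x in lebesgue. a x * b x \<le> ?A x + ?B x"
    using E(2) E'(2)
  proof eventually_elim
    case (elim x)
    from exponents_ge_1[OF s, of x] show ?case
    proof (cases rule: ge_1_cases)
      case 1
      then have "a x * b x \<le> a x * 1" using elim le1 by (intro mult_left_mono) (auto simp: conj_exponent_simps)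
      then show ?thesis using 1 by (simp add: conj_exponent_simps)
    next
      case 2
      then have "a x * b x \<le> 1 * b x" using elim le1 by (intro mult_right_mono) auto
      then show ?thesis using 2 by (simp add: conj_exponent_simps)
    next
      case (3 r)
      have "a x * b x \<le> ennpowr (a x) r + ennpowr (b x) (r / (r - 1))"
        using 3 by (intro ennreal_Young) (auto simp: field_simps)
      then show ?thesis using 3 by (simp add: conj_exponent_ennreal)
    qed
  qed
  then have "(\<integral>\<^sup>+x. a x * b x \<partial>lebesgue) \<le> (\<integral>\<^sup>+x. ?A x + ?B x \<partial>lebesgue)"
    by (rule nn_integral_mono_AE)
  also have "\<dots> = integral\<^sup>N lebesgue ?A + integral\<^sup>N lebesgue ?B"
    by (intro nn_integral_add) measurable
  also have "\<dots> \<le> 1 + 1" by (intro add_mono le1)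
  finally show ?thesis by simp
qed

text \<open>The weights \<open>v\<close> and \<open>1/v\<close> cancel in the pairing; \<open>288 = 12 * 12 * 2\<close>.\<close>

lemma nn_integral_mult_le_of_weighted_unit_balls:
  fixes r v z u :: "'a::euclidean_space \<Rightarrow> ennreal"
  assumes r: "r \<in> exponents" and v: "weight v"
    and "z \<in> borel_measurable borel" "u \<in> borel_measurable borel"
    and "unit_ball r (\<lambda>x. z x * v x / 12)"
    and "unit_ball (\<lambda>x. conj_exponent (r x)) (\<lambda>x. u x * inverse (v x) / 12)"
  shows "(\<integral>\<^sup>+x. u x * z x \<partial>lborel) \<le> ennreal 288"
proof -
  have [measurable]: "z \<in> borel_measurable lebesgue" "u \<in> borel_measurable lebesgue"
    using assms(3,4) by (simp_all add: measurable_completion)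
  have [measurable]: "v \<in> borel_measurable lebesgue" using v by (simp add: weight_def)
  have "(\<integral>\<^sup>+x. u x * z x \<partial>lebesgue) = (\<integral>\<^sup>+x. 144 * ((z x * v x / 12) * (u x * inverse (v x) / 12)) \<partial>lebesgue)"
  proof (rule nn_integral_cong_AE)
    show "AE x in lebesgue. u x * z x = 144 * ((z x * v x / 12) * (u x * inverse (v x) / 12))"
      using v[unfolded weight_def, THEN conjunct2]
    proof eventually_elim
      case (elim x)
      have "v x / v x = 1" using elim by (intro ennreal_divide_self) auto
      then have vv: "v x * inverse (v x) = 1" by (simp add: divide_ennreal_def)
      have tw: "(144 :: ennreal) * (inverse 12 * inverse 12) = 1"
      proof -
        have "(144 :: ennreal) = ennreal 144" "(12 :: ennreal) = ennreal 12" by simp_all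
        moreover have "ennreal 144 * (inverse (ennreal 12) * inverse (ennreal 12)) = 1"
          by (subst (1 2) inverse_ennreal) (simp_all flip: ennreal_mult ennreal_1 del: ennreal_numeral)
        ultimately show ?thesis by (simp only:)
      qed
      have "144 * ((z x * v x / 12) * (u x * inverse (v x) / 12))
        = (144 * (inverse 12 * inverse 12)) * (v x * inverse (v x)) * (u x * z x)"
        unfolding divide_ennreal_def by (simp only: mult_ac)
      then show ?case unfolding tw vv by simp
    qed
  qed
  also have "\<dots> = 144 * (\<integral>\<^sup>+x. (z x * v x / 12) * (u x * inverse (v x) / 12) \<partial>lebesgue)"
    by (intro nn_integral_cmult) measurable
  also have "\<dots> \<le> 144 * 2"
  proof (rule mult_left_mono)
    show "(\<integral>\<^sup>+x. (z x * v x / 12) * (u x * inverse (v x) / 12) \<partial>lebesgue) \<le> 2"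
      by (rule nn_integral_mult_le_of_unit_balls[OF r _ assms(5) _ assms(6)]) measurable
  qed simp
  finally show ?thesis
    by (simp add: nn_integral_completion)
qed

section \<open>The Rubio de Francia algorithm\<close>

lemma suminf_Suc_le: "(\<Sum>k. f (Suc k)) \<le> (\<Sum>k. f k :: ennreal)"
proof (rule suminf_le_const)
  fix n
  have "sum (\<lambda>k. f (Suc k)) {..<n} = sum f (Suc ` {..<n})" by (simp add: sum.reindex)
  also have "\<dots> \<le> (\<Sum>k. f k)" by (intro sum_le_suminf) auto
  finally show "sum (\<lambda>k. f (Suc k)) {..<n} \<le> (\<Sum>k. f k)" .
qed auto

text \<open>If the maximal operator has norm at most \<open>N\<close>, the series \<open>u = \<Sum>k. M\<^sup>k F / (4 N)\<^sup>k\<close> of iterated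
  maximal functions converges in norm. It starts with \<open>F\<close>, and applying the maximal operator shifts it
  by one term, so \<open>M u \<le> 4 N u\<close>. The factor \<open>4\<close> instead of \<open>2\<close> pays for bounding the power of an average by a
  sum of powers.\<close>

theorem Rubio_de_Francia:
  fixes N :: real and F v :: "'a::euclidean_space \<Rightarrow> ennreal"
  assumes s: "s \<in> exponents" and w: "weight v" and N: "1 \<le> N"
    and bd: "\<And>g. g \<in> borel_measurable lebesgue \<Longrightarrow> wnorm s v g < \<infinity> \<Longrightarrow> wnorm s v (maxop g) \<le> ennreal N * wnorm s v g"
    and F: "F \<in> borel_measurable lebesgue" "unit_ball s (\<lambda>x. F x * v x / 2)"
  obtains u where "u \<in> borel_measurable borel" "AE x in lebesgue. F x \<le> u x"
    "\<And>x. maxop u x \<le> ennreal (4 * N) * u x" "unit_ball s (\<lambda>x. u x * v x / 12)"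
proof -
  note [measurable] = F(1) exponents_measurable[OF s]
  from w have [measurable]: "v \<in> borel_measurable lebesgue" by (simp add: weight_def)
  obtain F0 where F0 [measurable]: "F0 \<in> borel_measurable borel" and "AE x in lborel. F x = F0 x"
    using completion_ex_borel_measurable[of F lborel] F(1) by auto
  then have F_eq: "AE x in lebesgue. F x = F0 x" by (simp add: AE_completion_iff)
  define M where "M k = (maxop ^^ k) F0" for k
  have M_0: "M 0 = F0" and M_Suc: "M (Suc k) = maxop (M k)" for k by (simp_all add: M_def)
  have M_borel [measurable]: "M k \<in> borel_measurable borel" for k
    by (cases k) (auto simp: M_0 M_Suc)
  then have [measurable]: "M k \<in> borel_measurable lebesgue" for k
    by (simp add: measurable_completion)
  have M_norm: "wnorm s v (M k) \<le> ennreal (2 * N ^ k)" for k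
  proof (induction k)
    case 0
    have "unit_ball s (\<lambda>x. F0 x * v x / ennreal 2)"
      using F_eq by (intro unit_ball_mono[OF F(2)]) (auto elim: eventually_mono)
    then show ?case unfolding wnorm_def M_0 by (simp, intro vnorm_le[of s _ 2, simplified]) (auto simp flip: M_0)
  next
    case (Suc k)
    then have "wnorm s v (M k) < \<infinity>" by (simp add: le_less_trans)
    then have "wnorm s v (M (Suc k)) \<le> ennreal N * wnorm s v (M k)"
      unfolding M_Suc by (intro bd) auto
    also have "\<dots> \<le> ennreal N * ennreal (2 * N ^ k)" using Suc by (intro mult_left_mono) auto
    also have "\<dots> = ennreal (2 * N ^ Suc k)" using N by (simp add: mult_ac flip: ennreal_mult)
    finally show ?case .
  qed
  define a where "a k x = M k x * v x / ennreal (3 * N ^ k)" for k x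
  have [measurable]: "a k \<in> borel_measurable lebesgue" for k unfolding a_def by measurable
  have "unit_ball s (a k)" for k
    unfolding a_def
  proof (rule unit_ball_of_vnorm_less)
    have "vnorm s (\<lambda>x. M k x * v x) \<le> ennreal (2 * N ^ k)" using M_norm unfolding wnorm_def .
    also have "\<dots> < ennreal (3 * N ^ k)" using N by (intro ennreal_lessI) auto
    finally show "vnorm s (\<lambda>x. M k x * v x) < ennreal (3 * N ^ k)" .
  qed measurable
  then have "\<forall>k. \<exists>E. (\<integral>\<^sup>+x\<in>{x. s x \<noteq> \<infinity>}. ennpowr (a k x) (enn2real (s x)) \<partial>lebesgue) + E \<le> 1 \<and>
      (AE x in lebesgue. s x = \<infinity> \<longrightarrow> a k x \<le> E)"
    unfolding unit_ball_def by (rule allI)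
  from choice[OF this] obtain E where
    E: "\<And>k. (\<integral>\<^sup>+x\<in>{x. s x \<noteq> \<infinity>}. ennpowr (a k x) (enn2real (s x)) \<partial>lebesgue) + E k \<le> 1"
       "\<And>k. AE x in lebesgue. s x = \<infinity> \<longrightarrow> a k x \<le> E k"
    by auto
  define c where "c = 1 / (4 * N)"
  have c: "0 < c" "4 * N * c = 1" using N by (simp_all add: c_def)
  define u where "u x = (\<Sum>k. ennreal (c ^ k) * M k x)" for x
  let ?h = "\<lambda>k. ennreal ((1/2) ^ Suc k)"
  have half: "(\<Sum>k. ?h k) = 1"
    using power_half_series by (simp add: sums_unique[symmetric] suminf_ennreal_eq del: power_Suc)
  show ?thesis
  proof
    show "u \<in> borel_measurable borel" unfolding u_def by measurable
    have "F0 x \<le> u x" for x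
      using sum_le_suminf[of "\<lambda>k. ennreal (c ^ k) * M k x" "{0}"] by (simp add: u_def M_0)
    then show "AE x in lebesgue. F x \<le> u x" using F_eq by (auto elim: eventually_mono)
    show "maxop u x \<le> ennreal (4 * N) * u x" for x
    proof -
      have "maxop u x \<le> (\<Sum>k. ennreal (c ^ k) * maxop (M k) x)"
        unfolding u_def by (rule maxop_suminf_le) simp
      also have "\<dots> = (\<Sum>k. ennreal (4 * N) * (ennreal (c ^ Suc k) * M (Suc k) x))"
      proof (intro arg_cong[where f = suminf] ext)
        fix k
        have "4 * N * c ^ Suc k = c ^ k" using c(2) by (simp flip: mult.assoc)
        moreover have "ennreal (4 * N) * ennreal (c ^ Suc k) = ennreal (4 * N * c ^ Suc k)"
          using N c(1) by (intro ennreal_mult[symmetric]) auto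
        ultimately show "ennreal (c ^ k) * maxop (M k) x = ennreal (4 * N) * (ennreal (c ^ Suc k) * M (Suc k) x)"
          by (simp only: M_Suc mult.assoc[symmetric])
      qed
      also have "\<dots> = ennreal (4 * N) * (\<Sum>k. ennreal (c ^ Suc k) * M (Suc k) x)"
        by (rule ennreal_suminf_cmult)
      also have "\<dots> \<le> ennreal (4 * N) * u x"
        unfolding u_def by (intro mult_left_mono suminf_Suc_le) auto
      finally show ?thesis .
    qed
    \<comment> \<open>Of the two factors \<open>2\<^sup>-\<^sup>k\<^sup>-\<^sup>1\<close>, one turns the sum into an average, the other makes the norms summable.\<close>
    have u_eq: "u x * v x / 12 = (\<Sum>k. ?h k * (?h k * a k x))" for x
    proof -
      have "u x * v x / 12 = (\<Sum>k. (ennreal (c ^ k) * M k x) * (v x / 12))"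
        unfolding u_def by (simp add: ennreal_times_divide)
      also have "\<dots> = (\<Sum>k. ?h k * (?h k * a k x))"
      proof (intro arg_cong[where f = suminf] ext)
        fix k
        let ?X = "(1/2 :: real) ^ Suc k" and ?Y = "inverse (3 * N ^ k)"
        have "c = (1/2) * (1/2) * inverse N" using N by (simp add: c_def field_simps)
        then have "c ^ k = (1/2) ^ k * (1/2) ^ k * inverse (N ^ k)"
          by (simp only: power_mult_distrib power_inverse)
        then have "?X * ?X * ?Y = c ^ k * inverse 12" by simp
        then have "ennreal (?X * ?X * ?Y) = ennreal (c ^ k * inverse 12)" by (rule arg_cong)
        moreover have "ennreal (?X * ?X * ?Y) = ennreal ?X * ennreal ?X * ennreal ?Y"
        proof -
          have "ennreal (x * x * y) = ennreal x * ennreal x * ennreal y" if "0 \<le> x" "0 \<le> y" for x y :: real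
            using that by (simp add: ennreal_mult')
          from this[of ?X ?Y] show ?thesis using N by auto
        qed
        moreover have "ennreal ?Y = inverse (ennreal (3 * N ^ k))"
          using N by (intro inverse_ennreal[symmetric]) auto
        moreover have "ennreal (c ^ k * inverse 12) = ennreal (c ^ k) * inverse 12"
        proof -
          have "inverse 12 = ennreal (inverse 12)" using inverse_ennreal[of 12] by simp
          moreover have "ennreal (c ^ k * inverse 12) = ennreal (c ^ k) * ennreal (inverse 12)"
            using c by (intro ennreal_mult) auto
          ultimately show ?thesis by (simp only:)
        qed
        ultimately have *: "?h k * ?h k * inverse (ennreal (3 * N ^ k)) = ennreal (c ^ k) * inverse 12"
          by (simp only:)
        have "?h k * (?h k * a k x) = (?h k * ?h k * inverse (ennreal (3 * N ^ k))) * (M k x * v x)"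
          unfolding a_def divide_ennreal_def by (simp only: mult_ac)
        also have "\<dots> = (ennreal (c ^ k) * M k x) * (v x / 12)"
          unfolding * by (simp only: divide_ennreal_def mult_ac)
        finally show "(ennreal (c ^ k) * M k x) * (v x / 12) = ?h k * (?h k * a k x)" ..
      qed
      finally show ?thesis .
    qed
    have h_le: "?h k \<le> 1" for k by (simp add: power_le_one del: power_Suc)
    note [measurable] = sets_exponent_finite(1)[OF exponents_measurable[OF s]]
    let ?I = "\<lambda>k. \<integral>\<^sup>+x\<in>{x. s x \<noteq> \<infinity>}. ennpowr (a k x) (enn2real (s x)) \<partial>lebesgue"
    have "(\<integral>\<^sup>+x\<in>{x. s x \<noteq> \<infinity>}. ennpowr (u x * v x / 12) (enn2real (s x)) \<partial>lebesgue)
      \<le> (\<integral>\<^sup>+x. (\<Sum>k. ?h k * (ennpowr (a k x) (enn2real (s x)) * indicator {x. s x \<noteq> \<infinity>} x)) \<partial>lebesgue)"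
    proof (rule nn_integral_mono)
      fix x
      show "ennpowr (u x * v x / 12) (enn2real (s x)) * indicator {x. s x \<noteq> \<infinity>} x
        \<le> (\<Sum>k. ?h k * (ennpowr (a k x) (enn2real (s x)) * indicator {x. s x \<noteq> \<infinity>} x))"
      proof (cases "s x = \<infinity>")
        case False
        then have ge: "1 \<le> enn2real (s x)"
          using exponents_ge_1[OF s, of x] by (cases "s x") auto
        have "ennpowr (u x * v x / 12) (enn2real (s x)) \<le> (\<Sum>k. ennpowr (?h k * a k x) (enn2real (s x)))"
          unfolding u_eq using ge by (intro ennpowr_dyadic_average_le_suminf) auto
        also have "\<dots> \<le> (\<Sum>k. ?h k * ennpowr (a k x) (enn2real (s x)))"
          by (intro suminf_le ennpowr_cmult_le h_le ge) auto
        finally show ?thesis using False by simp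
      qed simp
    qed
    also have "\<dots> = (\<Sum>k. ?h k * ?I k)"
      by (simp add: nn_integral_suminf nn_integral_cmult)
    finally have "(\<integral>\<^sup>+x\<in>{x. s x \<noteq> \<infinity>}. ennpowr (u x * v x / 12) (enn2real (s x)) \<partial>lebesgue) + (\<Sum>k. ?h k * E k)
       \<le> (\<Sum>k. ?h k * ?I k) + (\<Sum>k. ?h k * E k)" by (rule add_right_mono)
    also have "\<dots> = (\<Sum>k. ?h k * (?I k + E k))"
      by (subst suminf_add) (auto simp: distrib_left)
    also have "\<dots> \<le> (\<Sum>k. ?h k * 1)" by (intro suminf_le mult_left_mono E(1)) auto
    finally have "(\<integral>\<^sup>+x\<in>{x. s x \<noteq> \<infinity>}. ennpowr (u x * v x / 12) (enn2real (s x)) \<partial>lebesgue) + (\<Sum>k. ?h k * E k) \<le> 1"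
      using half by simp
    moreover have "AE x in lebesgue. s x = \<infinity> \<longrightarrow> u x * v x / 12 \<le> (\<Sum>k. ?h k * E k)"
    proof -
      have "AE x in lebesgue. \<forall>k. s x = \<infinity> \<longrightarrow> a k x \<le> E k" by (subst AE_all_countable) (use E(2) in auto)
      then show ?thesis
      proof eventually_elim
        case (elim x)
        then show ?case unfolding u_eq using mult_mono[OF h_le, of "a _ x"]
          by (auto intro!: suminf_le mult_left_mono order_trans[OF mult_right_mono[OF h_le]])
      qed
    qed
    ultimately show "unit_ball s (\<lambda>x. u x * v x / 12)" unfolding unit_ball_def by blast
  qed
qed

section \<open>Geometric sums over dyadic scales\<close>

lemma nn_integral_count_space_ge_point: "x \<in> A \<Longrightarrow> f x \<le> (\<integral>\<^sup>+x. f x \<partial>count_space A)"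
proof -
  assume "x \<in> A"
  then have "f x = (\<integral>\<^sup>+y. f y * indicator {x} y \<partial>count_space A)"
    by (subst nn_integral_indicator_finite) auto
  also have "\<dots> \<le> (\<integral>\<^sup>+y. f y \<partial>count_space A)"
    by (intro nn_integral_mono) (auto simp: indicator_def)
  finally show ?thesis .
qed

text \<open>The bound is uniform in the real shift \<open>t\<close>, because replacing \<open>t\<close> by its integer part costs only a
  factor \<open>\<beta>\<close> in every term.\<close>

lemma two_sided_geometric_sum:
  fixes \<beta> :: real
  assumes "1 < \<beta>"
  obtains K :: real where "0 < K"
    "\<And>t. (\<integral>\<^sup>+k. ennreal (\<beta> powr (- \<bar>real_of_int k + t\<bar>)) \<partial>count_space UNIV) \<le> ennreal K"
proof -
  let ?f = "\<lambda>k::int. ennreal (\<beta> powr (- \<bar>real_of_int k\<bar>))"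
  let ?G = "1 / (1 - 1 / \<beta>)"
  have G: "(\<Sum>n. ennreal (\<beta> powr (- real n))) = ennreal ?G"
  proof -
    have "(\<lambda>n. (1 / \<beta>) ^ n) sums ?G" using assms by (intro geometric_sums) auto
    moreover have "\<beta> powr (- real n) = (1 / \<beta>) ^ n" for n
      using assms by (simp add: powr_minus powr_realpow power_one_over divide_inverse power_inverse)
    ultimately have "(\<lambda>n. \<beta> powr (- real n)) sums ?G" by simp
    then show ?thesis by (intro suminf_ennreal_eq) auto
  qed
  have "(\<integral>\<^sup>+k. ?f k \<partial>count_space UNIV) \<le> (\<integral>\<^sup>+k. ?f k * indicator (range int) k + ?f k * indicator (range (\<lambda>n. - int n)) k \<partial>count_space UNIV)"
  proof (intro nn_integral_mono)
    fix k :: int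
    have "k \<in> range int \<or> k \<in> range (\<lambda>n. - int n)"
      by (metis int_cases2 rangeI)
    then show "?f k \<le> ?f k * indicator (range int) k + ?f k * indicator (range (\<lambda>n. - int n)) k" by auto
  qed
  also have "\<dots> = (\<integral>\<^sup>+k. ?f k \<partial>count_space (range int)) + (\<integral>\<^sup>+k. ?f k \<partial>count_space (range (\<lambda>n. - int n)))"
    by (simp add: nn_integral_add nn_integral_count_space_indicator)
  also have "\<dots> = (\<integral>\<^sup>+n. ?f (int n) \<partial>count_space UNIV) + (\<integral>\<^sup>+n. ?f (- int n) \<partial>count_space UNIV)"
    by (intro arg_cong2[where f = "(+)"] nn_integral_bij_count_space[symmetric]) (auto simp: bij_betw_def inj_on_def)
  also have "\<dots> = ennreal ?G + ennreal ?G"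
    by (simp add: nn_integral_count_space_nat G)
  finally have sum: "(\<integral>\<^sup>+k. ?f k \<partial>count_space UNIV) \<le> ennreal (2 * ?G)"
    using assms by (simp flip: ennreal_plus)
  show ?thesis
  proof (rule that[of "\<beta> * (2 * ?G)"])
    show "0 < \<beta> * (2 * ?G)" using assms by simp
    fix t :: real
    let ?m = "\<lfloor>t\<rfloor>"
    have "(\<integral>\<^sup>+k. ennreal (\<beta> powr (- \<bar>real_of_int k + t\<bar>)) \<partial>count_space UNIV)
      \<le> (\<integral>\<^sup>+k. ennreal \<beta> * ?f (k + ?m) \<partial>count_space UNIV)"
    proof (intro nn_integral_mono)
      fix k :: int
      have "- \<bar>real_of_int k + t\<bar> \<le> 1 - \<bar>real_of_int (k + ?m)\<bar>"
      proof -
        have "real_of_int ?m \<le> t" "t < real_of_int ?m + 1" by linarith+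
        then show ?thesis by (simp add: abs_if split: if_splits) linarith+
      qed
      then have "\<beta> powr (- \<bar>real_of_int k + t\<bar>) \<le> \<beta> powr (1 - \<bar>real_of_int (k + ?m)\<bar>)"
        using assms by (intro powr_mono) auto
      also have "\<dots> = \<beta> * \<beta> powr (- \<bar>real_of_int (k + ?m)\<bar>)"
        using assms powr_add[of \<beta> 1 "- \<bar>real_of_int (k + ?m)\<bar>"] by simp
      finally show "ennreal (\<beta> powr (- \<bar>real_of_int k + t\<bar>)) \<le> ennreal \<beta> * ?f (k + ?m)"
        using assms by (simp add: ennreal_leI flip: ennreal_mult)
    qed
    also have "\<dots> = ennreal \<beta> * (\<integral>\<^sup>+k. ?f (k + ?m) \<partial>count_space UNIV)"
      by (intro nn_integral_cmult) simp
    also have "(\<integral>\<^sup>+k. ?f (k + ?m) \<partial>count_space UNIV) = (\<integral>\<^sup>+k. ?f k \<partial>count_space UNIV)"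
      by (intro nn_integral_bij_count_space)
         (rule bij_betwI[where g = "\<lambda>k. k - ?m"], auto)
    also have "ennreal \<beta> * (\<integral>\<^sup>+k. ?f k \<partial>count_space UNIV) \<le> ennreal \<beta> * ennreal (2 * ?G)"
      by (intro mult_left_mono sum) simp
    also have "\<dots> = ennreal (\<beta> * (2 * ?G))" using assms by (simp flip: ennreal_mult)
    finally show "(\<integral>\<^sup>+k. ennreal (\<beta> powr (- \<bar>real_of_int k + t\<bar>)) \<partial>count_space UNIV) \<le> ennreal (\<beta> * (2 * ?G))" .
  qed
qed

lemma dyadic_sum_below:
  fixes \<gamma> :: real
  assumes "0 < \<gamma>"
  obtains K :: real where "0 < K"
    "\<And>c. (\<integral>\<^sup>+j. ennreal (2 powr (\<gamma> * real_of_int j)) * indicator {j. ennreal (2 powr real_of_int j) < c} j \<partial>count_space UNIV)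
      \<le> ennreal K * ennpowr c \<gamma>"
proof -
  have "1 < (2::real) powr \<gamma>" using assms by simp
  then obtain K where K: "0 < K"
    "\<And>t. (\<integral>\<^sup>+k. ennreal ((2 powr \<gamma>) powr (- \<bar>real_of_int k + t\<bar>)) \<partial>count_space UNIV) \<le> ennreal K"
    using two_sided_geometric_sum[of "2 powr \<gamma>"] by blast
  show ?thesis
  proof (rule that[OF K(1)])
    fix c :: ennreal
    consider "c = 0" | "c = top" | r where "c = ennreal r" "0 < r" by (cases c) (auto simp: less_le)
    then show "(\<integral>\<^sup>+j. ennreal (2 powr (\<gamma> * real_of_int j)) * indicator {j. ennreal (2 powr real_of_int j) < c} j \<partial>count_space UNIV)
      \<le> ennreal K * ennpowr c \<gamma>"
    proof cases
      case 3
      define t where "t = - log 2 r"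
      have r: "r = 2 powr (- t)" using 3 by (simp add: t_def)
      have "(\<integral>\<^sup>+j. ennreal (2 powr (\<gamma> * real_of_int j)) * indicator {j. ennreal (2 powr real_of_int j) < c} j \<partial>count_space UNIV)
        \<le> (\<integral>\<^sup>+j. ennpowr c \<gamma> * ennreal ((2 powr \<gamma>) powr (- \<bar>real_of_int j + t\<bar>)) \<partial>count_space UNIV)"
      proof (intro nn_integral_mono)
        fix j :: int
        show "ennreal (2 powr (\<gamma> * real_of_int j)) * indicator {j. ennreal (2 powr real_of_int j) < c} j
          \<le> ennpowr c \<gamma> * ennreal ((2 powr \<gamma>) powr (- \<bar>real_of_int j + t\<bar>))"
        proof (cases "ennreal (2 powr real_of_int j) < c")
          case True
          then have "(2::real) powr real_of_int j < 2 powr (- t)" using 3 r by (simp add: ennreal_less_iff)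
          then have neg: "real_of_int j + t < 0" by simp
          have "2 powr (\<gamma> * real_of_int j) = r powr \<gamma> * (2 powr \<gamma>) powr (- \<bar>real_of_int j + t\<bar>)"
            using neg by (simp add: r powr_powr algebra_simps flip: powr_add)
          then show ?thesis using True 3 by (simp add: ennpowr_ennreal flip: ennreal_mult)
        qed simp
      qed
      also have "\<dots> = ennpowr c \<gamma> * (\<integral>\<^sup>+j. ennreal ((2 powr \<gamma>) powr (- \<bar>real_of_int j + t\<bar>)) \<partial>count_space UNIV)"
        by (intro nn_integral_cmult) simp
      also have "\<dots> \<le> ennpowr c \<gamma> * ennreal K" by (intro mult_left_mono K(2)) simp
      finally show ?thesis by (simp add: mult.commute)
    qed (use K(1) in \<open>auto simp: ennreal_mult_top\<close>)
  qed
qed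

text \<open>The terms are \<open>2\<^sup>\<alpha>\<^sup>k P\<^sup>2\<close> below the scale where \<open>2\<^sup>-\<^sup>\<alpha>\<^sup>k = P\<close> and \<open>2\<^sup>-\<^sup>\<alpha>\<^sup>k\<close> above it. They decay
  geometrically on both sides of the scale, where they are about \<open>P\<close>.\<close>

lemma dyadic_sum_min_le:
  fixes \<alpha> :: real
  assumes "0 < \<alpha>"
  obtains K :: real where "0 < K"
    "\<And>P. (\<integral>\<^sup>+k. ennreal (2 powr (\<alpha> * real_of_int k)) * (min P (ennreal (2 powr (- \<alpha> * real_of_int k))))^2 \<partial>count_space UNIV)
      \<le> ennreal K * P"
proof -
  have "1 < (2::real) powr \<alpha>" using assms by simp
  then obtain K where K: "0 < K"
    "\<And>t. (\<integral>\<^sup>+k. ennreal ((2 powr \<alpha>) powr (- \<bar>real_of_int k + t\<bar>)) \<partial>count_space UNIV) \<le> ennreal K"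
    using two_sided_geometric_sum[of "2 powr \<alpha>"] by blast
  show ?thesis
  proof (rule that[OF K(1)])
    fix P :: ennreal
    consider "P = 0" | "P = top" | r where "P = ennreal r" "0 < r" by (cases P) (auto simp: less_le)
    then show "(\<integral>\<^sup>+k. ennreal (2 powr (\<alpha> * real_of_int k)) * (min P (ennreal (2 powr (- \<alpha> * real_of_int k))))^2 \<partial>count_space UNIV)
      \<le> ennreal K * P"
    proof cases
      case 3
      define t where "t = log 2 r / \<alpha>"
      have r: "r = 2 powr (\<alpha> * t)" using 3 assms by (simp add: t_def)
      have "(\<integral>\<^sup>+k. ennreal (2 powr (\<alpha> * real_of_int k)) * (min P (ennreal (2 powr (- \<alpha> * real_of_int k))))^2 \<partial>count_space UNIV)
        \<le> (\<integral>\<^sup>+k. P * ennreal ((2 powr \<alpha>) powr (- \<bar>real_of_int k + t\<bar>)) \<partial>count_space UNIV)"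
      proof (intro nn_integral_mono)
        fix k :: int
        let ?x = "real_of_int k"
        have "2 powr (\<alpha> * ?x) * (min r (2 powr (- \<alpha> * ?x)))^2 \<le> r * (2 powr \<alpha>) powr (- \<bar>?x + t\<bar>)"
        proof (cases "?x + t \<ge> 0")
          case True
          have "(min r (2 powr (- \<alpha> * ?x)))^2 \<le> (2 powr (- \<alpha> * ?x))^2"
            using 3 by (intro power_mono) auto
          then have "2 powr (\<alpha> * ?x) * (min r (2 powr (- \<alpha> * ?x)))^2 \<le> 2 powr (\<alpha> * ?x) * (2 powr (- \<alpha> * ?x))^2"
            by (rule mult_left_mono) simp
          also have "\<dots> = r * (2 powr \<alpha>) powr (- \<bar>?x + t\<bar>)"
            using True by (simp add: r powr_powr power2_eq_square algebra_simps flip: powr_add)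
          finally show ?thesis .
        next
          case False
          have "(min r (2 powr (- \<alpha> * ?x)))^2 \<le> r^2" using 3 by (intro power_mono) auto
          then have "2 powr (\<alpha> * ?x) * (min r (2 powr (- \<alpha> * ?x)))^2 \<le> 2 powr (\<alpha> * ?x) * r^2"
            by (rule mult_left_mono) simp
          also have "\<dots> = r * (2 powr \<alpha>) powr (- \<bar>?x + t\<bar>)"
            using False by (simp add: r powr_powr power2_eq_square algebra_simps flip: powr_add)
          finally show ?thesis .
        qed
        then show "ennreal (2 powr (\<alpha> * ?x)) * (min P (ennreal (2 powr (- \<alpha> * ?x))))^2
          \<le> P * ennreal ((2 powr \<alpha>) powr (- \<bar>?x + t\<bar>))"
          using 3 by (simp add: min_ennreal ennreal_power flip: ennreal_mult)
      qed
      also have "\<dots> = P * (\<integral>\<^sup>+k. ennreal ((2 powr \<alpha>) powr (- \<bar>real_of_int k + t\<bar>)) \<partial>count_space UNIV)"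
        by (intro nn_integral_cmult) simp
      also have "\<dots> \<le> P * ennreal K" by (intro mult_left_mono K(2)) simp
      finally show ?thesis by (simp add: mult.commute)
    qed (use K(1) in \<open>auto simp: ennreal_mult_top\<close>)
  qed
qed

section \<open>A maximal theorem for doubling weights\<close>

definition ball_mass :: "('a::euclidean_space \<Rightarrow> ennreal) \<Rightarrow> 'a \<Rightarrow> real \<Rightarrow> ennreal" where
  "ball_mass f x t = (\<integral>\<^sup>+y\<in>ball x t. f y \<partial>lborel)"

lemma borel_measurable_indicator_ball [measurable]:
  "(\<lambda>p. indicator (ball (fst p) t) (snd p) :: ennreal) \<in> borel_measurable (lborel \<Otimes>\<^sub>M (lborel :: 'a::euclidean_space measure))"
proof -
  have "(\<lambda>p. indicator (ball (fst p) t) (snd p) :: ennreal)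
      = indicator {p :: 'a \<times> 'a. dist (fst p) (snd p) < t}"
    by (auto simp: fun_eq_iff indicator_def)
  moreover have "open {p :: 'a \<times> 'a. dist (fst p) (snd p) < t}"
    by (intro open_Collect_less continuous_intros)
  then have "{p :: 'a \<times> 'a. dist (fst p) (snd p) < t} \<in> sets (lborel \<Otimes>\<^sub>M lborel)"
    unfolding lborel_prod by simp
  ultimately show ?thesis by simp
qed

lemma borel_measurable_ball_mass [measurable]:
  assumes [measurable]: "f \<in> borel_measurable borel"
  shows "(\<lambda>x. ball_mass f x t) \<in> borel_measurable borel"
proof -
  have "(\<lambda>p. f (snd p) * indicator (ball (fst p) t) (snd p)) \<in> borel_measurable (lborel \<Otimes>\<^sub>M lborel)"
    by measurable
  then have "(\<lambda>x. \<integral>\<^sup>+y. f y * indicator (ball x t) y \<partial>lborel) \<in> borel_measurable lborel"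
    by (intro lborel.borel_measurable_nn_integral) (simp add: case_prod_beta)
  then show ?thesis by (simp add: ball_mass_def)
qed

lemma ball_mass_add:
  assumes "f \<in> borel_measurable borel" "g \<in> borel_measurable borel"
  shows "ball_mass (\<lambda>y. f y + g y) x t = ball_mass f x t + ball_mass g x t"
  using assms by (simp add: ball_mass_def distrib_right nn_integral_add)

lemma ball_mass_cmult:
  assumes "f \<in> borel_measurable borel"
  shows "ball_mass (\<lambda>y. c * f y) x t = c * ball_mass f x t"
  using assms by (simp add: ball_mass_def mult.assoc nn_integral_cmult)

lemma ball_mass_mono:
  assumes "\<And>y. f y \<le> g y"
  shows "ball_mass f x t \<le> ball_mass g x t"
  unfolding ball_mass_def using assms by (intro nn_integral_mono mult_right_mono) auto

lemma ball_mass_le_maxop: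
  assumes "0 < t" "y \<in> ball x t"
  shows "ball_mass f x t \<le> emeasure lborel (ball x t) * maxop f y"
  unfolding ball_mass_def using assms by (rule maxop_upper)

definition doubling :: "real \<Rightarrow> ('a::euclidean_space \<Rightarrow> ennreal) \<Rightarrow> bool" where
  "doubling D u \<longleftrightarrow> (\<forall>x r. 0 < r \<longrightarrow> ball_mass u x (5 * r) \<le> ennreal D * ball_mass u x r)"

lemma emeasure_ball_scale:
  fixes x :: "'a::euclidean_space"
  assumes "0 < c" "0 < r"
  shows "emeasure lborel (ball x (c * r)) = ennreal (c ^ DIM('a)) * emeasure lborel (ball x r)"
  using assms by (simp add: emeasure_ball power_mult_distrib mult_ac flip: ennreal_mult)

text \<open>Averaging the hypothesis \<open>maxop u \<le> A u\<close> over the small ball compares it with the large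
  one.\<close>

lemma doubling_of_A1:
  fixes u :: "'a::euclidean_space \<Rightarrow> ennreal"
  assumes [measurable]: "u \<in> borel_measurable borel" and A: "0 \<le> A" and A1: "\<And>x. maxop u x \<le> ennreal A * u x"
  shows "doubling (5 ^ DIM('a) * A) u"
  unfolding doubling_def
proof (intro allI impI)
  fix x :: 'a and r :: real assume r: "0 < r"
  let ?V = "emeasure lborel (ball x r)"
  have V: "?V \<noteq> 0" "?V \<noteq> top"
    using emeasure_ball_pos[OF r, of x] emeasure_lborel_ball_finite[of x r] by auto
  have "ball_mass u x (5 * r) * ?V = (\<integral>\<^sup>+y\<in>ball x r. ball_mass u x (5 * r) \<partial>lborel)"
    by (simp add: nn_integral_cmult)
  also have "\<dots> \<le> (\<integral>\<^sup>+y\<in>ball x r. (ennreal (5 ^ DIM('a)) * ?V * ennreal A * u y) \<partial>lborel)"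
  proof (intro nn_integral_mono)
    fix y
    show "ball_mass u x (5 * r) * indicator (ball x r) y
      \<le> (ennreal (5 ^ DIM('a)) * ?V * ennreal A * u y) * indicator (ball x r) y"
    proof (cases "y \<in> ball x r")
      case True
      then have "ball_mass u x (5 * r) \<le> emeasure lborel (ball x (5 * r)) * maxop u y"
        using r by (intro ball_mass_le_maxop) auto
      also have "\<dots> \<le> emeasure lborel (ball x (5 * r)) * (ennreal A * u y)"
        by (intro mult_left_mono A1) simp
      finally show ?thesis using True r by (simp add: emeasure_ball_scale mult.assoc)
    qed simp
  qed
  also have "\<dots> = (ennreal (5 ^ DIM('a)) * ?V * ennreal A) * ball_mass u x r"
    by (simp add: ball_mass_def nn_integral_cmult mult.assoc)
  finally have "ball_mass u x (5 * r) * ?V \<le> (ennreal (5 ^ DIM('a) * A) * ball_mass u x r) * ?V"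
    using A by (simp add: ennreal_mult mult_ac)
  then show "ball_mass u x (5 * r) \<le> ennreal (5 ^ DIM('a) * A) * ball_mass u x r"
    using V by (simp add: ennreal_mult_le_mult_iff mult.commute[of _ ?V])
qed

text \<open>The balls on which the mean of \<open>f\<close> with respect to \<open>u\<close> is large are thinned out to a
  disjoint family by the Vitali covering lemma. It needs bounded radii, hence the bound \<open>b\<close> on the scales.\<close>

lemma weak_type_bounded_scales:
  fixes u f :: "'a::euclidean_space \<Rightarrow> ennreal" and b :: int and l :: ennreal
  assumes [measurable]: "u \<in> borel_measurable borel" "f \<in> borel_measurable borel" and D: "doubling D u"
  defines "E \<equiv> {x. \<exists>k\<le>b. l * ball_mass u x (2 powr real_of_int k) < ball_mass f x (2 powr real_of_int k)}"
  shows "l * (\<integral>\<^sup>+x\<in>E. u x \<partial>lborel) \<le> ennreal D * (\<integral>\<^sup>+x. f x \<partial>lborel)"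
proof -
  have "\<forall>x\<in>E. \<exists>k\<le>b. l * ball_mass u x (2 powr real_of_int k) < ball_mass f x (2 powr real_of_int k)"
    by (auto simp: E_def)
  from bchoice[OF this] obtain k where k: "\<And>x. x \<in> E \<Longrightarrow> k x \<le> b"
    "\<And>x. x \<in> E \<Longrightarrow> l * ball_mass u x (2 powr real_of_int (k x)) < ball_mass f x (2 powr real_of_int (k x))"
    by blast
  define r where "r x = 2 powr real_of_int (k x)" for x
  have r: "0 < r x" for x by (simp add: r_def)
  have 1: "E \<subseteq> (\<Union>x\<in>E. ball x (r x))" using r by auto
  have 2: "0 < r x \<and> r x \<le> 2 powr real_of_int b" if "x \<in> E" for x
    using k(1)[OF that] by (auto simp: r_def)
  obtain C where C: "countable C" "C \<subseteq> E" "pairwise (\<lambda>i j. disjnt (ball i (r i)) (ball j (r j))) C"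
    "E \<subseteq> (\<Union>i\<in>C. ball i (5 * r i))"
    by (rule Vitali_covering_lemma_balls[OF 1 2])
  have "(\<integral>\<^sup>+x\<in>E. u x \<partial>lborel) \<le> (\<integral>\<^sup>+x. \<integral>\<^sup>+i. u x * indicator (ball i (5 * r i)) x \<partial>count_space C \<partial>lborel)"
  proof (intro nn_integral_mono)
    fix x
    show "u x * indicator E x \<le> (\<integral>\<^sup>+i. u x * indicator (ball i (5 * r i)) x \<partial>count_space C)"
    proof (cases "x \<in> E")
      case True
      then obtain i where "i \<in> C" "x \<in> ball i (5 * r i)" using C(4) by auto
      then show ?thesis
        using nn_integral_count_space_ge_point[of i C "\<lambda>i. u x * indicator (ball i (5 * r i)) x"] True by simp
    qed simp
  qed
  also have "\<dots> = (\<integral>\<^sup>+i. ball_mass u i (5 * r i) \<partial>count_space C)"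
    unfolding ball_mass_def by (intro nn_integral_count_space_nn_integral C(1)) measurable
  also have "\<dots> \<le> (\<integral>\<^sup>+i. ennreal D * ball_mass u i (r i) \<partial>count_space C)"
    using D r by (intro nn_integral_mono) (auto simp: doubling_def)
  also have "\<dots> = ennreal D * (\<integral>\<^sup>+i. ball_mass u i (r i) \<partial>count_space C)"
    by (intro nn_integral_cmult) simp
  finally have "l * (\<integral>\<^sup>+x\<in>E. u x \<partial>lborel) \<le> l * (ennreal D * (\<integral>\<^sup>+i. ball_mass u i (r i) \<partial>count_space C))"
    by (rule mult_left_mono) simp
  also have "\<dots> = ennreal D * (\<integral>\<^sup>+i. l * ball_mass u i (r i) \<partial>count_space C)"
    by (subst nn_integral_cmult) (simp_all add: mult_ac)
  also have "\<dots> \<le> ennreal D * (\<integral>\<^sup>+i. ball_mass f i (r i) \<partial>count_space C)"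
    using k(2) C(2) by (intro mult_left_mono nn_integral_mono) (auto simp: r_def intro: less_imp_le)
  also have "(\<integral>\<^sup>+i. ball_mass f i (r i) \<partial>count_space C) = (\<integral>\<^sup>+i. emeasure (density lborel f) (ball i (r i)) \<partial>count_space C)"
    by (intro nn_integral_cong) (simp add: emeasure_density ball_mass_def)
  also have "\<dots> = emeasure (density lborel f) (\<Union>i\<in>C. ball i (r i))"
    using C(1,3) by (intro emeasure_UN_countable[symmetric])
      (auto simp: disjoint_family_on_def pairwise_def disjnt_def)
  also have "\<dots> \<le> emeasure (density lborel f) (space (density lborel f))"
    by (rule emeasure_space)
  also have "\<dots> = (\<integral>\<^sup>+x. f x \<partial>lborel)"
    by (subst emeasure_density) auto
  finally show ?thesis by (simp add: mult_left_mono)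
qed

text \<open>The bound on the scales is removed by monotone convergence.\<close>

lemma weak_type:
  fixes u f :: "'a::euclidean_space \<Rightarrow> ennreal" and l :: ennreal
  assumes [measurable]: "u \<in> borel_measurable borel" "f \<in> borel_measurable borel" and D: "doubling D u"
  defines "E \<equiv> {x. \<exists>k::int. l * ball_mass u x (2 powr real_of_int k) < ball_mass f x (2 powr real_of_int k)}"
  shows "l * (\<integral>\<^sup>+x\<in>E. u x \<partial>lborel) \<le> ennreal D * (\<integral>\<^sup>+x. f x \<partial>lborel)"
proof -
  define E' where "E' n = {x. \<exists>k\<le>int n. l * ball_mass u x (2 powr real_of_int k) < ball_mass f x (2 powr real_of_int k)}" for n
  have [measurable]: "E' n \<in> sets borel" for n
    unfolding E'_def by measurable
  have "incseq E'"
  proof (intro incseq_SucI subsetI)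
    fix n x assume "x \<in> E' n"
    then obtain k where "k \<le> int n" "l * ball_mass u x (2 powr real_of_int k) < ball_mass f x (2 powr real_of_int k)"
      by (auto simp: E'_def)
    then show "x \<in> E' (Suc n)" by (auto simp: E'_def intro!: exI[of _ k])
  qed
  have "E = (\<Union>n. E' n)"
  proof safe
    fix x assume "x \<in> E"
    then obtain k where "l * ball_mass u x (2 powr real_of_int k) < ball_mass f x (2 powr real_of_int k)"
      by (auto simp: E_def)
    moreover have "k \<le> int (nat k)" by simp
    ultimately show "x \<in> (\<Union>n. E' n)" unfolding E'_def by blast
  qed (auto simp: E_def E'_def)
  then have "(\<integral>\<^sup>+x\<in>E. u x \<partial>lborel) = emeasure (density lborel u) (\<Union>n. E' n)"
    by (simp add: emeasure_density)
  also have "\<dots> = (SUP n. emeasure (density lborel u) (E' n))"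
    using \<open>incseq E'\<close> by (intro SUP_emeasure_incseq[symmetric]) auto
  finally have "l * (\<integral>\<^sup>+x\<in>E. u x \<partial>lborel) = (SUP n. l * (\<integral>\<^sup>+x\<in>E' n. u x \<partial>lborel))"
    by (simp add: SUP_mult_left_ennreal emeasure_density)
  also have "\<dots> \<le> ennreal D * (\<integral>\<^sup>+x. f x \<partial>lborel)"
    unfolding E'_def by (intro SUP_least weak_type_bounded_scales) (use D in auto)
  finally show ?thesis .
qed

text \<open>The centred maximal operator with respect to the measure with density \<open>u\<close>. Radii are powers of \<open>2\<close>, so
  that the supremum is countable and measurability is immediate.\<close>

definition dyadic_maxop :: "('a::euclidean_space \<Rightarrow> ennreal) \<Rightarrow> ('a \<Rightarrow> ennreal) \<Rightarrow> 'a \<Rightarrow> ennreal" where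
  "dyadic_maxop u a x = (SUP k::int. ball_mass (\<lambda>y. a y * u y) x (2 powr real_of_int k) / ball_mass u x (2 powr real_of_int k))"

lemma borel_measurable_dyadic_maxop [measurable]:
  assumes [measurable]: "u \<in> borel_measurable borel" "a \<in> borel_measurable borel"
  shows "dyadic_maxop u a \<in> borel_measurable borel"
  unfolding dyadic_maxop_def by measurable

text \<open>The part of \<open>a\<close> below \<open>h\<close> contributes at most \<open>h\<close> to any mean, so a mean above \<open>2 h\<close> leaves more than
  \<open>h\<close> for the part above \<open>h\<close>. This truncation is what turns the weak type bound into a strong one.\<close>

lemma dyadic_maxop_level_set:
  fixes u a :: "'a::euclidean_space \<Rightarrow> ennreal" and h :: ennreal
  assumes [measurable]: "u \<in> borel_measurable borel" "a \<in> borel_measurable borel" and D: "doubling D u"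
  shows "h * (\<integral>\<^sup>+x\<in>{x. 2 * h < dyadic_maxop u a x}. u x \<partial>lborel)
    \<le> ennreal D * (\<integral>\<^sup>+x\<in>{x. h < a x}. (a x * u x) \<partial>lborel)"
proof -
  define f where "f x = a x * u x * indicator {x. h < a x} x" for x
  have [measurable]: "f \<in> borel_measurable borel" unfolding f_def by measurable
  define E where "E = {x. \<exists>k::int. h * ball_mass u x (2 powr real_of_int k) < ball_mass f x (2 powr real_of_int k)}"
  have sub: "{x. 2 * h < dyadic_maxop u a x} \<subseteq> E"
  proof
    fix x assume "x \<in> {x. 2 * h < dyadic_maxop u a x}"
    then obtain k where k: "2 * h < ball_mass (\<lambda>y. a y * u y) x (2 powr real_of_int k) / ball_mass u x (2 powr real_of_int k)"
      unfolding dyadic_maxop_def less_SUP_iff by auto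
    define t where "t = 2 powr real_of_int k"
    note k = k[folded t_def]
    have "ball_mass u x t \<noteq> 0"
    proof
      assume "ball_mass u x t = 0"
      then have "AE y in lborel. u y * indicator (ball x t) y = 0"
        unfolding ball_mass_def by (subst (asm) nn_integral_0_iff_AE) auto
      then have "ball_mass (\<lambda>y. a y * u y) x t = 0"
        unfolding ball_mass_def by (subst nn_integral_0_iff_AE) (auto elim: eventually_mono)
      with k show False by simp
    qed
    moreover have "ball_mass u x t \<noteq> top" using k by auto
    ultimately have cancel: "2 * h * ball_mass u x t / ball_mass u x t = 2 * h"
      by (rule ennreal_mult_divide_eq)
    have "2 * h * ball_mass u x t < ball_mass (\<lambda>y. a y * u y) x t"
    proof (rule ccontr)
      assume "\<not> 2 * h * ball_mass u x t < ball_mass (\<lambda>y. a y * u y) x t"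
      then have "ball_mass (\<lambda>y. a y * u y) x t / ball_mass u x t \<le> 2 * h * ball_mass u x t / ball_mass u x t"
        by (intro divide_right_mono_ennreal) (simp only: not_less)
      with k show False unfolding cancel by (meson leD)
    qed
    also have "ball_mass (\<lambda>y. a y * u y) x t \<le> ball_mass (\<lambda>y. h * u y + f y) x t"
    proof (rule ball_mass_mono)
      show "a y * u y \<le> h * u y + f y" for y
        by (cases "h < a y") (auto simp: f_def intro: mult_right_mono)
    qed
    also have "\<dots> = h * ball_mass u x t + ball_mass f x t"
      by (subst ball_mass_add) (simp_all add: ball_mass_cmult)
    finally have less: "2 * h * ball_mass u x t < h * ball_mass u x t + ball_mass f x t" .
    have "h * ball_mass u x t < ball_mass f x t"
    proof (rule ccontr)
      assume "\<not> h * ball_mass u x t < ball_mass f x t"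
      then have "h * ball_mass u x t + ball_mass f x t \<le> h * ball_mass u x t + h * ball_mass u x t"
        by (intro add_left_mono) (simp only: not_less)
      also have "\<dots> = 2 * h * ball_mass u x t" by (simp add: mult_2 distrib_right)
      finally show False using less by (meson leD)
    qed
    then show "x \<in> E" unfolding E_def t_def by blast
  qed
  have "h * (\<integral>\<^sup>+x\<in>{x. 2 * h < dyadic_maxop u a x}. u x \<partial>lborel) \<le> h * (\<integral>\<^sup>+x\<in>E. u x \<partial>lborel)"
    using sub by (intro mult_left_mono nn_integral_mono) (auto simp: indicator_def)
  also have "\<dots> \<le> ennreal D * (\<integral>\<^sup>+x. f x \<partial>lborel)"
    unfolding E_def using D by (intro weak_type) auto
  finally show ?thesis by (simp only: f_def)
qed

text \<open>A single level just below half of \<open>N\<close> suffices when \<open>N\<close> is finite; when \<open>N\<close> is infinite all levels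
  contribute and the sum diverges.\<close>

lemma dyadic_layer_cake:
  fixes N :: ennreal and s :: real
  assumes s: "0 < s"
  shows "ennpowr N s \<le> ennreal (4 powr s) *
    (\<integral>\<^sup>+j. ennreal (2 powr (s * real_of_int j)) * indicator {j. 2 * ennreal (2 powr real_of_int j) < N} j \<partial>count_space UNIV)"
    (is "_ \<le> _ * ?S")
proof -
  have point: "ennreal (2 powr (s * real_of_int j)) \<le> ?S" if "2 * ennreal (2 powr real_of_int j) < N" for j
    using nn_integral_count_space_ge_point[of j UNIV
        "\<lambda>j. ennreal (2 powr (s * real_of_int j)) * indicator {j. 2 * ennreal (2 powr real_of_int j) < N} j"] that
    by simp
  consider "N = 0" | "N = top" | r where "N = ennreal r" "0 < r" by (cases N) (auto simp: less_le)
  then show ?thesis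
  proof cases
    case 2
    have "?S = top"
    proof (rule ccontr)
      assume "?S \<noteq> top"
      then obtain M where M: "?S = ennreal M" "0 \<le> M" by (cases ?S) auto
      define j where "j = \<lceil>log 2 (M + 1) / s\<rceil>"
      have "log 2 (M + 1) / s \<le> real_of_int j" unfolding j_def by linarith
      then have "log 2 (M + 1) \<le> s * real_of_int j" using s by (simp add: field_simps)
      then have "2 powr log 2 (M + 1) \<le> 2 powr (s * real_of_int j)" by (intro powr_mono) auto
      then have "M + 1 \<le> 2 powr (s * real_of_int j)" using M by simp
      moreover have "ennreal (2 powr (s * real_of_int j)) \<le> ennreal M"
        unfolding M(1)[symmetric] using 2 by (intro point) (simp add: ennreal_mult_less_top less_top[symmetric] ennreal_mult_eq_top_iff)
      then have "2 powr (s * real_of_int j) \<le> M" using M(2) by (simp add: ennreal_le_iff)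
      ultimately show False by linarith
    qed
    then show ?thesis using 2 by (simp add: ennreal_mult_top)
  next
    case 3
    define j where "j = \<lceil>log 2 r\<rceil> - 2"
    have j: "real_of_int j + 1 < log 2 r" "log 2 r \<le> real_of_int j + 2" unfolding j_def by linarith+
    have "2 powr (real_of_int j + 1) < 2 powr (log 2 r)" using j by (intro powr_less_mono) auto
    then have "2 * 2 powr real_of_int j < r" using 3 by (simp add: powr_add)
    then have "2 * ennreal (2 powr real_of_int j) < N"
      using 3 by (simp add: ennreal_less_iff flip: ennreal_numeral ennreal_mult)
    note le = point[OF this]
    have "r = 2 powr (log 2 r)" using 3 by simp
    also have "\<dots> \<le> 2 powr (real_of_int j + 2)" using j by (intro powr_mono) auto
    also have "\<dots> = 4 * 2 powr real_of_int j" by (simp add: powr_add)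
    finally have "r powr s \<le> (4 * 2 powr real_of_int j) powr s" using 3 s by (intro powr_mono2) auto
    also have "\<dots> = 4 powr s * 2 powr (s * real_of_int j)" by (simp add: powr_mult powr_powr mult.commute)
    finally have "ennpowr N s \<le> ennreal (4 powr s) * ennreal (2 powr (s * real_of_int j))"
      using 3 by (simp add: ennpowr_ennreal ennreal_leI flip: ennreal_mult)
    also have "\<dots> \<le> ennreal (4 powr s) * ?S" by (intro mult_left_mono le) simp
    finally show ?thesis .
  qed simp
qed

text \<open>Summing the level set estimate over the levels \<open>2\<^sup>j\<close> leaves, in each point, a geometric sum over
  \<open>2\<^sup>j < a x\<close> with exponent \<open>s - 1 > 0\<close>. The constant depends on \<open>u\<close> through its doubling constant only.\<close>

theorem dyadic_maxop_strong_type: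
  fixes s D :: real
  assumes s: "1 < s" and D: "0 \<le> D"
  obtains C :: real where "0 \<le> C"
    "\<And>u a :: 'a::euclidean_space \<Rightarrow> ennreal. u \<in> borel_measurable borel \<Longrightarrow> a \<in> borel_measurable borel \<Longrightarrow> doubling D u \<Longrightarrow>
      (\<integral>\<^sup>+x. ennpowr (dyadic_maxop u a x) s * u x \<partial>lborel) \<le> ennreal C * (\<integral>\<^sup>+x. ennpowr (a x) s * u x \<partial>lborel)"
proof -
  have "0 < s - 1" using s by simp
  then obtain K where K: "0 < K"
    "\<And>c. (\<integral>\<^sup>+j. ennreal (2 powr ((s - 1) * real_of_int j)) * indicator {j. ennreal (2 powr real_of_int j) < c} j \<partial>count_space UNIV)
      \<le> ennreal K * ennpowr c (s - 1)"
    using dyadic_sum_below[of "s - 1"] by blast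
  show ?thesis
  proof (rule that[of "4 powr s * D * K"])
    show "0 \<le> 4 powr s * D * K" using D K by simp
    fix u a :: "'a \<Rightarrow> ennreal"
    assume [measurable]: "u \<in> borel_measurable borel" "a \<in> borel_measurable borel" and db: "doubling D u"
    define N where "N = dyadic_maxop u a"
    have [measurable]: "N \<in> borel_measurable borel" unfolding N_def by measurable
    define h where "h j = ennreal (2 powr real_of_int j)" for j :: int
    have split: "ennreal (2 powr (s * real_of_int j)) = ennreal (2 powr ((s - 1) * real_of_int j)) * h j" for j
      by (simp add: h_def algebra_simps flip: ennreal_mult powr_add)
    have "(\<integral>\<^sup>+x. ennpowr (N x) s * u x \<partial>lborel)
      \<le> (\<integral>\<^sup>+x. ennreal (4 powr s) * (\<integral>\<^sup>+j. ennreal (2 powr (s * real_of_int j)) * (u x * indicator {x. 2 * h j < N x} x) \<partial>count_space UNIV) \<partial>lborel)"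
    proof (intro nn_integral_mono)
      fix x
      have "ennpowr (N x) s * u x \<le> ennreal (4 powr s) *
        (\<integral>\<^sup>+j. ennreal (2 powr (s * real_of_int j)) * indicator {j. 2 * h j < N x} j \<partial>count_space UNIV) * u x"
        unfolding h_def using s by (intro mult_right_mono dyadic_layer_cake) auto
      also have "\<dots> = ennreal (4 powr s) * (\<integral>\<^sup>+j. ennreal (2 powr (s * real_of_int j)) * indicator {j. 2 * h j < N x} j * u x \<partial>count_space UNIV)"
        by (simp add: mult.assoc nn_integral_multc[symmetric])
      finally show "ennpowr (N x) s * u x \<le> ennreal (4 powr s) *
        (\<integral>\<^sup>+j. ennreal (2 powr (s * real_of_int j)) * (u x * indicator {x. 2 * h j < N x} x) \<partial>count_space UNIV)"
        by (simp add: mult_ac indicator_def)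
    qed
    also have "\<dots> = (\<integral>\<^sup>+x. (\<integral>\<^sup>+j. ennreal (4 powr s) * (ennreal (2 powr (s * real_of_int j)) * (u x * indicator {x. 2 * h j < N x} x)) \<partial>count_space UNIV) \<partial>lborel)"
      by (simp add: nn_integral_cmult)
    also have "\<dots> = (\<integral>\<^sup>+j. (\<integral>\<^sup>+x. ennreal (4 powr s) * (ennreal (2 powr (s * real_of_int j)) * (u x * indicator {x. 2 * h j < N x} x)) \<partial>lborel) \<partial>count_space UNIV)"
      by (intro nn_integral_count_space_nn_integral) auto
    also have "\<dots> = ennreal (4 powr s) * (\<integral>\<^sup>+j. (\<integral>\<^sup>+x. ennreal (2 powr (s * real_of_int j)) * (u x * indicator {x. 2 * h j < N x} x) \<partial>lborel) \<partial>count_space UNIV)"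
      by (simp add: nn_integral_cmult)
    also have "\<dots> \<le> ennreal (4 powr s) * (\<integral>\<^sup>+j. (\<integral>\<^sup>+x. ennreal D * (ennreal (2 powr ((s - 1) * real_of_int j)) * (a x * u x * indicator {x. h j < a x} x)) \<partial>lborel) \<partial>count_space UNIV)"
    proof (rule mult_left_mono[OF nn_integral_mono])
      fix j :: int
      have "(\<integral>\<^sup>+x. ennreal (2 powr (s * real_of_int j)) * (u x * indicator {x. 2 * h j < N x} x) \<partial>lborel)
        = ennreal (2 powr ((s - 1) * real_of_int j)) * (h j * (\<integral>\<^sup>+x\<in>{x. 2 * h j < N x}. u x \<partial>lborel))"
        by (simp add: nn_integral_cmult split mult.assoc)
      also have "\<dots> \<le> ennreal (2 powr ((s - 1) * real_of_int j)) * (ennreal D * (\<integral>\<^sup>+x\<in>{x. h j < a x}. (a x * u x) \<partial>lborel))"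
        unfolding N_def using db by (intro mult_left_mono dyadic_maxop_level_set) auto
      also have "\<dots> = (\<integral>\<^sup>+x. ennreal D * (ennreal (2 powr ((s - 1) * real_of_int j)) * (a x * u x * indicator {x. h j < a x} x)) \<partial>lborel)"
        by (simp add: nn_integral_cmult) (simp only: mult.left_commute)
      finally show "(\<integral>\<^sup>+x. ennreal (2 powr (s * real_of_int j)) * (u x * indicator {x. 2 * h j < N x} x) \<partial>lborel) \<le> \<dots>" .
    qed simp
    also have "\<dots> = ennreal (4 powr s) * (\<integral>\<^sup>+x. (\<integral>\<^sup>+j. ennreal D * (ennreal (2 powr ((s - 1) * real_of_int j)) * (a x * u x * indicator {x. h j < a x} x)) \<partial>count_space UNIV) \<partial>lborel)"
      by (subst nn_integral_count_space_nn_integral) auto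
    also have "\<dots> \<le> ennreal (4 powr s) * (\<integral>\<^sup>+x. ennreal D * ennreal K * (ennpowr (a x) s * u x) \<partial>lborel)"
    proof (rule mult_left_mono[OF nn_integral_mono])
      fix x
      have "(\<integral>\<^sup>+j. ennreal D * (ennreal (2 powr ((s - 1) * real_of_int j)) * (a x * u x * indicator {x. h j < a x} x)) \<partial>count_space UNIV)
        = ennreal D * (a x * u x) * (\<integral>\<^sup>+j. ennreal (2 powr ((s - 1) * real_of_int j)) * indicator {j. h j < a x} j \<partial>count_space UNIV)"
        by (subst nn_integral_cmult[symmetric]) (auto simp: mult_ac indicator_def intro!: nn_integral_cong)
      also have "\<dots> \<le> ennreal D * (a x * u x) * (ennreal K * ennpowr (a x) (s - 1))"
        unfolding h_def by (intro mult_left_mono K(2)) simp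
      also have "\<dots> = ennreal D * ennreal K * (ennpowr (a x) s * u x)"
        using ennpowr_add[of "a x" 1 "s - 1"] by (simp add: mult_ac)
      finally show "(\<integral>\<^sup>+j. ennreal D * (ennreal (2 powr ((s - 1) * real_of_int j)) * (a x * u x * indicator {x. h j < a x} x)) \<partial>count_space UNIV) \<le> \<dots>" .
    qed simp
    also have "\<dots> = ennreal (4 powr s * D * K) * (\<integral>\<^sup>+x. ennpowr (a x) s * u x \<partial>lborel)"
      using D K by (simp add: nn_integral_cmult ennreal_mult mult.assoc)
    finally show "(\<integral>\<^sup>+x. ennpowr (dyadic_maxop u a x) s * u x \<partial>lborel) \<le> \<dots>" unfolding N_def .
  qed
qed

section \<open>The bilinear form of the Riesz potential\<close>

definition riesz_kernel :: "real \<Rightarrow> 'a::euclidean_space \<Rightarrow> 'a \<Rightarrow> ennreal" where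
  "riesz_kernel \<alpha> x y = ennreal (1 / norm (x - y) powr (real DIM('a) - \<alpha>))"

text \<open>Integrating over balls of a fixed radius is a symmetric operation, by Tonelli's theorem.\<close>

lemma ball_mass_self_adjoint:
  assumes [measurable]: "f \<in> borel_measurable borel" "g \<in> borel_measurable borel"
  shows "(\<integral>\<^sup>+x. f x * ball_mass g x t \<partial>lborel) = (\<integral>\<^sup>+x. g x * ball_mass f x t \<partial>(lborel :: 'a::euclidean_space measure))"
proof -
  have "(\<integral>\<^sup>+x. f x * ball_mass g x t \<partial>lborel)
    = (\<integral>\<^sup>+x. \<integral>\<^sup>+y. f x * (g y * indicator (ball x t) y) \<partial>lborel \<partial>lborel)"
    unfolding ball_mass_def by (intro nn_integral_cong nn_integral_cmult[symmetric]) measurable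
  also have "\<dots> = (\<integral>\<^sup>+y. \<integral>\<^sup>+x. f x * (g y * indicator (ball x t) y) \<partial>lborel \<partial>lborel)"
  proof (rule lborel_pair.Fubini'[symmetric])
    have "(\<lambda>p. f (fst p) * (g (snd p) * indicator (ball (fst p) t) (snd p))) \<in> borel_measurable (lborel \<Otimes>\<^sub>M lborel)"
      by measurable
    then show "case_prod (\<lambda>x y. f x * (g y * indicator (ball x t) y)) \<in> borel_measurable (lborel \<Otimes>\<^sub>M lborel)"
      by (simp add: case_prod_beta)
  qed
  also have "\<dots> = (\<integral>\<^sup>+y. \<integral>\<^sup>+x. g y * (f x * indicator (ball y t) x) \<partial>lborel \<partial>lborel)"
    by (intro nn_integral_cong) (auto simp: indicator_def dist_commute mult_ac)
  also have "\<dots> = (\<integral>\<^sup>+y. g y * ball_mass f y t \<partial>lborel)"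
    unfolding ball_mass_def by (intro nn_integral_cong nn_integral_cmult) measurable
  finally show ?thesis .
qed

lemma nn_integral_mult_scale_sum:
  assumes [measurable]: "g \<in> borel_measurable borel" "\<And>k. A k \<in> borel_measurable borel"
  shows "(\<integral>\<^sup>+y. g y * (\<integral>\<^sup>+k. \<tau> k * A k y \<partial>count_space (UNIV :: int set)) \<partial>lborel)
    = (\<integral>\<^sup>+k. \<tau> k * (\<integral>\<^sup>+y. g y * A k y \<partial>lborel) \<partial>count_space UNIV)"
proof -
  have "(\<integral>\<^sup>+y. g y * (\<integral>\<^sup>+k. \<tau> k * A k y \<partial>count_space (UNIV :: int set)) \<partial>lborel)
    = (\<integral>\<^sup>+y. (\<integral>\<^sup>+k. \<tau> k * (g y * A k y) \<partial>count_space (UNIV :: int set)) \<partial>lborel)"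
    by (intro nn_integral_cong, subst nn_integral_cmult[symmetric]) (auto simp: mult.left_commute)
  also have "\<dots> = (\<integral>\<^sup>+k. (\<integral>\<^sup>+y. \<tau> k * (g y * A k y) \<partial>lborel) \<partial>count_space UNIV)"
    by (intro nn_integral_count_space_nn_integral) auto
  finally show ?thesis by (simp add: nn_integral_cmult)
qed

text \<open>At the dyadic scale just above \<open>\<bar>x - y\<bar>\<close> the balls around \<open>x\<close> and \<open>y\<close> share the ball of half that
  radius around the midpoint, so this one scale already gives the kernel up to a constant.\<close>

lemma riesz_kernel_le_scale_sum:
  fixes \<alpha> :: real
  assumes \<alpha>: "\<alpha> < real DIM('a)"
  obtains c :: real where "0 < c"
    "\<And>x y :: 'a::euclidean_space. riesz_kernel \<alpha> x y \<le> ennreal c * (\<integral>\<^sup>+k. ennreal (2 powr ((\<alpha> - 2 * real DIM('a)) * real_of_int k)) *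
       ball_mass (indicator (ball x (2 powr real_of_int k))) y (2 powr real_of_int k) \<partial>count_space UNIV)"
proof -
  let ?n = "real DIM('a)" and ?V = "unit_ball_vol (real DIM('a))"
  have V: "0 < ?V" by simp
  then have V0: "?V \<noteq> 0" by linarith
  show ?thesis
  proof (rule that[of "2 powr (2 * ?n - \<alpha>) / ?V"])
    show "0 < 2 powr (2 * ?n - \<alpha>) / ?V" using V by simp
    fix x y :: 'a
    let ?S = "\<integral>\<^sup>+k. ennreal (2 powr ((\<alpha> - 2 * ?n) * real_of_int k)) *
       ball_mass (indicator (ball x (2 powr real_of_int k))) y (2 powr real_of_int k) \<partial>count_space UNIV"
    show "riesz_kernel \<alpha> x y \<le> ennreal (2 powr (2 * ?n - \<alpha>) / ?V) * ?S"
    proof (cases "x = y")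
      case False
      define d where "d = norm (x - y)"
      have d: "0 < d" using False by (simp add: d_def)
      define k where "k = \<lfloor>log 2 d\<rfloor> + 1"
      define K where "K = real_of_int k"
      have K: "K - 1 \<le> log 2 d" "log 2 d < K" unfolding K_def k_def by linarith+
      have dK: "2 powr (K - 1) \<le> d" "d < 2 powr K"
        using K d by (simp_all add: le_log_iff log_less_iff)
      have half: "2 powr K = 2 * 2 powr (K - 1)" by (simp add: powr_diff)
      define m where "m = (1/2) *\<^sub>R (x + y)"
      have mx: "dist x m = d / 2" "dist y m = d / 2"
      proof -
        have "x - m = (1/2) *\<^sub>R (x - y)" "y - m = - ((1/2) *\<^sub>R (x - y))"
          unfolding m_def by (simp_all add: algebra_simps flip: scaleR_add_left)
        then show "dist x m = d / 2" "dist y m = d / 2" by (simp_all add: dist_norm d_def)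
      qed
      have sub: "ball m (2 powr (K - 1)) \<subseteq> ball x (2 powr K) \<inter> ball y (2 powr K)"
      proof
        fix z assume "z \<in> ball m (2 powr (K - 1))"
        then have "dist m z < 2 powr (K - 1)" by simp
        moreover have "dist x z \<le> dist x m + dist m z" "dist y z \<le> dist y m + dist m z"
          by (rule dist_triangle)+
        ultimately show "z \<in> ball x (2 powr K) \<inter> ball y (2 powr K)"
          using mx dK half by simp
      qed
      have "ennreal (?V * (2 powr (K - 1)) ^ DIM('a)) = emeasure lborel (ball m (2 powr (K - 1)))"
        by (simp add: emeasure_ball)
      also have "\<dots> = (\<integral>\<^sup>+z. indicator (ball m (2 powr (K - 1))) z \<partial>lborel)"
        by (intro nn_integral_indicator[symmetric]) simp
      also have "\<dots> \<le> ball_mass (indicator (ball x (2 powr K))) y (2 powr K)"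
        unfolding ball_mass_def using sub by (intro nn_integral_mono) (auto simp: indicator_def)
      finally have "ennreal (2 powr ((\<alpha> - 2 * ?n) * K)) * ennreal (?V * (2 powr (K - 1)) ^ DIM('a))
        \<le> ennreal (2 powr ((\<alpha> - 2 * ?n) * K)) * ball_mass (indicator (ball x (2 powr K))) y (2 powr K)"
        by (rule mult_left_mono) simp
      also have "\<dots> \<le> ?S" unfolding K_def
        using nn_integral_count_space_ge_point[of k UNIV "\<lambda>k. ennreal (2 powr ((\<alpha> - 2 * ?n) * real_of_int k)) *
          ball_mass (indicator (ball x (2 powr real_of_int k))) y (2 powr real_of_int k)"] by simp
      finally have S: "ennreal (2 powr ((\<alpha> - 2 * ?n) * K)) * ennreal (?V * (2 powr (K - 1)) ^ DIM('a)) \<le> ?S" .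
      have "1 / d powr (?n - \<alpha>) \<le> 1 / (2 powr (K - 1)) powr (?n - \<alpha>)"
        using dK \<alpha> by (intro divide_left_mono powr_mono2 mult_pos_pos) (auto intro: d)
      also have "\<dots> = 2 powr ((K - 1) * (\<alpha> - ?n))"
        by (simp add: powr_powr algebra_simps flip: powr_minus_divide)
      also have "\<dots> = (2 powr (2 * ?n - \<alpha>) / ?V) * (2 powr ((\<alpha> - 2 * ?n) * K) * (?V * (2 powr (K - 1)) ^ DIM('a)))"
      proof -
        have "(2 powr (K - 1)) ^ DIM('a) = 2 powr ((K - 1) * ?n)" by (simp add: powr_powr flip: powr_realpow)
        moreover have "2 powr ((K - 1) * (\<alpha> - ?n)) = 2 powr (2 * ?n - \<alpha>) * 2 powr ((\<alpha> - 2 * ?n) * K) * 2 powr ((K - 1) * ?n)"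
          by (simp add: algebra_simps flip: powr_add)
        ultimately show ?thesis by (simp add: field_simps V0)
      qed
      finally have "riesz_kernel \<alpha> x y \<le> ennreal (2 powr (2 * ?n - \<alpha>) / ?V) *
          (ennreal (2 powr ((\<alpha> - 2 * ?n) * K)) * ennreal (?V * (2 powr (K - 1)) ^ DIM('a)))"
        using V unfolding riesz_kernel_def d_def[symmetric] by (simp add: ennreal_leI V0 flip: ennreal_mult)
      also have "\<dots> \<le> ennreal (2 powr (2 * ?n - \<alpha>) / ?V) * ?S" by (rule mult_left_mono[OF S]) simp
      finally show ?thesis .
    qed (simp add: riesz_kernel_def)
  qed
qed

text \<open>Using the symmetry of the ball averages twice moves both of them onto \<open>f\<close> and \<open>g\<close>.\<close>

lemma riesz_form_le_scale_sum:
  fixes \<alpha> :: real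
  assumes \<alpha>: "\<alpha> < real DIM('a)"
  obtains c :: real where "0 < c"
    "\<And>f g :: 'a::euclidean_space \<Rightarrow> ennreal. f \<in> borel_measurable borel \<Longrightarrow> g \<in> borel_measurable borel \<Longrightarrow>
      (\<integral>\<^sup>+x. f x * (\<integral>\<^sup>+y. g y * riesz_kernel \<alpha> x y \<partial>lborel) \<partial>lborel)
      \<le> ennreal c * (\<integral>\<^sup>+k. ennreal (2 powr ((\<alpha> - 2 * real DIM('a)) * real_of_int k)) *
         (\<integral>\<^sup>+x. ball_mass f x (2 powr real_of_int k) * ball_mass g x (2 powr real_of_int k) \<partial>lborel) \<partial>count_space UNIV)"
proof -
  obtain c where c: "0 < c"
    "\<And>x y :: 'a. riesz_kernel \<alpha> x y \<le> ennreal c * (\<integral>\<^sup>+k. ennreal (2 powr ((\<alpha> - 2 * real DIM('a)) * real_of_int k)) *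
       ball_mass (indicator (ball x (2 powr real_of_int k))) y (2 powr real_of_int k) \<partial>count_space UNIV)"
    using riesz_kernel_le_scale_sum[OF \<alpha>] by blast
  show ?thesis
  proof (rule that[OF c(1)])
    fix f g :: "'a \<Rightarrow> ennreal" assume [measurable]: "f \<in> borel_measurable borel" "g \<in> borel_measurable borel"
    define t where "t k = 2 powr real_of_int k" for k :: int
    define \<tau> where "\<tau> k = ennreal (2 powr ((\<alpha> - 2 * real DIM('a)) * real_of_int k))" for k :: int
    have inner: "(\<integral>\<^sup>+y. g y * riesz_kernel \<alpha> x y \<partial>lborel) \<le> ennreal c * (\<integral>\<^sup>+k. \<tau> k * ball_mass (\<lambda>z. ball_mass g z (t k)) x (t k) \<partial>count_space UNIV)" for x
    proof -
      have [measurable]: "(\<lambda>y. \<integral>\<^sup>+k. \<tau> k * ball_mass (indicator (ball x (t k))) y (t k) \<partial>count_space UNIV) \<in> borel_measurable borel"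
      proof -
        have "(\<lambda>y. \<Sum>k. \<tau> (from_nat_into UNIV k) * ball_mass (indicator (ball x (t (from_nat_into UNIV k)))) y (t (from_nat_into UNIV k))) \<in> borel_measurable borel"
          by measurable
        moreover have "bij_betw (from_nat_into UNIV) UNIV (UNIV :: int set)"
          by (rule bij_betw_from_nat_into) (auto simp: infinite_UNIV_int)
        ultimately show ?thesis
          by (simp add: nn_integral_bij_count_space[symmetric] nn_integral_count_space_nat)
      qed
      have "(\<integral>\<^sup>+y. g y * riesz_kernel \<alpha> x y \<partial>lborel)
        \<le> (\<integral>\<^sup>+y. ennreal c * (g y * (\<integral>\<^sup>+k. \<tau> k * ball_mass (indicator (ball x (t k))) y (t k) \<partial>count_space UNIV)) \<partial>lborel)"
        unfolding \<tau>_def t_def by (subst mult.left_commute, intro nn_integral_mono mult_left_mono c(2)) simp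
      also have "\<dots> = ennreal c * (\<integral>\<^sup>+y. g y * (\<integral>\<^sup>+k. \<tau> k * ball_mass (indicator (ball x (t k))) y (t k) \<partial>count_space UNIV) \<partial>lborel)"
        by (intro nn_integral_cmult) measurable
      also have "\<dots> = ennreal c * (\<integral>\<^sup>+k. \<tau> k * (\<integral>\<^sup>+y. g y * ball_mass (indicator (ball x (t k))) y (t k) \<partial>lborel) \<partial>count_space UNIV)"
        by (subst nn_integral_mult_scale_sum) auto
      also have "(\<lambda>k. \<integral>\<^sup>+y. g y * ball_mass (indicator (ball x (t k))) y (t k) \<partial>lborel) = (\<lambda>k. ball_mass (\<lambda>z. ball_mass g z (t k)) x (t k))"
        by (intro ext, subst ball_mass_self_adjoint) (auto simp: ball_mass_def[of "\<lambda>z. ball_mass g z _"] mult.commute)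
      finally show ?thesis .
    qed
    have "(\<integral>\<^sup>+x. f x * (\<integral>\<^sup>+y. g y * riesz_kernel \<alpha> x y \<partial>lborel) \<partial>lborel)
      \<le> (\<integral>\<^sup>+x. (ennreal c * f x) * (\<integral>\<^sup>+k. \<tau> k * ball_mass (\<lambda>z. ball_mass g z (t k)) x (t k) \<partial>count_space UNIV) \<partial>lborel)"
      by (rule nn_integral_mono, subst mult.commute[of "ennreal c"], subst mult.assoc)
         (rule mult_left_mono[OF inner], simp)
    also have "\<dots> = (\<integral>\<^sup>+k. \<tau> k * (\<integral>\<^sup>+x. (ennreal c * f x) * ball_mass (\<lambda>z. ball_mass g z (t k)) x (t k) \<partial>lborel) \<partial>count_space UNIV)"
      by (intro nn_integral_mult_scale_sum) auto
    also have "\<dots> = (\<integral>\<^sup>+k. ennreal c * (\<tau> k * (\<integral>\<^sup>+x. ball_mass f x (t k) * ball_mass g x (t k) \<partial>lborel)) \<partial>count_space UNIV)"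
    proof (intro nn_integral_cong)
      fix k
      have "(\<integral>\<^sup>+x. (ennreal c * f x) * ball_mass (\<lambda>z. ball_mass g z (t k)) x (t k) \<partial>lborel)
        = ennreal c * (\<integral>\<^sup>+x. f x * ball_mass (\<lambda>z. ball_mass g z (t k)) x (t k) \<partial>lborel)"
        by (simp add: mult.assoc nn_integral_cmult)
      also have "\<dots> = ennreal c * (\<integral>\<^sup>+x. ball_mass f x (t k) * ball_mass g x (t k) \<partial>lborel)"
        by (subst ball_mass_self_adjoint) (auto simp: mult.commute)
      finally show "\<tau> k * (\<integral>\<^sup>+x. (ennreal c * f x) * ball_mass (\<lambda>z. ball_mass g z (t k)) x (t k) \<partial>lborel)
        = ennreal c * (\<tau> k * (\<integral>\<^sup>+x. ball_mass f x (t k) * ball_mass g x (t k) \<partial>lborel))"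
        by (simp only: mult.left_commute)
    qed
    also have "\<dots> = ennreal c * (\<integral>\<^sup>+k. \<tau> k * (\<integral>\<^sup>+x. ball_mass f x (t k) * ball_mass g x (t k) \<partial>lborel) \<partial>count_space UNIV)"
      by (simp add: nn_integral_cmult)
    finally show "(\<integral>\<^sup>+x. f x * (\<integral>\<^sup>+y. g y * riesz_kernel \<alpha> x y \<partial>lborel) \<partial>lborel)
      \<le> ennreal c * (\<integral>\<^sup>+k. ennreal (2 powr ((\<alpha> - 2 * real DIM('a)) * real_of_int k)) *
         (\<integral>\<^sup>+x. ball_mass f x (2 powr real_of_int k) * ball_mass g x (2 powr real_of_int k) \<partial>lborel) \<partial>count_space UNIV)"
      unfolding \<tau>_def t_def .
  qed
qed

lemma dual_exponents_gt_1:
  fixes \<alpha> n a b :: real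
  assumes \<alpha>: "0 < \<alpha>" "\<alpha> < n" and a: "1 / a = 1 - \<alpha> / n" and b: "1 / b = \<alpha> / n"
  shows "1 < a" "1 < b"
proof -
  have "b = n / \<alpha>" using b by (metis inverse_divide inverse_eq_divide inverse_inverse_eq)
  then show "1 < b" using \<alpha> by simp
  have "0 < 1 / a" "1 / a < 1" unfolding a using \<alpha> by (auto simp: field_simps)
  then show "1 < a" by (auto simp: divide_less_eq split: if_splits)
qed

text \<open>The average of \<open>u\<^sup>1\<^sup>/\<^sup>a \<phi>\<^sup>1\<^sup>/\<^sup>b\<close> over a ball is bounded in two ways: by Hoelder's inequality, which
  is good at large scales because \<open>\<phi>\<close> has integral at most \<open>1\<close>, and by the maximal function of
  \<open>(\<phi>/u)\<^sup>1\<^sup>/\<^sup>b\<close> with respect to \<open>u\<close>, which is good at small scales. In both, the mean of \<open>u\<close> is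
  estimated by its value in the centre. The function \<open>P\<close> marks the transition.\<close>

lemma ball_mass_le_min_scale:
  fixes \<alpha> A a b :: real
  assumes \<alpha>: "0 < \<alpha>" "\<alpha> < real DIM('a)" and A: "0 \<le> A"
    and a: "1 / a = 1 - \<alpha> / real DIM('a)" and b: "1 / b = \<alpha> / real DIM('a)"
  obtains C1 C2 :: real where "0 \<le> C1" "0 \<le> C2"
    "\<And>u \<phi> :: 'a::euclidean_space \<Rightarrow> ennreal. u \<in> borel_measurable borel \<Longrightarrow> \<phi> \<in> borel_measurable borel \<Longrightarrow>
      (\<And>x. maxop u x \<le> ennreal A * u x) \<Longrightarrow> (AE x in lborel. u x < \<infinity>) \<Longrightarrow> (\<integral>\<^sup>+x. \<phi> x \<partial>lborel) \<le> 1 \<Longrightarrow>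
      \<exists>P \<in> borel_measurable borel. (\<integral>\<^sup>+x. ennpowr (P x) b \<partial>lborel) \<le> ennreal C2 \<and>
        (\<forall>x k. u x < \<infinity> \<longrightarrow> ball_mass (\<lambda>y. ennpowr (u y) (1/a) * ennpowr (\<phi> y) (1/b)) x (2 powr real_of_int k)
          \<le> ennreal C1 * ennreal (2 powr (real DIM('a) * real_of_int k)) * ennpowr (u x) (1/a) *
            min (P x) (ennreal (2 powr (- \<alpha> * real_of_int k))))"
proof -
  let ?n = "real DIM('a)" and ?V = "unit_ball_vol (real DIM('a))"
  have n: "0 < ?n" using \<alpha> by simp
  have V: "0 < ?V" by simp
  note a1 = dual_exponents_gt_1(1)[OF \<alpha> a b] and b1 = dual_exponents_gt_1(2)[OF \<alpha> a b]
  have ab: "1 / a + 1 / b = 1" using a b by simp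
  define D where "D = 5 ^ DIM('a) * A"
  have "0 \<le> D" using A by (simp add: D_def)
  obtain C where C: "0 \<le> C"
    "\<And>u h :: 'a \<Rightarrow> ennreal. u \<in> borel_measurable borel \<Longrightarrow> h \<in> borel_measurable borel \<Longrightarrow> doubling D u \<Longrightarrow>
      (\<integral>\<^sup>+x. ennpowr (dyadic_maxop u h x) b * u x \<partial>lborel) \<le> ennreal C * (\<integral>\<^sup>+x. ennpowr (h x) b * u x \<partial>lborel)"
    by (rule dyadic_maxop_strong_type[OF b1 \<open>0 \<le> D\<close>, where 'a = 'a], rule that, assumption, blast)
  define C1 where "C1 = max (?V * A) ((?V * A) powr (1/a))"
  \<comment> \<open>The two entries are the constants of the maximal function bound and of the Hoelder bound.\<close>
  have C1: "?V * A \<le> C1" "(?V * A) powr (1/a) \<le> C1" "0 \<le> C1" using V A by (auto simp: C1_def le_max_iff_disj)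
  show ?thesis
  proof (rule that[OF C1(3) C(1)])
    fix u \<phi> :: "'a \<Rightarrow> ennreal"
    assume [measurable]: "u \<in> borel_measurable borel" "\<phi> \<in> borel_measurable borel"
      and A1: "\<And>x. maxop u x \<le> ennreal A * u x" and fin: "AE x in lborel. u x < \<infinity>"
      and \<phi>: "(\<integral>\<^sup>+x. \<phi> x \<partial>lborel) \<le> 1"
    define f where "f y = ennpowr (u y) (1/a) * ennpowr (\<phi> y) (1/b)" for y
    define h where "h y = ennpowr (\<phi> y / u y) (1/b)" for y
    have [measurable]: "f \<in> borel_measurable borel" "h \<in> borel_measurable borel"
      unfolding f_def h_def by measurable
    have u_split: "u y = ennpowr (u y) (1/a) * ennpowr (u y) (1/b)" for y
      using ennpowr_add[of "u y" "1/a" "1/b"] ab by simp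
    have f_eq: "AE y in lborel. f y = h y * u y"
      using fin
    proof eventually_elim
      case (elim y)
      show ?case
      proof (cases "u y = 0")
        case False
        then have r: "ennpowr (u y) (1/b) \<noteq> 0" "ennpowr (u y) (1/b) \<noteq> top" using elim by auto
        have "h y * u y = (ennpowr (\<phi> y) (1/b) / ennpowr (u y) (1/b) * ennpowr (u y) (1/b)) * ennpowr (u y) (1/a)"
          using b1 by (subst u_split) (simp add: h_def ennpowr_divide mult_ac)
        also have "\<dots> = f y"
          using r by (simp add: f_def mult.commute ennreal_times_divide ennreal_mult_divide_eq)
        finally show ?thesis ..
      qed (simp add: f_def)
    qed
    define P where "P x = ennpowr (u x) (1/b) * dyadic_maxop u h x" for x
    have [measurable]: "P \<in> borel_measurable borel" unfolding P_def by measurable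
    have "(\<integral>\<^sup>+x. ennpowr (P x) b \<partial>lborel) = (\<integral>\<^sup>+x. ennpowr (dyadic_maxop u h x) b * u x \<partial>lborel)"
      using b1 by (simp add: P_def ennpowr_mult ennpowr_ennpowr mult.commute)
    also have "\<dots> \<le> ennreal C * (\<integral>\<^sup>+x. ennpowr (h x) b * u x \<partial>lborel)"
      unfolding D_def using A A1 by (intro C(2)[unfolded D_def] doubling_of_A1) auto
    also have "\<dots> \<le> ennreal C * (\<integral>\<^sup>+x. \<phi> x \<partial>lborel)"
    proof (intro mult_left_mono nn_integral_mono_AE)
      show "AE x in lborel. ennpowr (h x) b * u x \<le> \<phi> x"
        using fin
      proof eventually_elim
        case (elim x)
        have "ennpowr (h x) b = \<phi> x / u x" using b1 by (simp add: h_def ennpowr_ennpowr)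
        then show ?case using elim
          by (cases "u x = 0") (auto simp: ennreal_times_divide mult.commute ennreal_mult_divide_eq)
      qed
    qed simp
    also have "\<dots> \<le> ennreal C" using mult_left_mono[OF \<phi>, of "ennreal C"] by simp
    finally have P_int: "(\<integral>\<^sup>+x. ennpowr (P x) b \<partial>lborel) \<le> ennreal C" .
    have "ball_mass f x (2 powr real_of_int k)
          \<le> ennreal C1 * ennreal (2 powr (?n * real_of_int k)) * ennpowr (u x) (1/a) *
            min (P x) (ennreal (2 powr (- \<alpha> * real_of_int k)))" if ux: "u x < \<infinity>" for x k
    proof -
      define t where "t = 2 powr real_of_int k"
      define T where "T = 2 powr (?n * real_of_int k)"
      have t: "0 < t" by (simp add: t_def)
      have tT: "t ^ DIM('a) = T" by (simp add: t_def T_def powr_powr mult.commute flip: powr_realpow)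
      have T: "0 < T" by (simp add: T_def)
      have vol: "emeasure lborel (ball x t) = ennreal (?V * T)"
        using t by (simp add: emeasure_ball tT)
      have "ball_mass u x t \<le> emeasure lborel (ball x t) * maxop u x"
        using t by (intro ball_mass_le_maxop) auto
      also have "\<dots> \<le> ennreal (?V * T) * (ennreal A * u x)"
        unfolding vol by (intro mult_left_mono A1) simp
      also have "\<dots> = ennreal (?V * A * T) * u x"
        using V A T by (simp add: ennreal_mult mult_ac)
      finally have mass_u: "ball_mass u x t \<le> ennreal (?V * A * T) * u x" .
      then have mass_fin: "ball_mass u x t \<noteq> top"
        using ux by (auto simp: top_unique ennreal_mult_eq_top_iff)
      have "ball_mass f x t = (\<integral>\<^sup>+y. ennpowr (u y * indicator (ball x t) y) (1/a) * ennpowr (\<phi> y) (1/b) \<partial>lborel)"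
        unfolding ball_mass_def f_def by (intro nn_integral_cong) (auto simp: indicator_def)
      also have "\<dots> \<le> ennpowr (ball_mass u x t) (1/a)"
        unfolding ball_mass_def by (intro nn_integral_Hoelder_le a1 ab \<phi>) measurable
      also have "\<dots> \<le> ennpowr (ennreal (?V * A * T) * u x) (1/a)"
        using a1 by (intro ennpowr_mono mass_u) auto
      also have "\<dots> = ennreal ((?V * A) powr (1/a) * (T powr (1/a))) * ennpowr (u x) (1/a)"
        using a1 V A T by (simp add: ennpowr_mult ennpowr_ennreal powr_mult)
      also have "T powr (1/a) = T * 2 powr (- \<alpha> * real_of_int k)"
        using n unfolding a T_def by (simp add: powr_powr algebra_simps flip: powr_add)
      also have "ennreal ((?V * A) powr (1/a) * (T * 2 powr (- \<alpha> * real_of_int k))) * ennpowr (u x) (1/a)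
        \<le> ennreal (C1 * (T * 2 powr (- \<alpha> * real_of_int k))) * ennpowr (u x) (1/a)"
        using C1 T by (intro mult_right_mono ennreal_leI) auto
      finally have le1: "ball_mass f x t \<le> ennreal C1 * ennreal T * ennpowr (u x) (1/a) * ennreal (2 powr (- \<alpha> * real_of_int k))"
        using C1(3) T by (simp add: ennreal_mult mult_ac)
      have "ball_mass f x t = ball_mass (\<lambda>y. h y * u y) x t"
        unfolding ball_mass_def using f_eq by (intro nn_integral_cong_AE) auto
      also have "\<dots> \<le> dyadic_maxop u h x * ball_mass u x t"
      proof (cases "ball_mass u x t = 0")
        case True
        then have "AE y in lborel. u y * indicator (ball x t) y = 0"
          unfolding ball_mass_def by (subst (asm) nn_integral_0_iff_AE) auto
        then have "ball_mass (\<lambda>y. h y * u y) x t = 0"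
          unfolding ball_mass_def by (subst nn_integral_0_iff_AE) (auto elim: eventually_mono)
        then show ?thesis by simp
      next
        case False
        have "ball_mass (\<lambda>y. h y * u y) x t = ball_mass (\<lambda>y. h y * u y) x t / ball_mass u x t * ball_mass u x t"
          using False mass_fin by (simp add: ennreal_divide_mult_cancel)
        also have "\<dots> \<le> dyadic_maxop u h x * ball_mass u x t"
          unfolding dyadic_maxop_def t_def by (intro mult_right_mono SUP_upper) auto
        finally show ?thesis .
      qed
      also have "\<dots> \<le> dyadic_maxop u h x * (ennreal (?V * A * T) * u x)"
        by (intro mult_left_mono mass_u) simp
      also have "\<dots> \<le> dyadic_maxop u h x * (ennreal (C1 * T) * u x)"
        using C1 T by (intro mult_left_mono mult_right_mono ennreal_leI) auto
      also have "\<dots> = ennreal C1 * ennreal T * ennpowr (u x) (1/a) * P x"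
        using C1(3) T unfolding P_def by (subst u_split) (simp add: ennreal_mult mult_ac)
      finally have le2: "ball_mass f x t \<le> ennreal C1 * ennreal T * ennpowr (u x) (1/a) * P x" .
      show ?thesis using le1 le2 unfolding t_def T_def by (auto simp: min_def)
    qed
    then show "\<exists>P \<in> borel_measurable borel. (\<integral>\<^sup>+x. ennpowr (P x) b \<partial>lborel) \<le> ennreal C \<and>
        (\<forall>x k. u x < \<infinity> \<longrightarrow> ball_mass (\<lambda>y. ennpowr (u y) (1/a) * ennpowr (\<phi> y) (1/b)) x (2 powr real_of_int k)
          \<le> ennreal C1 * ennreal (2 powr (?n * real_of_int k)) * ennpowr (u x) (1/a) *
            min (P x) (ennreal (2 powr (- \<alpha> * real_of_int k))))"
      using P_int unfolding f_def by (intro bexI[of _ P]) auto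
  qed
qed

text \<open>With both averages bounded by the minimum above, the sum over the scales is at most a multiple of
  \<open>max P Q\<close>, and the remaining integral of \<open>(u z)\<^sup>1\<^sup>/\<^sup>a max P Q\<close> is estimated by Young's inequality.\<close>

theorem riesz_form_bounded:
  fixes \<alpha> A B a b :: real
  assumes \<alpha>: "0 < \<alpha>" "\<alpha> < real DIM('a)" and A: "0 \<le> A" and B: "0 \<le> B"
    and a: "1 / a = 1 - \<alpha> / real DIM('a)" and b: "1 / b = \<alpha> / real DIM('a)"
  obtains C :: real where "0 \<le> C"
    "\<And>u z \<phi> \<psi> :: 'a::euclidean_space \<Rightarrow> ennreal.
      \<lbrakk>u \<in> borel_measurable borel; z \<in> borel_measurable borel; \<phi> \<in> borel_measurable borel; \<psi> \<in> borel_measurable borel;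
       \<And>x. maxop u x \<le> ennreal A * u x; \<And>x. maxop z x \<le> ennreal A * z x;
       AE x in lborel. u x < \<infinity>; AE x in lborel. z x < \<infinity>;
       (\<integral>\<^sup>+x. u x * z x \<partial>lborel) \<le> ennreal B; (\<integral>\<^sup>+x. \<phi> x \<partial>lborel) \<le> 1; (\<integral>\<^sup>+x. \<psi> x \<partial>lborel) \<le> 1\<rbrakk> \<Longrightarrow>
      (\<integral>\<^sup>+x. ennpowr (u x) (1/a) * ennpowr (\<phi> x) (1/b) *
        (\<integral>\<^sup>+y. ennpowr (z y) (1/a) * ennpowr (\<psi> y) (1/b) * riesz_kernel \<alpha> x y \<partial>lborel) \<partial>lborel) \<le> ennreal C"
proof -
  let ?n = "real DIM('a)"
  note a1 = dual_exponents_gt_1(1)[OF \<alpha> a b] and b1 = dual_exponents_gt_1(2)[OF \<alpha> a b]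
  have ab: "1 / a + 1 / b = 1" using a b by simp
  obtain C1 C2 where C12: "0 \<le> C1" "0 \<le> C2"
    and min_scale: "\<And>u \<phi> :: 'a \<Rightarrow> ennreal. u \<in> borel_measurable borel \<Longrightarrow> \<phi> \<in> borel_measurable borel \<Longrightarrow>
      (\<And>x. maxop u x \<le> ennreal A * u x) \<Longrightarrow> (AE x in lborel. u x < \<infinity>) \<Longrightarrow> (\<integral>\<^sup>+x. \<phi> x \<partial>lborel) \<le> 1 \<Longrightarrow>
      \<exists>P \<in> borel_measurable borel. (\<integral>\<^sup>+x. ennpowr (P x) b \<partial>lborel) \<le> ennreal C2 \<and>
        (\<forall>x k. u x < \<infinity> \<longrightarrow> ball_mass (\<lambda>y. ennpowr (u y) (1/a) * ennpowr (\<phi> y) (1/b)) x (2 powr real_of_int k)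
          \<le> ennreal C1 * ennreal (2 powr (?n * real_of_int k)) * ennpowr (u x) (1/a) *
            min (P x) (ennreal (2 powr (- \<alpha> * real_of_int k))))"
    using ball_mass_le_min_scale[OF \<alpha> A a b] by blast
  obtain c where c: "0 < c"
    "\<And>f g :: 'a \<Rightarrow> ennreal. f \<in> borel_measurable borel \<Longrightarrow> g \<in> borel_measurable borel \<Longrightarrow>
      (\<integral>\<^sup>+x. f x * (\<integral>\<^sup>+y. g y * riesz_kernel \<alpha> x y \<partial>lborel) \<partial>lborel)
      \<le> ennreal c * (\<integral>\<^sup>+k. ennreal (2 powr ((\<alpha> - 2 * ?n) * real_of_int k)) *
         (\<integral>\<^sup>+x. ball_mass f x (2 powr real_of_int k) * ball_mass g x (2 powr real_of_int k) \<partial>lborel) \<partial>count_space UNIV)"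
    using riesz_form_le_scale_sum[OF \<alpha>(2)] by blast
  obtain K where K: "0 < K"
    "\<And>P. (\<integral>\<^sup>+k. ennreal (2 powr (\<alpha> * real_of_int k)) * (min P (ennreal (2 powr (- \<alpha> * real_of_int k))))^2 \<partial>count_space UNIV)
      \<le> ennreal K * P"
    using dyadic_sum_min_le[OF \<alpha>(1)] by blast
  show ?thesis
  proof (rule that[of "c * (C1^2 * K * (B + 2 * C2))"])
    show "0 \<le> c * (C1^2 * K * (B + 2 * C2))" using c(1) K(1) B C12 by simp
    fix u z \<phi> \<psi> :: "'a \<Rightarrow> ennreal"
    assume [measurable]: "u \<in> borel_measurable borel" "z \<in> borel_measurable borel"
        "\<phi> \<in> borel_measurable borel" "\<psi> \<in> borel_measurable borel"
      and A1: "\<And>x. maxop u x \<le> ennreal A * u x" "\<And>x. maxop z x \<le> ennreal A * z x"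
      and fin: "AE x in lborel. u x < \<infinity>" "AE x in lborel. z x < \<infinity>"
      and uz: "(\<integral>\<^sup>+x. u x * z x \<partial>lborel) \<le> ennreal B"
      and int: "(\<integral>\<^sup>+x. \<phi> x \<partial>lborel) \<le> 1" "(\<integral>\<^sup>+x. \<psi> x \<partial>lborel) \<le> 1"
    define f where "f y = ennpowr (u y) (1/a) * ennpowr (\<phi> y) (1/b)" for y
    define g where "g y = ennpowr (z y) (1/a) * ennpowr (\<psi> y) (1/b)" for y
    have [measurable]: "f \<in> borel_measurable borel" "g \<in> borel_measurable borel"
      unfolding f_def g_def by measurable
    define t where "t k = 2 powr real_of_int k" for k :: int
    define \<tau> where "\<tau> k = ennreal (2 powr ((\<alpha> - 2 * ?n) * real_of_int k))" for k :: int
    obtain P where [measurable]: "P \<in> borel_measurable borel"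
      and P_int: "(\<integral>\<^sup>+x. ennpowr (P x) b \<partial>lborel) \<le> ennreal C2"
      and P: "\<And>x k. u x < \<infinity> \<Longrightarrow> ball_mass f x (t k)
          \<le> ennreal C1 * ennreal (2 powr (?n * real_of_int k)) * ennpowr (u x) (1/a) *
            min (P x) (ennreal (2 powr (- \<alpha> * real_of_int k)))"
      using min_scale[of u \<phi>] A1(1) fin(1) int(1) unfolding f_def t_def by auto
    obtain Q where [measurable]: "Q \<in> borel_measurable borel"
      and Q_int: "(\<integral>\<^sup>+x. ennpowr (Q x) b \<partial>lborel) \<le> ennreal C2"
      and Q: "\<And>x k. z x < \<infinity> \<Longrightarrow> ball_mass g x (t k)
          \<le> ennreal C1 * ennreal (2 powr (?n * real_of_int k)) * ennpowr (z x) (1/a) *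
            min (Q x) (ennreal (2 powr (- \<alpha> * real_of_int k)))"
      using min_scale[of z \<psi>] A1(2) fin(2) int(2) unfolding g_def t_def by auto
    define R where "R x = max (P x) (Q x)" for x
    have [measurable]: "R \<in> borel_measurable borel" unfolding R_def by measurable
    let ?U = "\<lambda>x. ennpowr (u x * z x) (1/a)"
    let ?m = "\<lambda>x k. min (R x) (ennreal (2 powr (- \<alpha> * real_of_int k)))"
    have "(\<integral>\<^sup>+k. \<tau> k * (\<integral>\<^sup>+x. ball_mass f x (t k) * ball_mass g x (t k) \<partial>lborel) \<partial>count_space UNIV)
      \<le> (\<integral>\<^sup>+k. (\<integral>\<^sup>+x. ennreal (C1^2) * (?U x * (ennreal (2 powr (\<alpha> * real_of_int k)) * (?m x k)^2)) \<partial>lborel) \<partial>count_space UNIV)"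
    proof (rule nn_integral_mono)
      fix k :: int
      define T where "T = 2 powr (?n * real_of_int k)"
      have T: "0 < T" by (simp add: T_def)
      have \<tau>: "\<tau> k * (ennreal T * ennreal T) = ennreal (2 powr (\<alpha> * real_of_int k))"
      proof -
        have "2 powr ((\<alpha> - 2 * ?n) * real_of_int k) * (T * T) = 2 powr (\<alpha> * real_of_int k)"
          unfolding T_def by (simp add: algebra_simps flip: powr_add)
        then show ?thesis unfolding \<tau>_def using T by (simp flip: ennreal_mult)
      qed
      have "\<tau> k * (\<integral>\<^sup>+x. ball_mass f x (t k) * ball_mass g x (t k) \<partial>lborel) = (\<integral>\<^sup>+x. \<tau> k * (ball_mass f x (t k) * ball_mass g x (t k)) \<partial>lborel)"
        by (simp add: nn_integral_cmult)
      also have "\<dots> \<le> (\<integral>\<^sup>+x. ennreal (C1^2) * (?U x * (ennreal (2 powr (\<alpha> * real_of_int k)) * (?m x k)^2)) \<partial>lborel)"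
      proof (rule nn_integral_mono_AE)
        show "AE x in lborel. \<tau> k * (ball_mass f x (t k) * ball_mass g x (t k))
          \<le> ennreal (C1^2) * (?U x * (ennreal (2 powr (\<alpha> * real_of_int k)) * (?m x k)^2))"
          using fin
        proof eventually_elim
          case (elim x)
          have "ball_mass f x (t k) \<le> ennreal C1 * ennreal T * ennpowr (u x) (1/a) * min (P x) (ennreal (2 powr (- \<alpha> * real_of_int k)))"
            using P[OF elim(1)] unfolding T_def .
          also have "\<dots> \<le> ennreal C1 * ennreal T * ennpowr (u x) (1/a) * ?m x k"
            by (intro mult_left_mono min.mono) (auto simp: R_def)
          finally have fP: "ball_mass f x (t k) \<le> ennreal C1 * ennreal T * ennpowr (u x) (1/a) * ?m x k" .
          have "ball_mass g x (t k) \<le> ennreal C1 * ennreal T * ennpowr (z x) (1/a) * min (Q x) (ennreal (2 powr (- \<alpha> * real_of_int k)))"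
            using Q[OF elim(2)] unfolding T_def .
          also have "\<dots> \<le> ennreal C1 * ennreal T * ennpowr (z x) (1/a) * ?m x k"
            by (intro mult_left_mono min.mono) (auto simp: R_def)
          finally have gQ: "ball_mass g x (t k) \<le> ennreal C1 * ennreal T * ennpowr (z x) (1/a) * ?m x k" .
          have "\<tau> k * (ball_mass f x (t k) * ball_mass g x (t k))
            \<le> \<tau> k * ((ennreal C1 * ennreal T * ennpowr (u x) (1/a) * ?m x k) * (ennreal C1 * ennreal T * ennpowr (z x) (1/a) * ?m x k))"
            by (intro mult_left_mono mult_mono fP gQ) auto
          also have "\<dots> = (ennreal C1 * ennreal C1) * (ennpowr (u x) (1/a) * ennpowr (z x) (1/a)) * (\<tau> k * (ennreal T * ennreal T)) * (?m x k)^2"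
            by (simp only: power2_eq_square mult_ac)
          also have "\<dots> = ennreal (C1^2) * (?U x * (ennreal (2 powr (\<alpha> * real_of_int k)) * (?m x k)^2))"
            using a1 C12(1) unfolding \<tau> by (simp only: ennpowr_mult[of "1/a"] power2_eq_square[of C1] ennreal_mult mult.assoc zero_less_divide_1_iff less_trans[OF zero_less_one a1])
          finally show ?case .
        qed
      qed
      finally show "\<tau> k * (\<integral>\<^sup>+x. ball_mass f x (t k) * ball_mass g x (t k) \<partial>lborel)
        \<le> (\<integral>\<^sup>+x. ennreal (C1^2) * (?U x * (ennreal (2 powr (\<alpha> * real_of_int k)) * (?m x k)^2)) \<partial>lborel)" .
    qed
    also have "\<dots> = (\<integral>\<^sup>+x. (\<integral>\<^sup>+k. ennreal (C1^2) * (?U x * (ennreal (2 powr (\<alpha> * real_of_int k)) * (?m x k)^2)) \<partial>count_space UNIV) \<partial>lborel)"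
      by (intro nn_integral_count_space_nn_integral[symmetric]) auto
    also have "\<dots> \<le> (\<integral>\<^sup>+x. ennreal (C1^2 * K) * (u x * z x + (ennpowr (P x) b + ennpowr (Q x) b)) \<partial>lborel)"
    proof (rule nn_integral_mono)
      fix x
      have "(\<integral>\<^sup>+k. ennreal (C1^2) * (?U x * (ennreal (2 powr (\<alpha> * real_of_int k)) * (?m x k)^2)) \<partial>count_space UNIV)
        = ennreal (C1^2) * (?U x * (\<integral>\<^sup>+k. ennreal (2 powr (\<alpha> * real_of_int k)) * (?m x k)^2 \<partial>count_space UNIV))"
        by (simp add: nn_integral_cmult)
      also have "\<dots> \<le> ennreal (C1^2) * (?U x * (ennreal K * R x))"
        by (intro mult_left_mono K(2)) auto
      also have "\<dots> = ennreal (C1^2 * K) * (?U x * R x)"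
        using K(1) by (simp add: ennreal_mult mult_ac)
      also have "\<dots> \<le> ennreal (C1^2 * K) * (ennpowr (?U x) a + ennpowr (R x) b)"
        by (intro mult_left_mono ennreal_Young a1 ab) simp
      also have "\<dots> \<le> ennreal (C1^2 * K) * (u x * z x + (ennpowr (P x) b + ennpowr (Q x) b))"
        using a1 by (intro mult_left_mono add_mono) (auto simp: ennpowr_ennpowr R_def max_def)
      finally show "(\<integral>\<^sup>+k. ennreal (C1^2) * (?U x * (ennreal (2 powr (\<alpha> * real_of_int k)) * (?m x k)^2)) \<partial>count_space UNIV)
        \<le> ennreal (C1^2 * K) * (u x * z x + (ennpowr (P x) b + ennpowr (Q x) b))" .
    qed
    also have "\<dots> = ennreal (C1^2 * K) * ((\<integral>\<^sup>+x. u x * z x \<partial>lborel) + ((\<integral>\<^sup>+x. ennpowr (P x) b \<partial>lborel) + (\<integral>\<^sup>+x. ennpowr (Q x) b \<partial>lborel)))"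
      by (simp add: nn_integral_cmult nn_integral_add)
    also have "\<dots> \<le> ennreal (C1^2 * K) * (ennreal B + (ennreal C2 + ennreal C2))"
      by (intro mult_left_mono add_mono uz P_int Q_int) simp
    also have "\<dots> = ennreal (C1^2 * K * (B + 2 * C2))"
    proof -
      have "ennreal B + (ennreal C2 + ennreal C2) = ennreal (B + (C2 + C2))"
        using B C12(2) by (simp only: ennreal_plus add_nonneg_nonneg)
      also have "B + (C2 + C2) = B + 2 * C2" by simp
      finally show ?thesis
        using K(1) B C12(2) by (simp only: ennreal_mult[symmetric] zero_le_power2 mult_nonneg_nonneg
          add_nonneg_nonneg less_imp_le zero_le_numeral)
    qed
    finally have sum: "(\<integral>\<^sup>+k. \<tau> k * (\<integral>\<^sup>+x. ball_mass f x (t k) * ball_mass g x (t k) \<partial>lborel) \<partial>count_space UNIV)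
      \<le> ennreal (C1^2 * K * (B + 2 * C2))" .
    have "(\<integral>\<^sup>+x. f x * (\<integral>\<^sup>+y. g y * riesz_kernel \<alpha> x y \<partial>lborel) \<partial>lborel)
      \<le> ennreal c * (\<integral>\<^sup>+k. \<tau> k * (\<integral>\<^sup>+x. ball_mass f x (t k) * ball_mass g x (t k) \<partial>lborel) \<partial>count_space UNIV)"
      unfolding \<tau>_def t_def by (intro c(2)) auto
    also have "\<dots> \<le> ennreal c * ennreal (C1^2 * K * (B + 2 * C2))" by (intro mult_left_mono sum) simp
    also have "\<dots> = ennreal (c * (C1^2 * K * (B + 2 * C2)))"
      using c(1) K(1) B C12 by (intro ennreal_mult[symmetric]) auto
    finally show "(\<integral>\<^sup>+x. ennpowr (u x) (1/a) * ennpowr (\<phi> x) (1/b) *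
        (\<integral>\<^sup>+y. ennpowr (z y) (1/a) * ennpowr (\<psi> y) (1/b) * riesz_kernel \<alpha> x y \<partial>lborel) \<partial>lborel)
        \<le> ennreal (c * (C1^2 * K * (B + 2 * C2)))"
      unfolding f_def g_def .
  qed
qed

section \<open>Factoring functions of the weighted spaces\<close>

lemma borel_AE_representative:
  fixes f :: "'a::euclidean_space \<Rightarrow> ennreal"
  assumes "f \<in> borel_measurable lebesgue"
  obtains f' where "f' \<in> borel_measurable borel" "AE x in lebesgue. f x = f' x" "AE x in lborel. f x = f' x"
proof -
  obtain f' where "f' \<in> borel_measurable borel" "AE x in lborel. f x = f' x"
    using completion_ex_borel_measurable[of f lborel] assms by auto
  then show ?thesis using that by (auto simp: AE_completion_iff)
qed

lemma AE_lborel_le_of_AE_lebesgue_le: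
  fixes h k :: "'a::euclidean_space \<Rightarrow> ennreal"
  assumes h: "h \<in> borel_measurable lebesgue" and [measurable]: "k \<in> borel_measurable borel"
    and le: "AE x in lebesgue. h x \<le> k x"
  shows "AE x in lborel. h x \<le> k x"
proof -
  obtain h' where [measurable]: "h' \<in> borel_measurable borel"
    and h': "AE x in lebesgue. h x = h' x" "AE x in lborel. h x = h' x"
    by (rule borel_AE_representative[OF h])
  have "AE x in lebesgue. h' x \<le> k x" using le h'(1) by eventually_elim simp
  then have "AE x in lborel. h' x \<le> k x" by (subst (asm) AE_completion_iff) auto
  then show ?thesis using h'(2) by eventually_elim simp
qed

text \<open>Put \<open>\<phi> = (g \<omega>)\<^sup>e\<close>. The function \<open>\<phi>\<^sup>1\<^sup>/\<^sup>s / v\<close> lies in the space on which the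
  maximal operator is bounded, and the relation between the exponents says that
  \<open>g = (\<phi>\<^sup>1\<^sup>/\<^sup>s / v)\<^sup>1\<^sup>/\<^sup>a \<phi>\<^sup>1\<^sup>/\<^sup>b\<close> almost everywhere. The Rubio de Francia algorithm replaces the first factor by
  a majorant \<open>u\<close> that dominates its own maximal function up to a constant.\<close>

lemma factor_through_A1_weight:
  fixes N a b :: real and g \<omega> s :: "'a::euclidean_space \<Rightarrow> ennreal" and e :: "'a \<Rightarrow> real"
  assumes s: "s \<in> exponents" and \<omega>: "weight \<omega>" and v: "weight v" "\<And>x. v x = ennpowr (\<omega> x) a" and N: "1 \<le> N"
    and bd: "\<And>h. h \<in> borel_measurable lebesgue \<Longrightarrow> wnorm s v h < \<infinity> \<Longrightarrow> wnorm s v (maxop h) \<le> ennreal N * wnorm s v h"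
    and a: "0 < a" and e: "e \<in> borel_measurable lebesgue" "\<And>x. 0 < e x" "\<And>x. 1 / e x = enn2real (inverse (s x)) / a + 1 / b"
    and g: "g \<in> borel_measurable lebesgue" "(\<integral>\<^sup>+x. ennpowr (g x * \<omega> x) (e x) \<partial>lebesgue) \<le> 1"
  obtains u \<phi> where "u \<in> borel_measurable borel" "\<phi> \<in> borel_measurable borel"
    "AE x in lebesgue. g x \<le> ennpowr (u x) (1/a) * ennpowr (\<phi> x) (1/b)"
    "(\<integral>\<^sup>+x. \<phi> x \<partial>lborel) \<le> 1" "\<And>x. maxop u x \<le> ennreal (4 * N) * u x" "AE x in lborel. u x < \<infinity>"
    "unit_ball s (\<lambda>x. u x * v x / 12)"
proof -
  note [measurable] = exponents_measurable[OF s] e(1) g(1)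
  from \<omega> v(1) have [measurable]: "\<omega> \<in> borel_measurable lebesgue" "v \<in> borel_measurable lebesgue"
    by (simp_all add: weight_def)
  have \<omega>_pos: "AE x in lebesgue. 0 < \<omega> x \<and> \<omega> x < \<infinity>" and v_pos: "AE x in lebesgue. 0 < v x \<and> v x < \<infinity>"
    using \<omega> v(1) by (simp_all add: weight_def)
  define \<phi>0 where "\<phi>0 x = ennpowr (g x * \<omega> x) (e x)" for x
  have [measurable]: "\<phi>0 \<in> borel_measurable lebesgue" unfolding \<phi>0_def by measurable
  obtain \<phi> where \<phi>: "\<phi> \<in> borel_measurable borel" "AE x in lebesgue. \<phi>0 x = \<phi> x" "AE x in lborel. \<phi>0 x = \<phi> x"
    by (rule borel_AE_representative[of \<phi>0]) auto
  have \<phi>0_int: "(\<integral>\<^sup>+x. \<phi>0 x \<partial>lebesgue) \<le> 1" using g(2) by (simp add: \<phi>0_def)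
  have \<phi>0_fin: "AE x in lebesgue. \<phi>0 x \<noteq> \<infinity>"
    using \<phi>0_int by (intro nn_integral_noteq_infinite) (auto simp: top_unique)
  define \<kappa> where "\<kappa> x = enn2real (inverse (s x))" for x
  define F where "F x = ennpowr (\<phi>0 x) (\<kappa> x) * inverse (v x)" for x
  have [measurable]: "F \<in> borel_measurable lebesgue" unfolding F_def \<kappa>_def by measurable
  have Fv: "AE x in lebesgue. F x * v x = ennpowr (\<phi>0 x) (\<kappa> x)"
    using v_pos
  proof eventually_elim
    case (elim x)
    then have "v x \<noteq> 0" "v x \<noteq> top" by (auto simp: less_top)
    then have "inverse (v x) * v x = 1" using ennreal_divide_mult_cancel[of "v x" 1] by (simp add: divide_ennreal_def)
    then show ?case by (simp add: F_def mult.assoc)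
  qed
  have half: "(1 :: ennreal) / 2 + 1 / 2 = 1"
    using ennreal_divide_mult_cancel[of 2 1] by (simp add: mult_2_right)
  have F_ball: "unit_ball s (\<lambda>x. F x * v x / 2)"
    unfolding unit_ball_def
  proof (intro exI[of _ "1/2"] conjI)
    show "AE x in lebesgue. s x = \<infinity> \<longrightarrow> F x * v x / 2 \<le> 1 / 2"
      using Fv \<phi>0_fin
    proof eventually_elim
      case (elim x)
      have "ennpowr (\<phi>0 x) 0 \<le> 1"
        using elim(2) by (auto simp: ennpowr_def)
      then show ?case using elim(1) by (auto simp: \<kappa>_def intro!: divide_right_mono_ennreal)
    qed
    have "(\<integral>\<^sup>+x\<in>{x. s x \<noteq> \<infinity>}. ennpowr (F x * v x / 2) (enn2real (s x)) \<partial>lebesgue) \<le> (\<integral>\<^sup>+x. (1/2) * \<phi>0 x \<partial>lebesgue)"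
    proof (rule nn_integral_mono_AE)
      show "AE x in lebesgue. ennpowr (F x * v x / 2) (enn2real (s x)) * indicator {x. s x \<noteq> \<infinity>} x \<le> (1/2) * \<phi>0 x"
        using Fv
      proof eventually_elim
        case (elim x)
        show ?case
        proof (cases "s x")
          case (real r)
          then have r: "1 \<le> r" using exponents_ge_1[OF s, of x] by (metis ennreal_le_iff ennreal_1)
          have "\<kappa> x * r = 1" using real r by (simp add: \<kappa>_def inverse_ennreal)
          moreover have "ennpowr ((1/2) * ennpowr (\<phi>0 x) (\<kappa> x)) r \<le> (1/2) * ennpowr (ennpowr (\<phi>0 x) (\<kappa> x)) r"
            using r by (intro ennpowr_cmult_le) (auto simp: divide_le_posI_ennreal)
          ultimately show ?thesis
            using real elim by (simp add: ennpowr_ennpowr divide_ennreal_def mult.commute)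
        qed simp
      qed
    qed
    also have "\<dots> = (1/2) * (\<integral>\<^sup>+x. \<phi>0 x \<partial>lebesgue)" by (intro nn_integral_cmult) measurable
    also have "\<dots> \<le> (1/2) * 1" by (intro mult_left_mono \<phi>0_int) simp
    finally have "(\<integral>\<^sup>+x\<in>{x. s x \<noteq> \<infinity>}. ennpowr (F x * v x / 2) (enn2real (s x)) \<partial>lebesgue) + 1/2 \<le> (1/2) * 1 + 1/2"
      by (rule add_right_mono)
    then show "(\<integral>\<^sup>+x\<in>{x. s x \<noteq> \<infinity>}. ennpowr (F x * v x / 2) (enn2real (s x)) \<partial>lebesgue) + 1/2 \<le> 1"
      using half by simp
  qed
  obtain u where u: "u \<in> borel_measurable borel" "AE x in lebesgue. F x \<le> u x"
    "\<And>x. maxop u x \<le> ennreal (4 * N) * u x" "unit_ball s (\<lambda>x. u x * v x / 12)"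
    by (rule Rubio_de_Francia[OF s v(1) N bd \<open>F \<in> borel_measurable lebesgue\<close> F_ball]) blast+
  have [measurable]: "u \<in> borel_measurable lebesgue" using u(1) by (simp add: measurable_completion)
  show ?thesis
  proof (rule that[OF u(1) \<phi>(1) _ _ u(3) _ u(4)])
    show "AE x in lebesgue. g x \<le> ennpowr (u x) (1/a) * ennpowr (\<phi> x) (1/b)"
      using u(2) \<phi>(2) \<omega>_pos
    proof eventually_elim
      case (elim x)
      have inv: "ennpowr (inverse (v x)) (1/a) = inverse (\<omega> x)"
        using a by (simp add: v(2) ennpowr_inverse ennpowr_ennpowr)
      have "inverse (\<omega> x) * \<omega> x = 1"
        using ennreal_divide_mult_cancel[of "\<omega> x" 1] elim(3) by (auto simp: divide_ennreal_def)
      then have "g x = g x * (inverse (\<omega> x) * \<omega> x)" by simp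
      also have "\<dots> = (g x * \<omega> x) * inverse (\<omega> x)" by (simp only: mult_ac)
      also have "g x * \<omega> x = ennpowr (\<phi>0 x) (1 / e x)"
        using e(2)[of x] by (simp add: \<phi>0_def ennpowr_ennpowr)
      also have "\<dots> = ennpowr (ennpowr (\<phi>0 x) (\<kappa> x)) (1/a) * ennpowr (\<phi>0 x) (1/b)"
        by (simp add: e(3) \<kappa>_def ennpowr_ennpowr flip: ennpowr_add)
      also have "\<dots> * inverse (\<omega> x) = ennpowr (F x) (1/a) * ennpowr (\<phi>0 x) (1/b)"
        unfolding F_def inv[symmetric] using a by (simp add: ennpowr_mult mult_ac)
      also have "\<dots> \<le> ennpowr (u x) (1/a) * ennpowr (\<phi>0 x) (1/b)"
        using elim(1) a by (intro mult_right_mono ennpowr_mono) auto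
      finally show ?case using elim(2) by simp
    qed
    have "(\<integral>\<^sup>+x. \<phi> x \<partial>lborel) = (\<integral>\<^sup>+x. \<phi>0 x \<partial>lebesgue)"
      unfolding nn_integral_completion using \<phi>(3) by (intro nn_integral_cong_AE) (auto elim: eventually_mono)
    then show "(\<integral>\<^sup>+x. \<phi> x \<partial>lborel) \<le> 1" using \<phi>0_int by simp
    have "AE x in lebesgue. u x * v x / 12 < \<infinity>"
      by (rule unit_ball_finite_AE[OF _ _ u(4)]) measurable
    then have "AE x in lebesgue. u x < \<infinity>"
      using v_pos
    proof eventually_elim
      case (elim x)
      then show ?case by (cases "u x = top"; cases "v x = 0") (auto simp: ennreal_top_mult less_top[symmetric] divide_ennreal_def ennreal_mult_eq_top_iff)
    qed
    then show "AE x in lborel. u x < \<infinity>" using u(1) by (subst (asm) AE_completion_iff) auto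
  qed
qed

section \<open>Riesz potentials\<close>

definition riesz_potential :: "real \<Rightarrow> ('a::euclidean_space \<Rightarrow> ennreal) \<Rightarrow> 'a \<Rightarrow> ennreal" where
  "riesz_potential \<alpha> f x = (\<integral>\<^sup>+y. f y * riesz_kernel \<alpha> x y \<partial>lborel)"

lemma borel_measurable_riesz_kernel [measurable]:
  "(\<lambda>p. riesz_kernel \<alpha> (fst p) (snd p)) \<in> borel_measurable (lborel \<Otimes>\<^sub>M lborel)"
  unfolding riesz_kernel_def by measurable

lemma riesz_potential_cong_AE:
  assumes "AE y in lborel. f y = g y"
  shows "riesz_potential \<alpha> f = riesz_potential \<alpha> g"
  unfolding riesz_potential_def using assms by (intro ext nn_integral_cong_AE) (auto elim: eventually_mono)

lemma riesz_potential_mono_AE: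
  assumes "AE y in lborel. f y \<le> g y"
  shows "riesz_potential \<alpha> f x \<le> riesz_potential \<alpha> g x"
  unfolding riesz_potential_def using assms by (intro nn_integral_mono_AE) (auto elim!: eventually_mono intro: mult_right_mono)

lemma borel_measurable_riesz_potential:
  fixes f :: "'a::euclidean_space \<Rightarrow> ennreal"
  assumes "f \<in> borel_measurable lebesgue"
  shows "riesz_potential \<alpha> f \<in> borel_measurable borel"
proof -
  obtain f' where [measurable]: "f' \<in> borel_measurable borel" and "AE x in lborel. f x = f' x"
    by (rule borel_AE_representative[OF assms])
  then have eq: "riesz_potential \<alpha> f = riesz_potential \<alpha> f'" by (intro riesz_potential_cong_AE)
  have "(\<lambda>p. f' (snd p) * riesz_kernel \<alpha> (fst p) (snd p)) \<in> borel_measurable (lborel \<Otimes>\<^sub>M lborel)"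
    by measurable
  then have "(\<lambda>x. \<integral>\<^sup>+y. f' y * riesz_kernel \<alpha> x y \<partial>lborel) \<in> borel_measurable lborel"
    by (intro lborel.borel_measurable_nn_integral) (simp add: case_prod_beta)
  then show ?thesis unfolding eq by (simp add: riesz_potential_def[abs_def])
qed

lemma riesz_potential_divide:
  fixes f :: "'a::euclidean_space \<Rightarrow> ennreal"
  assumes "f \<in> borel_measurable lebesgue"
  shows "riesz_potential \<alpha> (\<lambda>y. f y / c) x = riesz_potential \<alpha> f x / c"
proof -
  obtain f' where [measurable]: "f' \<in> borel_measurable borel" and ae: "AE x in lborel. f x = f' x"
    by (rule borel_AE_representative[OF assms])
  have "(\<lambda>y. riesz_kernel \<alpha> x y) \<in> borel_measurable lborel" unfolding riesz_kernel_def by measurable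
  then have "riesz_potential \<alpha> (\<lambda>y. f' y / c) x = riesz_potential \<alpha> f' x / c"
    unfolding riesz_potential_def divide_ennreal_def
    by (subst nn_integral_multc[symmetric]) (auto simp: mult_ac)
  moreover have "AE y in lborel. f y / c = f' y / c" using ae by eventually_elim simp
  ultimately show ?thesis
    using riesz_potential_cong_AE[OF ae] riesz_potential_cong_AE[of "\<lambda>y. f y / c" "\<lambda>y. f' y / c"] by simp
qed

lemma ennreal_norm_fractional_kernel:
  "ennreal (norm (fractional_kernel \<alpha> f x y)) = ennreal \<bar>f y\<bar> * riesz_kernel \<alpha> x y"
  by (simp add: fractional_kernel_def riesz_kernel_def abs_divide flip: ennreal_mult)

lemma abs_fractional_integral_le_riesz_potential:
  "ennreal \<bar>fractional_integral \<alpha> f x\<bar> \<le> riesz_potential \<alpha> (\<lambda>y. ennreal \<bar>f y\<bar>) x"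
proof (cases "integrable lebesgue (fractional_kernel \<alpha> f x)")
  case True
  have "ennreal \<bar>fractional_integral \<alpha> f x\<bar> \<le> (\<integral>\<^sup>+y. ennreal (norm (fractional_kernel \<alpha> f x y)) \<partial>lebesgue)"
    unfolding fractional_integral_def using integral_norm_bound_ennreal[OF True] by simp
  then show ?thesis
    by (simp only: ennreal_norm_fractional_kernel riesz_potential_def nn_integral_completion)
next
  case False
  then show ?thesis by (simp add: fractional_integral_def not_integrable_integral_eq)
qed

lemma integrable_fractional_kernel:
  fixes f :: "'a::euclidean_space \<Rightarrow> real"
  assumes [measurable]: "f \<in> borel_measurable lebesgue" and fin: "riesz_potential \<alpha> (\<lambda>y. ennreal \<bar>f y\<bar>) x < \<infinity>"
  shows "integrable lebesgue (fractional_kernel \<alpha> f x)"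
proof (rule integrableI_bounded)
  have "(\<lambda>y. norm (x - y) powr (real DIM('a) - \<alpha>)) \<in> borel_measurable borel" by measurable
  then have [measurable]: "(\<lambda>y. norm (x - y) powr (real DIM('a) - \<alpha>)) \<in> borel_measurable lebesgue"
    by (simp add: measurable_completion)
  show "fractional_kernel \<alpha> f x \<in> borel_measurable lebesgue"
    unfolding fractional_kernel_def[abs_def] by measurable
  show "(\<integral>\<^sup>+y. ennreal (norm (fractional_kernel \<alpha> f x y)) \<partial>lebesgue) < \<infinity>"
    using fin by (simp only: ennreal_norm_fractional_kernel riesz_potential_def nn_integral_completion)
qed

section \<open>Norms for exponents that are finite almost everywhere\<close>

text \<open>The essential supremum in the norm is then taken over a null set. All functions are measurable there
  because Lebesgue measure is complete, so \<open>g\<close> may be arbitrary.\<close>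

lemma vnorm_le_of_AE_finite:
  fixes q g :: "'a::euclidean_space \<Rightarrow> ennreal"
  assumes q: "q \<in> borel_measurable lebesgue" "AE x in lebesgue. q x \<noteq> \<infinity>" and l: "0 < l"
    and int: "(\<integral>\<^sup>+x. ennpowr (g x / ennreal l) (enn2real (q x)) \<partial>lebesgue) \<le> 1"
  shows "vnorm q g \<le> ennreal l"
proof -
  let ?Z = "{x. q x = \<infinity>}" and ?R = "restrict_space lebesgue {x. q x = \<infinity>}"
  have Z: "?Z \<in> null_sets lebesgue"
    using q(2) sets_exponent_finite(2)[OF q(1)] by (subst AE_iff_null_sets) auto
  have "g \<in> borel_measurable ?R"
  proof (rule measurableI)
    fix B assume "B \<in> sets (borel :: ennreal measure)"
    have "g -` B \<inter> space ?R \<subseteq> ?Z" by (auto simp: space_restrict_space)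
    then have "g -` B \<inter> space ?R \<in> sets lebesgue"
      using Z by (meson null_sets_completion_subset null_setsD2)
    then show "g -` B \<inter> space ?R \<in> sets ?R"
      using Z by (auto simp: sets_restrict_space_iff space_restrict_space)
  qed auto
  moreover have "AE x in ?R. g x \<le> 0"
    using Z by (subst AE_restrict_space_iff) (auto intro: AE_not_in[THEN eventually_mono])
  ultimately have "esssup ?R g \<le> 0" by (intro esssup_I)
  then have "esssup ?R g = 0" by simp
  moreover have "(\<integral>\<^sup>+x\<in>{x. q x \<noteq> \<infinity>}. ennpowr (g x / ennreal l) (enn2real (q x)) \<partial>lebesgue) \<le> 1"
    by (rule order_trans[OF nn_integral_mono int]) (auto simp: indicator_def)
  ultimately show ?thesis
    unfolding vnorm_def using l by (intro Inf_lower) auto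
qed

lemma ennreal_le_mult_of_forall_greater:
  assumes K: "0 \<le> K" and a: "a < \<infinity>" and le: "\<And>l. a < ennreal l \<Longrightarrow> 0 < l \<Longrightarrow> X \<le> ennreal (K * l)"
  shows "X \<le> ennreal K * a"
proof -
  obtain r where r: "a = ennreal r" "0 \<le> r" using a by (cases a) auto
  have step: "X \<le> ennreal (K * (r + d))" if "0 < d" for d
    using that r by (intro le) (auto simp: ennreal_lessI)
  from step[OF zero_less_one] obtain x where x: "X = ennreal x" "0 \<le> x"
    by (cases X) (auto simp: top_unique)
  have "x \<le> K * r"
  proof (rule field_le_epsilon)
    fix d :: real assume d: "0 < d"
    have "X \<le> ennreal (K * (r + d / (K + 1)))" using K d by (intro step) auto
    then have "x \<le> K * (r + d / (K + 1))" using x K r d by (simp add: ennreal_le_iff)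
    also have "\<dots> = K * r + (K / (K + 1)) * d" by (simp add: distrib_left)
    also have "\<dots> \<le> K * r + 1 * d" using K d by (intro add_left_mono mult_right_mono) auto
    finally show "x \<le> K * r + d" by simp
  qed
  then show ?thesis using x r K by (simp add: ennreal_leI flip: ennreal_mult)
qed

section \<open>Strong bounds by duality\<close>

text \<open>If the modular of \<open>J w / K\<close> exceeded \<open>1\<close>, so would that of a bounded truncation \<open>T\<close> of it with bounded
  support, and its modular \<open>m\<close> is finite. Testing the dual estimate with
  \<open>T\<^sup>e\<^sup>-\<^sup>1 w / m\<close> then gives \<open>K \<le> C\<close>. This function is admissible
  because \<open>m > 1\<close> and \<open>e' \<ge> 1\<close>.\<close>

lemma modular_le_1_of_dual_bound:
  fixes J w :: "'a::euclidean_space \<Rightarrow> ennreal" and e e' :: "'a \<Rightarrow> real" and C K :: real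
  assumes J [measurable]: "J \<in> borel_measurable lebesgue" and w: "weight w"
    and e [measurable]: "e \<in> borel_measurable lebesgue" and ee': "AE x in lebesgue. 1 < e x \<and> e' x = e x / (e x - 1)"
    and dual: "\<And>g. g \<in> borel_measurable lebesgue \<Longrightarrow>
      (\<integral>\<^sup>+x. ennpowr (g x * inverse (w x)) (e' x) \<partial>lebesgue) \<le> 1 \<Longrightarrow> (\<integral>\<^sup>+x. g x * J x \<partial>lebesgue) \<le> ennreal C"
    and K: "0 \<le> C" "C < K"
  shows "(\<integral>\<^sup>+x. ennpowr (J x * w x / ennreal K) (e x) \<partial>lebesgue) \<le> 1"
proof (rule ccontr)
  from w have w_meas [measurable]: "w \<in> borel_measurable lebesgue"
    and w_pos: "AE x in lebesgue. 0 < w x \<and> w x < \<infinity>" by (simp_all add: weight_def)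
  define A where "A x = J x * w x / ennreal K" for x
  \<comment> \<open>Truncating the exponent as well keeps the modular finite when \<open>e\<close> is unbounded.\<close>
  have [measurable]: "A \<in> borel_measurable lebesgue" unfolding A_def by measurable
  define T where "T k x = (if norm x < real k \<and> e x \<le> real k then min (A x) (of_nat k) else 0)" for k x
  have [measurable]: "(\<lambda>x. norm x) \<in> borel_measurable (lebesgue :: 'a measure)"
    by (intro measurable_completion) simp
  have T_meas [measurable]: "T k \<in> borel_measurable lebesgue" for k unfolding T_def by measurable
  assume "\<not> (\<integral>\<^sup>+x. ennpowr (J x * w x / ennreal K) (e x) \<partial>lebesgue) \<le> 1"
  then have "1 < (\<integral>\<^sup>+x. ennpowr (A x) (e x) \<partial>lebesgue)" by (simp add: A_def)
  also have "\<dots> \<le> (\<integral>\<^sup>+x. (SUP k. ennpowr (T k x) (e x)) \<partial>lebesgue)"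
  proof (rule nn_integral_mono_AE)
    show "AE x in lebesgue. ennpowr (A x) (e x) \<le> (SUP k. ennpowr (T k x) (e x))"
      using ee'
    proof eventually_elim
      case (elim x)
      obtain k0 :: nat where k0: "norm x < real k0" "e x \<le> real k0"
      proof -
        obtain k0 :: nat where "max (norm x) (e x) < real k0" using reals_Archimedean2 by blast
        then show ?thesis by (intro that[of k0]) auto
      qed
      show ?case
      proof (cases "A x")
        case (real r)
        obtain k1 :: nat where "r \<le> real k1" using real_arch_simple by blast
        then have "A x \<le> of_nat (max k0 k1)"
          using real by (simp add: ennreal_of_nat_eq_real_of_nat ennreal_leI)
        then have "T (max k0 k1) x = A x" using k0 by (auto simp: T_def min_absorb1)
        then show ?thesis by (metis SUP_upper UNIV_I)
      next
        case top
        have "of_nat m \<le> (SUP k. ennpowr (T k x) (e x))" for m :: nat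
        proof -
          define k where "k = max k0 (max m 1)"
          have "(of_nat m :: ennreal) \<le> of_nat k" by (simp add: k_def)
          also have "\<dots> \<le> ennpowr (of_nat k) (e x)"
          proof -
            have "1 \<le> real k" unfolding k_def by simp
            then have "real k powr 1 \<le> real k powr e x" using elim by (intro powr_mono) auto
            then show ?thesis using \<open>1 \<le> real k\<close> by (simp add: ennreal_of_nat_eq_real_of_nat ennpowr_ennreal ennreal_leI)
          qed
          also have "of_nat k = T k x" using k0 top by (auto simp: T_def k_def)
          also have "ennpowr (T k x) (e x) \<le> (SUP k. ennpowr (T k x) (e x))" by (intro SUP_upper) simp
          finally show ?thesis .
        qed
        then have "(SUP m. of_nat m) \<le> (SUP k. ennpowr (T k x) (e x))" by (intro SUP_least)
        then have "top \<le> (SUP k. ennpowr (T k x) (e x))" unfolding ennreal_SUP_of_nat_eq_top .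
        then show ?thesis by (rule order_trans[OF top_greatest])
      qed
    qed
  qed
  also have "\<dots> = (SUP k. \<integral>\<^sup>+x. ennpowr (T k x) (e x) \<partial>lebesgue)"
  proof (rule nn_integral_monotone_convergence_SUP_AE)
    fix k
    show "AE x in lebesgue. ennpowr (T k x) (e x) \<le> ennpowr (T (Suc k) x) (e x)"
      using ee'
    proof eventually_elim
      case (elim x)
      have "min (A x) (of_nat k) \<le> min (A x) (of_nat (Suc k))" by (intro min.mono) (auto simp: add_increasing)
      then show ?case using elim by (intro ennpowr_mono) (auto simp: T_def)
    qed
  qed measurable
  finally obtain k where k: "1 < (\<integral>\<^sup>+x. ennpowr (T k x) (e x) \<partial>lebesgue)"
    by (auto simp: less_SUP_iff)
  define m where "m = (\<integral>\<^sup>+x. ennpowr (T k x) (e x) \<partial>lebesgue)"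
  have m1: "1 < m" using k by (simp add: m_def)
  have "m \<le> (\<integral>\<^sup>+x. ennreal ((real k + 1) powr real k) * indicator (ball (0 :: 'a) (real k)) x \<partial>lebesgue)"
    unfolding m_def
  proof (rule nn_integral_mono_AE)
    show "AE x in lebesgue. ennpowr (T k x) (e x) \<le> ennreal ((real k + 1) powr real k) * indicator (ball (0 :: 'a) (real k)) x"
      using ee'
    proof eventually_elim
      case (elim x)
      show ?case
      proof (cases "norm x < real k \<and> e x \<le> real k")
        case True
        have "ennpowr (T k x) (e x) \<le> ennpowr (ennreal (real k + 1)) (e x)"
          using True elim by (intro ennpowr_mono) (auto simp: T_def ennreal_of_nat_eq_real_of_nat intro!: min.coboundedI2 ennreal_leI)
        also have "\<dots> = ennreal ((real k + 1) powr e x)" by (rule ennpowr_ennreal) simp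
        also have "\<dots> \<le> ennreal ((real k + 1) powr real k)" using True by (intro ennreal_leI powr_mono) auto
        finally show ?thesis using True by simp
      qed (auto simp: T_def)
    qed
  qed
  also have "\<dots> = ennreal ((real k + 1) powr real k) * emeasure lebesgue (ball (0 :: 'a) (real k))"
    by (rule nn_integral_cmult_indicator) simp
  also have "\<dots> < top"
    using emeasure_lborel_ball_finite[of "0 :: 'a" "real k"] by (simp add: ennreal_mult_less_top)
  finally have m_fin: "m \<noteq> top" by simp
  have m0: "m \<noteq> 0" using m1 by auto
  have mm: "inverse m * m = 1" using ennreal_divide_mult_cancel[OF m0 m_fin, of 1] by (simp add: divide_ennreal_def)
  have inv_m: "inverse m \<le> 1"
  proof -
    have "inverse m * 1 \<le> inverse m * m" using m1 by (intro mult_left_mono) auto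
    then show ?thesis using mm by simp
  qed
  define g where "g x = inverse m * (ennpowr (T k x) (e x - 1) * w x)" for x
  have g_meas [measurable]: "g \<in> borel_measurable lebesgue" unfolding g_def by measurable
  have "(\<integral>\<^sup>+x. ennpowr (g x * inverse (w x)) (e' x) \<partial>lebesgue) \<le> (\<integral>\<^sup>+x. inverse m * ennpowr (T k x) (e x) \<partial>lebesgue)"
  proof (rule nn_integral_mono_AE)
    show "AE x in lebesgue. ennpowr (g x * inverse (w x)) (e' x) \<le> inverse m * ennpowr (T k x) (e x)"
      using ee' w_pos
    proof eventually_elim
      case (elim x)
      have "w x / w x = 1" using elim by (intro ennreal_divide_self) auto
      then have "g x * inverse (w x) = inverse m * ennpowr (T k x) (e x - 1)"
        by (simp add: g_def mult.assoc divide_ennreal_def)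
      moreover have "ennpowr (inverse m * ennpowr (T k x) (e x - 1)) (e' x) \<le> inverse m * ennpowr (ennpowr (T k x) (e x - 1)) (e' x)"
        using elim inv_m by (intro ennpowr_cmult_le) auto
      moreover have "(e x - 1) * e' x = e x" using elim by simp
      ultimately show ?case by (simp add: ennpowr_ennpowr)
    qed
  qed
  also have "\<dots> = inverse m * m" unfolding m_def by (intro nn_integral_cmult) measurable
  finally have "(\<integral>\<^sup>+x. g x * J x \<partial>lebesgue) \<le> ennreal C" using mm by (intro dual g_meas) simp
  have KK: "inverse (ennreal K) * ennreal K = 1"
    using K by (simp add: inverse_ennreal flip: ennreal_mult)
  have "1 = inverse m * m" using mm ..
  also have "\<dots> = (\<integral>\<^sup>+x. inverse m * ennpowr (T k x) (e x) \<partial>lebesgue)"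
    unfolding m_def by (intro nn_integral_cmult[symmetric]) measurable
  also have "\<dots> \<le> (\<integral>\<^sup>+x. inverse (ennreal K) * (g x * J x) \<partial>lebesgue)"
  proof (rule nn_integral_mono)
    fix x
    have "ennpowr (T k x) (e x) = ennpowr (T k x) (e x - 1) * T k x"
      using ennpowr_add[of "T k x" "e x - 1" 1] by simp
    also have "\<dots> \<le> ennpowr (T k x) (e x - 1) * A x" by (intro mult_left_mono) (auto simp: T_def)
    finally have "inverse m * ennpowr (T k x) (e x) \<le> inverse m * (ennpowr (T k x) (e x - 1) * A x)"
      by (intro mult_left_mono) auto
    also have "\<dots> = inverse (ennreal K) * (g x * J x)"
      unfolding A_def g_def divide_ennreal_def by (simp only: mult_ac)
    finally show "inverse m * ennpowr (T k x) (e x) \<le> inverse (ennreal K) * (g x * J x)" .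
  qed
  also have "\<dots> = inverse (ennreal K) * (\<integral>\<^sup>+x. g x * J x \<partial>lebesgue)" by (intro nn_integral_cmult) measurable
  also have "\<dots> \<le> inverse (ennreal K) * ennreal C" by (intro mult_left_mono) (fact, simp)
  also have "\<dots> = ennreal (C / K)" using K by (simp add: inverse_ennreal divide_inverse mult.commute flip: ennreal_mult)
  finally have "1 \<le> C / K" using K by (simp flip: ennreal_1)
  then show False using K by (simp add: field_simps)
qed

text \<open>The exponent of \<open>|B|\<close> in the fractional mean is \<open>\<alpha>/n - 1 = -1/a\<close>, which is what Hoelder's inequality
  needs to turn \<open>\<integral>\<^sub>B u\<close> into the mean of \<open>u\<close> under the power \<open>1/a\<close>.\<close>

lemma fractional_maximal_le_maxop:
  fixes f :: "'a::euclidean_space \<Rightarrow> real" and a b \<alpha> :: real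
  assumes [measurable]: "u \<in> borel_measurable borel" "\<phi> \<in> borel_measurable borel"
    and a: "1 < a" "1 / a + 1 / b = 1" "1 / b = \<alpha> / real DIM('a)" and \<phi>: "(\<integral>\<^sup>+x. \<phi> x \<partial>lborel) \<le> 1"
    and f: "AE x in lborel. ennreal \<bar>f x\<bar> \<le> l * (ennpowr (u x) (1/a) * ennpowr (\<phi> x) (1/b))"
  shows "fractional_maximal \<alpha> f x \<le> l * ennpowr (maxop u x) (1/a)"
  unfolding fractional_maximal_def
proof (rule SUP_least, clarsimp simp: nn_integral_completion)
  fix c and r :: real assume r: "0 < r" "dist c x < r"
  let ?I = "\<lambda>g. \<integral>\<^sup>+y\<in>ball c r. g y \<partial>lborel"
  obtain V where V: "emeasure lborel (ball c r) = ennreal V" "0 < V"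
    using emeasure_ball_pos[OF r(1), of c] emeasure_lborel_ball_finite[of c r]
    by (cases "emeasure lborel (ball c r)") auto
  have "?I (\<lambda>y. ennreal \<bar>f y\<bar>) \<le> (\<integral>\<^sup>+y. l * (ennpowr (u y * indicator (ball c r) y) (1/a) * ennpowr (\<phi> y) (1/b)) \<partial>lborel)"
    using f by (intro nn_integral_mono_AE) (auto elim!: eventually_mono simp: indicator_def)
  also have "\<dots> = l * (\<integral>\<^sup>+y. ennpowr (u y * indicator (ball c r) y) (1/a) * ennpowr (\<phi> y) (1/b) \<partial>lborel)"
    by (intro nn_integral_cmult) measurable
  also have "\<dots> \<le> l * ennpowr (?I u) (1/a)"
  proof (rule mult_left_mono)
    show "(\<integral>\<^sup>+y. ennpowr (u y * indicator (ball c r) y) (1/a) * ennpowr (\<phi> y) (1/b) \<partial>lborel) \<le> ennpowr (?I u) (1/a)"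
      by (intro nn_integral_Hoelder_le a \<phi>) measurable
  qed simp
  finally have I: "?I (\<lambda>y. ennreal \<bar>f y\<bar>) \<le> l * ennpowr (?I u) (1/a)" .
  have vol: "ennpowr (ennreal V) (\<alpha> / real DIM('a)) * inverse (ennreal V) = ennpowr (inverse (ennreal V)) (1/a)"
  proof -
    have "V powr (\<alpha> / real DIM('a)) * inverse V = V powr (\<alpha> / real DIM('a) - 1)"
      using V(2) by (simp add: powr_diff divide_inverse)
    also have "\<alpha> / real DIM('a) - 1 = - (1/a)" using a(2,3) by simp
    also have "V powr - (1/a) = inverse V powr (1/a)" using V(2) by (simp add: powr_minus inverse_powr)
    finally show ?thesis using V(2) by (simp add: inverse_ennreal ennpowr_ennreal flip: ennreal_mult)
  qed
  have "ennpowr (ennreal V) (\<alpha> / real DIM('a)) * (?I (\<lambda>y. ennreal \<bar>f y\<bar>) / ennreal V)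
    \<le> ennpowr (ennreal V) (\<alpha> / real DIM('a)) * (l * ennpowr (?I u) (1/a) / ennreal V)"
    by (intro mult_left_mono divide_right_mono_ennreal I) simp
  also have "\<dots> = l * (ennpowr (?I u) (1/a) * ennpowr (inverse (ennreal V)) (1/a))"
    unfolding vol[symmetric] divide_ennreal_def by (simp only: mult_ac)
  also have "\<dots> = l * ennpowr (?I u / ennreal V) (1/a)"
    using a(1) by (simp add: divide_ennreal_def ennpowr_mult)
  also have "\<dots> \<le> l * ennpowr (maxop u x) (1/a)"
    using a(1) r V(1) unfolding maxop_def
    by (intro mult_left_mono ennpowr_mono SUP_upper2[of "(c, r)"]) auto
  finally show "ennpowr (emeasure lborel (ball c r)) (\<alpha> / real DIM('a)) * (?I (\<lambda>y. ennreal \<bar>f y\<bar>) / emeasure lborel (ball c r))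
    \<le> l * ennpowr (maxop u x) (1/a)" unfolding V(1) .
qed

section \<open>The fractional operators on weighted variable Lebesgue spaces\<close>

lemma enn2real_inverse_divide:
  assumes "0 < S"
  shows "enn2real (inverse (x / ennreal S)) = S * enn2real (inverse x)"
proof -
  consider "x = 0" | "x = top" | y where "x = ennreal y" "0 < y" by (cases x) (auto simp: less_le)
  then show ?thesis
  proof cases
    case 2
    then show ?thesis using assms by (simp add: ennreal_top_divide)
  next
    case 3
    then show ?thesis using assms by (simp add: divide_ennreal inverse_ennreal divide_inverse)
  qed (use assms in \<open>auto simp: divide_ennreal_def\<close>)
qed

lemma enn2real_inverse_conj_exponent:
  assumes "1 \<le> s"
  shows "enn2real (inverse (conj_exponent s)) = 1 - enn2real (inverse s)"
  using assms
proof (cases rule: ge_1_cases)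
  case (3 r)
  then show ?thesis by (simp add: conj_exponent_ennreal inverse_ennreal field_simps)
qed (simp_all add: conj_exponent_simps)

lemma conj_exponent_in_exponents:
  assumes "s \<in> exponents"
  shows "(\<lambda>x. conj_exponent (s x)) \<in> exponents"
proof -
  note [measurable] = exponents_measurable[OF assms]
  have "1 \<le> conj_exponent (s x)" for x
    using exponents_ge_1[OF assms, of x]
  proof (cases rule: ge_1_cases)
    case (3 r)
    then have "1 \<le> r / (r - 1)" by (simp add: field_simps)
    then show ?thesis using 3 by (simp add: conj_exponent_ennreal)
  qed (simp_all add: conj_exponent_simps)
  then show ?thesis unfolding exponents_def by simp
qed

lemma weight_inverse:
  assumes "weight w"
  shows "weight (\<lambda>x. inverse (w x))"
proof -
  have [measurable]: "w \<in> borel_measurable lebesgue" using assms by (simp add: weight_def)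
  have "AE x in lebesgue. 0 < inverse (w x) \<and> inverse (w x) < \<infinity>"
    using assms[unfolded weight_def, THEN conjunct2]
    by eventually_elim (auto simp: less_top[symmetric] zero_less_iff_neq_zero)
  then show ?thesis by (simp add: weight_def)
qed

lemma weight_ennpowr:
  assumes "weight w"
  shows "weight (\<lambda>x. ennpowr (w x) a)"
proof -
  have [measurable]: "w \<in> borel_measurable lebesgue" using assms by (simp add: weight_def)
  have "AE x in lebesgue. 0 < ennpowr (w x) a \<and> ennpowr (w x) a < \<infinity>"
    using assms[unfolded weight_def, THEN conjunct2]
    by eventually_elim (auto simp: less_top[symmetric] zero_less_iff_neq_zero)
  then show ?thesis by (simp add: weight_def)
qed

theorem corollary3p7:
  fixes \<alpha> :: real and p q w :: "'a::euclidean_space \<Rightarrow> ennreal" and \<sigma> :: ennreal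
  assumes "0 < \<alpha>" and "\<alpha> < real DIM('a)"
    and "p \<in> exponents" and "q \<in> exponents"
    and "esssup lebesgue p < ennreal (real DIM('a) / \<alpha>)"
    and "\<And>x. inverse (p x) - inverse (q x) = ennreal (\<alpha> / real DIM('a))"
    and "\<sigma> = conj_exponent (ennreal (real DIM('a) / \<alpha>))"
    and "weight w"
    and "M_pair (\<lambda>x. q x / \<sigma>) (\<lambda>x. ennpowr (w x) (enn2real \<sigma>))"
  shows "\<exists>C::real. \<forall>f \<in> Lspace p w.
           (AE x in lebesgue. integrable lebesgue (fractional_kernel \<alpha> f x)) \<and>
           wnorm q w (\<lambda>x. ennreal \<bar>fractional_integral \<alpha> f x\<bar>)
             \<le> ennreal C * wnorm p w (\<lambda>x. ennreal \<bar>f x\<bar>) \<and>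
           wnorm q w (fractional_maximal \<alpha> f)
             \<le> ennreal C * wnorm p w (\<lambda>x. ennreal \<bar>f x\<bar>)"
proof -
  let ?n = "real DIM('a)"
  define b where "b = ?n / \<alpha>"
  define S where "S = b / (b - 1)"
  note \<alpha> = assms(1,2)
  have b: "1 < b" "1 / b = \<alpha> / ?n" using \<alpha> by (simp_all add: b_def)
  have S: "1 < S" "1 / S = 1 - \<alpha> / ?n"
  proof -
    show "1 < S" using b by (simp add: S_def field_simps)
    have "1 / S = 1 - 1 / b" using b(1) by (simp add: S_def diff_divide_distrib)
    then show "1 / S = 1 - \<alpha> / ?n" using b(2) by simp
  qed
  then have S0: "0 < S" by simp
  have Sb: "1 / S + 1 / b = 1" using S b by simp
  have \<sigma>: "\<sigma> = ennreal S" "enn2real \<sigma> = S"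
    using S(1) conj_exponent_ennreal[OF b(1)] assms(7) by (simp_all add: b_def S_def)
  note [measurable] = exponents_measurable[OF assms(3)] exponents_measurable[OF assms(4)]
  have [measurable]: "w \<in> borel_measurable lebesgue" using assms(8) by (simp add: weight_def)
  define r where "r x = q x / ennreal S" for x
  define v where "v x = ennpowr (w x) S" for x
  have Mp: "M_pair r v" using assms(9) unfolding \<sigma>(2) by (simp add: r_def[abs_def] v_def[abs_def] \<sigma>(1))
  then have r: "r \<in> exponents" and bd1: "maximal_bounded r v"
    and bd2: "maximal_bounded (\<lambda>x. conj_exponent (r x)) (\<lambda>x. inverse (v x))"
    by (simp_all add: M_pair_def)
  have r': "(\<lambda>x. conj_exponent (r x)) \<in> exponents" by (rule conj_exponent_in_exponents[OF r])
  have v: "weight v" unfolding v_def[abs_def] by (rule weight_ennpowr[OF assms(8)])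
  have v': "weight (\<lambda>x. inverse (v x))" by (rule weight_inverse[OF v])
  have w': "weight (\<lambda>x. inverse (w x))" by (rule weight_inverse[OF assms(8)])
  have [measurable]: "v \<in> borel_measurable lebesgue" using v by (simp add: weight_def)
  obtain N1 where N1: "1 \<le> N1"
    "\<And>g. g \<in> borel_measurable lebesgue \<Longrightarrow> wnorm r v g < \<infinity> \<Longrightarrow> wnorm r v (maxop g) \<le> ennreal N1 * wnorm r v g"
    using maximal_bounded_imp_maxop_bounded[OF bd1 exponents_measurable[OF r] v] by blast
  obtain N2 where N2: "1 \<le> N2"
    "\<And>g. g \<in> borel_measurable lebesgue \<Longrightarrow> wnorm (\<lambda>x. conj_exponent (r x)) (\<lambda>x. inverse (v x)) g < \<infinity> \<Longrightarrow>
      wnorm (\<lambda>x. conj_exponent (r x)) (\<lambda>x. inverse (v x)) (maxop g) \<le> ennreal N2 * wnorm (\<lambda>x. conj_exponent (r x)) (\<lambda>x. inverse (v x)) g"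
    using maximal_bounded_imp_maxop_bounded[OF bd2 exponents_measurable[OF r'] v'] by blast

  \<comment> \<open>The exponents enter through their reciprocals: \<open>1/q\<close> is real everywhere, and
    \<open>1/p = 1/q + 1/b\<close>, \<open>1/r = S/q\<close>, \<open>1/r' = 1 - S/q\<close>, while \<open>e' = q'\<close> has \<open>1/e' = 1/(S r') + 1/b\<close>.\<close>
  define iq where "iq x = enn2real (inverse (q x))" for x
  define e where "e x = enn2real (p x)" for x
  define e' where "e' x = 1 / (1 - iq x)" for x
  have r_iq: "enn2real (inverse (r x)) = S * iq x" for x
    using S(1) by (simp add: r_def iq_def enn2real_inverse_divide)
  have iq: "0 \<le> iq x" "S * iq x \<le> 1" "iq x < 1" for x
  proof -
    show 0: "0 \<le> iq x" by (simp add: iq_def)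
    have "enn2real (inverse (r x)) \<le> 1"
      using exponents_ge_1[OF r, of x]
      by (cases rule: ge_1_cases) (simp_all add: inverse_ennreal inverse_le_1_iff)
    then show *: "S * iq x \<le> 1" by (simp add: r_iq)
    show "iq x < 1"
    proof (rule ccontr)
      assume "\<not> iq x < 1"
      then have "1 * 1 < S * iq x" using S(1) by (intro mult_less_le_imp_less) auto
      with * show False by simp
    qed
  qed
  have p_e: "p x = ennreal (e x)" "1 \<le> e x" "1 / e x = iq x + \<alpha> / ?n" for x
  proof -
    have pq: "inverse (p x) - inverse (q x) = ennreal (\<alpha> / ?n)" by (rule assms(6))
    have pos: "0 < \<alpha> / ?n" using \<alpha> by (intro divide_pos_pos) auto
    have fin: "p x \<noteq> top"
    proof
      assume "p x = top"
      then have "ennreal (\<alpha> / ?n) = 0" using pq by simp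
      then have "\<alpha> / ?n \<le> 0" by (simp only: ennreal_eq_0_iff)
      with pos show False by linarith
    qed
    then show p: "p x = ennreal (e x)" by (simp add: e_def less_top)
    show e1: "1 \<le> e x" using exponents_ge_1[OF assms(3), of x] unfolding p
      by (metis ennreal_1 ennreal_le_iff e_def enn2real_nonneg)
    have "inverse (q x) \<noteq> top" using exponents_ge_1[OF assms(4), of x] by auto
    then have "inverse (q x) = ennreal (iq x)" unfolding iq_def by (intro ennreal_enn2real[symmetric]) (simp only: less_top)
    then have eq: "ennreal (1 / e x - iq x) = ennreal (\<alpha> / ?n)"
      using pq e1 iq(1)[of x] unfolding p by (simp add: inverse_ennreal ennreal_minus divide_inverse)
    have "0 \<le> 1 / e x - iq x"
    proof (rule ccontr)
      assume "\<not> 0 \<le> 1 / e x - iq x"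
      then have "ennreal (1 / e x - iq x) = 0" by (simp only: ennreal_eq_0_iff)
      then have "\<alpha> / ?n \<le> 0" unfolding eq by (simp only: ennreal_eq_0_iff)
      with pos show False by linarith
    qed
    with eq pos have "1 / e x - iq x = \<alpha> / ?n" by (simp only: ennreal_inj less_imp_le)
    then show "1 / e x = iq x + \<alpha> / ?n" by simp
  qed
  \<comment> \<open>\<open>q x = \<infinity>\<close> would mean \<open>p x = n/\<alpha>\<close>.\<close>
  have q_fin: "AE x in lebesgue. q x \<noteq> \<infinity>"
    using esssup_AE[where M = lebesgue and f = p]
  proof eventually_elim
    case (elim x)
    then have "ennreal (e x) < ennreal b" using assms(5) p_e(1)[of x] by (simp add: b_def)
    then have "e x < b" using b by (simp add: ennreal_less_iff p_e order_trans[OF zero_le_one])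
    then have "1 / b < 1 / e x" using p_e(2)[of x] b by (intro divide_strict_left_mono) auto
    then have "0 < iq x" using p_e(3)[of x] b by simp
    then show ?case by (auto simp: iq_def)
  qed
  define eq where "eq x = enn2real (q x)" for x
  have q_eq: "AE x in lebesgue. r x \<noteq> \<infinity> \<and> enn2real (r x) = eq x / S \<and> 1 < eq x \<and> e' x = eq x / (eq x - 1)"
    using q_fin
  proof eventually_elim
    case (elim x)
    then have q: "q x = ennreal (eq x)" by (simp add: eq_def less_top)
    have "0 \<le> eq x" by (simp add: eq_def)
    have rx: "r x = ennreal (eq x / S)"
      using S(1) \<open>0 \<le> eq x\<close> by (simp add: r_def q divide_ennreal)
    then have "1 \<le> eq x / S"
      using exponents_ge_1[OF r, of x] S(1) \<open>0 \<le> eq x\<close> by simp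
    then have eq1: "1 < eq x" using S(1) by (simp add: field_simps)
    then have "iq x = 1 / eq x" by (simp add: iq_def q inverse_ennreal divide_inverse)
    then have "1 - iq x = (eq x - 1) / eq x" using eq1 by (simp add: diff_divide_distrib)
    then have "e' x = eq x / (eq x - 1)" by (simp add: e'_def)
    then show ?case using rx eq1 S(1) by simp
  qed
  have e_meas [measurable]: "e \<in> borel_measurable lebesgue" "e' \<in> borel_measurable lebesgue" "eq \<in> borel_measurable lebesgue"
    unfolding e_def[abs_def] e'_def[abs_def] iq_def eq_def[abs_def] by measurable
  define N where "N = max N1 N2"
  have N: "1 \<le> N" using N1(1) by (simp add: N_def)
  have bdN1: "wnorm r v (maxop g) \<le> ennreal N * wnorm r v g"
    if "g \<in> borel_measurable lebesgue" "wnorm r v g < \<infinity>" for g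
    using N1(2)[OF that] by (rule order_trans) (auto simp: N_def intro!: mult_right_mono ennreal_leI)
  have bdN2: "wnorm (\<lambda>x. conj_exponent (r x)) (\<lambda>x. inverse (v x)) (maxop g) \<le> ennreal N * wnorm (\<lambda>x. conj_exponent (r x)) (\<lambda>x. inverse (v x)) g"
    if "g \<in> borel_measurable lebesgue" "wnorm (\<lambda>x. conj_exponent (r x)) (\<lambda>x. inverse (v x)) g < \<infinity>" for g
    using N2(2)[OF that] by (rule order_trans) (auto simp: N_def intro!: mult_right_mono ennreal_leI)
  define A where "A = 4 * N"
  have A: "0 \<le> A" "0 < A" using N by (simp_all add: A_def)

  have factor_f: "\<exists>u \<phi>. u \<in> borel_measurable borel \<and> \<phi> \<in> borel_measurable borel \<and>
      (AE x in lebesgue. h x \<le> ennpowr (u x) (1/S) * ennpowr (\<phi> x) (1/b)) \<and>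
      (\<integral>\<^sup>+x. \<phi> x \<partial>lborel) \<le> 1 \<and> (\<forall>x. maxop u x \<le> ennreal A * u x) \<and> (AE x in lborel. u x < \<infinity>) \<and>
      unit_ball r (\<lambda>x. u x * v x / 12)"
    if h: "h \<in> borel_measurable lebesgue" "(\<integral>\<^sup>+x. ennpowr (h x * w x) (e x) \<partial>lebesgue) \<le> 1" for h
  proof -
    have e_pos: "0 < e x" for x using p_e(2)[of x] by linarith
    have e_rel: "1 / e x = enn2real (inverse (r x)) / S + 1 / b" for x
      using p_e(3)[of x] S(1) b(2) by (simp add: r_iq)
    show ?thesis unfolding A_def
      by (rule factor_through_A1_weight[OF r assms(8) v v_def N bdN1 S0 e_meas(1) e_pos e_rel h]) blast+
  qed
  have factor_g: "\<exists>u \<phi>. u \<in> borel_measurable borel \<and> \<phi> \<in> borel_measurable borel \<and>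
      (AE x in lebesgue. h x \<le> ennpowr (u x) (1/S) * ennpowr (\<phi> x) (1/b)) \<and>
      (\<integral>\<^sup>+x. \<phi> x \<partial>lborel) \<le> 1 \<and> (\<forall>x. maxop u x \<le> ennreal A * u x) \<and> (AE x in lborel. u x < \<infinity>) \<and>
      unit_ball (\<lambda>x. conj_exponent (r x)) (\<lambda>x. u x * inverse (v x) / 12)"
    if h: "h \<in> borel_measurable lebesgue" "(\<integral>\<^sup>+x. ennpowr (h x * inverse (w x)) (e' x) \<partial>lebesgue) \<le> 1" for h
  proof -
    have e_pos: "0 < e' x" for x using iq(3)[of x] by (simp add: e'_def)
    have e_rel: "1 / e' x = enn2real (inverse (conj_exponent (r x))) / S + 1 / b" for x
    proof -
      have "enn2real (inverse (conj_exponent (r x))) = 1 - S * iq x"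
        using enn2real_inverse_conj_exponent[OF exponents_ge_1[OF r, of x]] by (simp add: r_iq)
      then show ?thesis using S(1) Sb by (simp add: e'_def diff_divide_distrib)
    qed
    have v_eq: "inverse (v x) = ennpowr (inverse (w x)) S" for x
      using S(1) by (simp add: v_def ennpowr_inverse)
    show ?thesis unfolding A_def
      by (rule factor_through_A1_weight[OF r' w' v' v_eq N bdN2 S0 e_meas(2) e_pos e_rel h]) blast+
  qed

  obtain C where C: "0 \<le> C"
    "\<And>u z \<phi> \<psi> :: 'a \<Rightarrow> ennreal.
      \<lbrakk>u \<in> borel_measurable borel; z \<in> borel_measurable borel; \<phi> \<in> borel_measurable borel; \<psi> \<in> borel_measurable borel;
       \<And>x. maxop u x \<le> ennreal A * u x; \<And>x. maxop z x \<le> ennreal A * z x;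
       AE x in lborel. u x < \<infinity>; AE x in lborel. z x < \<infinity>;
       (\<integral>\<^sup>+x. u x * z x \<partial>lborel) \<le> ennreal 288; (\<integral>\<^sup>+x. \<phi> x \<partial>lborel) \<le> 1; (\<integral>\<^sup>+x. \<psi> x \<partial>lborel) \<le> 1\<rbrakk> \<Longrightarrow>
      (\<integral>\<^sup>+x. ennpowr (u x) (1/S) * ennpowr (\<phi> x) (1/b) *
        (\<integral>\<^sup>+y. ennpowr (z y) (1/S) * ennpowr (\<psi> y) (1/b) * riesz_kernel \<alpha> x y \<partial>lborel) \<partial>lborel) \<le> ennreal C"
    by (rule riesz_form_bounded[OF \<alpha> A(1) _ S(2) b(2), of 288], simp, rule that, assumption, blast)

  have form: "(\<integral>\<^sup>+x. g x * riesz_potential \<alpha> h x \<partial>lebesgue) \<le> ennreal C"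
    if h: "h \<in> borel_measurable lebesgue" "(\<integral>\<^sup>+x. ennpowr (h x * w x) (e x) \<partial>lebesgue) \<le> 1"
    and g: "g \<in> borel_measurable lebesgue" "(\<integral>\<^sup>+x. ennpowr (g x * inverse (w x)) (e' x) \<partial>lebesgue) \<le> 1" for g h
  proof -
    obtain z \<psi> where z: "z \<in> borel_measurable borel" "\<psi> \<in> borel_measurable borel"
      "AE x in lebesgue. h x \<le> ennpowr (z x) (1/S) * ennpowr (\<psi> x) (1/b)"
      "(\<integral>\<^sup>+x. \<psi> x \<partial>lborel) \<le> 1" "\<And>x. maxop z x \<le> ennreal A * z x" "AE x in lborel. z x < \<infinity>"
      "unit_ball r (\<lambda>x. z x * v x / 12)"
      using factor_f[OF h] by blast
    obtain u \<phi> where u: "u \<in> borel_measurable borel" "\<phi> \<in> borel_measurable borel"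
      "AE x in lebesgue. g x \<le> ennpowr (u x) (1/S) * ennpowr (\<phi> x) (1/b)"
      "(\<integral>\<^sup>+x. \<phi> x \<partial>lborel) \<le> 1" "\<And>x. maxop u x \<le> ennreal A * u x" "AE x in lborel. u x < \<infinity>"
      "unit_ball (\<lambda>x. conj_exponent (r x)) (\<lambda>x. u x * inverse (v x) / 12)"
      using factor_g[OF g] by blast
    note [measurable] = z(1,2) u(1,2)
    have uz: "(\<integral>\<^sup>+x. u x * z x \<partial>lborel) \<le> ennreal 288"
      by (rule nn_integral_mult_le_of_weighted_unit_balls[OF r v z(1) u(1) z(7) u(7)])
    have zh: "AE x in lborel. h x \<le> ennpowr (z x) (1/S) * ennpowr (\<psi> x) (1/b)"
      by (rule AE_lborel_le_of_AE_lebesgue_le[OF h(1) _ z(3)]) measurable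
    have "(\<integral>\<^sup>+x. g x * riesz_potential \<alpha> h x \<partial>lebesgue)
      \<le> (\<integral>\<^sup>+x. ennpowr (u x) (1/S) * ennpowr (\<phi> x) (1/b) *
        riesz_potential \<alpha> (\<lambda>y. ennpowr (z y) (1/S) * ennpowr (\<psi> y) (1/b)) x \<partial>lebesgue)"
    proof (rule nn_integral_mono_AE)
      show "AE x in lebesgue. g x * riesz_potential \<alpha> h x \<le> ennpowr (u x) (1/S) * ennpowr (\<phi> x) (1/b) *
        riesz_potential \<alpha> (\<lambda>y. ennpowr (z y) (1/S) * ennpowr (\<psi> y) (1/b)) x"
        using u(3) by eventually_elim (intro mult_mono riesz_potential_mono_AE zh, auto)
    qed
    also have "\<dots> \<le> ennreal C"
      unfolding nn_integral_completion riesz_potential_def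
      by (rule C(2)[OF u(1) z(1) u(2) z(2) u(5) z(5) u(6) z(6) uz u(4) z(4)])
    finally show ?thesis .
  qed

  \<comment> \<open>Any constant greater than \<open>C\<close> would do.\<close>
  define K1 where "K1 = C + 1"
  have potential: "(\<integral>\<^sup>+x. ennpowr (riesz_potential \<alpha> h x * w x / ennreal K1) (eq x) \<partial>lebesgue) \<le> 1"
    if h: "h \<in> borel_measurable lebesgue" "(\<integral>\<^sup>+x. ennpowr (h x * w x) (e x) \<partial>lebesgue) \<le> 1" for h
  proof (rule modular_le_1_of_dual_bound[OF _ assms(8) e_meas(3)])
    show "riesz_potential \<alpha> h \<in> borel_measurable lebesgue"
      using borel_measurable_riesz_potential[OF h(1)] by (simp add: measurable_completion)
    show "AE x in lebesgue. 1 < eq x \<and> e' x = eq x / (eq x - 1)" using q_eq by eventually_elim simp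
    show "0 \<le> C" "C < K1" using C(1) by (simp_all add: K1_def)
  qed (rule form[OF h])

  \<comment> \<open>From \<open>M\<^sub>\<alpha> f \<le> (A u)\<^sup>1\<^sup>/\<^sup>S\<close> and the unit ball bound for \<open>u v / 12\<close>.\<close>
  define K2 where "K2 = (12 * A) powr (1 / S)"
  define K where "K = max K1 K2"
  have K: "0 < K1" "0 < K2" "K1 \<le> K" "K2 \<le> K" "0 < K"
    using C(1) A by (auto simp: K1_def K2_def K_def)
  \<comment> \<open>Normalising by any \<open>l\<close> above the norm of \<open>f\<close> puts \<open>\<bar>f\<bar> / l\<close> into the unit ball.\<close>
  have norms: "(AE x in lebesgue. integrable lebesgue (fractional_kernel \<alpha> f x)) \<and>
      wnorm q w (\<lambda>x. ennreal \<bar>fractional_integral \<alpha> f x\<bar>) \<le> ennreal (K * l) \<and>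
      wnorm q w (fractional_maximal \<alpha> f) \<le> ennreal (K * l)"
    if f: "f \<in> Lspace p w" and l: "wnorm p w (\<lambda>x. ennreal \<bar>f x\<bar>) < ennreal l" "0 < l" for f l
  proof -
    have [measurable]: "f \<in> borel_measurable lebesgue" using f by (simp add: Lspace_def)
    define h where "h x = ennreal \<bar>f x\<bar> / ennreal l" for x
    have h_meas [measurable]: "h \<in> borel_measurable lebesgue" unfolding h_def by measurable
    have "unit_ball p (\<lambda>x. ennreal \<bar>f x\<bar> * w x / ennreal l)"
      using l(1) unfolding wnorm_def by (intro unit_ball_of_vnorm_less) auto
    then have "unit_ball p (\<lambda>x. h x * w x)"
      by (simp add: h_def divide_ennreal_def mult_ac)
    then obtain E where "(\<integral>\<^sup>+x\<in>{x. p x \<noteq> \<infinity>}. ennpowr (h x * w x) (enn2real (p x)) \<partial>lebesgue) + E \<le> 1"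
      unfolding unit_ball_def by blast
    then have "(\<integral>\<^sup>+x\<in>{x. p x \<noteq> \<infinity>}. ennpowr (h x * w x) (enn2real (p x)) \<partial>lebesgue) \<le> 1"
      by (rule ennreal_add_le_imp_le)
    moreover have "p x \<noteq> \<infinity>" for x using p_e(1)[of x] by (metis ennreal_neq_top infinity_ennreal_def)
    ultimately have h_int: "(\<integral>\<^sup>+x. ennpowr (h x * w x) (e x) \<partial>lebesgue) \<le> 1"
      by (simp add: e_def)
    let ?J = "riesz_potential \<alpha> (\<lambda>y. ennreal \<bar>f y\<bar>)"
    have hJ: "riesz_potential \<alpha> h x = ?J x / ennreal l" for x
      unfolding h_def by (rule riesz_potential_divide) measurable
    have [measurable]: "?J \<in> borel_measurable lebesgue"
      using borel_measurable_riesz_potential[of "\<lambda>y. ennreal \<bar>f y\<bar>" \<alpha>] by (simp add: measurable_completion)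
    have div: "?J x / ennreal l * w x / ennreal K1 = ?J x * w x / ennreal (K1 * l)" for x
      using l(2) K(1) by (simp add: divide_ennreal_def ennreal_mult ennreal_inverse_mult mult_ac)
    have J_int: "(\<integral>\<^sup>+x. ennpowr (?J x * w x / ennreal (K1 * l)) (eq x) \<partial>lebesgue) \<le> 1"
      using potential[OF h_meas h_int] unfolding hJ div .
    have "AE x in lebesgue. ennpowr (?J x * w x / ennreal (K1 * l)) (eq x) \<noteq> \<infinity>"
      using J_int by (intro nn_integral_noteq_infinite) (auto simp: top_unique)
    then have integ: "AE x in lebesgue. integrable lebesgue (fractional_kernel \<alpha> f x)"
      using assms(8)[unfolded weight_def, THEN conjunct2]
    proof eventually_elim
      case (elim x)
      then have "?J x < \<infinity>"
        by (cases "?J x = top"; cases "w x = 0")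
           (auto simp: less_top[symmetric] ennreal_top_mult divide_ennreal_def ennreal_mult_eq_top_iff)
      then show ?case by (intro integrable_fractional_kernel) auto
    qed
    have "wnorm q w (\<lambda>x. ennreal \<bar>fractional_integral \<alpha> f x\<bar>) \<le> ennreal (K1 * l)"
      unfolding wnorm_def
    proof (rule vnorm_le_of_AE_finite[OF _ q_fin])
      have "(\<integral>\<^sup>+x. ennpowr (ennreal \<bar>fractional_integral \<alpha> f x\<bar> * w x / ennreal (K1 * l)) (eq x) \<partial>lebesgue)
        \<le> (\<integral>\<^sup>+x. ennpowr (?J x * w x / ennreal (K1 * l)) (eq x) \<partial>lebesgue)"
        by (intro nn_integral_mono ennpowr_mono divide_right_mono_ennreal mult_right_mono
            abs_fractional_integral_le_riesz_potential) (auto simp: eq_def)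
      then show "(\<integral>\<^sup>+x. ennpowr (ennreal \<bar>fractional_integral \<alpha> f x\<bar> * w x / ennreal (K1 * l)) (enn2real (q x)) \<partial>lebesgue) \<le> 1"
        using J_int unfolding eq_def by (rule order_trans)
    qed (use K l in auto)
    also have "\<dots> \<le> ennreal (K * l)" using K l by (intro ennreal_leI mult_right_mono) auto
    finally have I: "wnorm q w (\<lambda>x. ennreal \<bar>fractional_integral \<alpha> f x\<bar>) \<le> ennreal (K * l)" .

    obtain u \<phi> where u: "u \<in> borel_measurable borel" "\<phi> \<in> borel_measurable borel"
      "AE x in lebesgue. h x \<le> ennpowr (u x) (1/S) * ennpowr (\<phi> x) (1/b)"
      "(\<integral>\<^sup>+x. \<phi> x \<partial>lborel) \<le> 1" "\<And>x. maxop u x \<le> ennreal A * u x"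
      "unit_ball r (\<lambda>x. u x * v x / 12)"
      using factor_f[OF h_meas h_int] by blast
    have l_cancel: "ennreal l * (t / ennreal l) = t" for t
      using l(2) ennreal_divide_mult_cancel[of "ennreal l" t] by (simp add: mult.commute)
    note [measurable] = u(1,2)
    have f_le: "AE x in lborel. ennreal \<bar>f x\<bar> \<le> ennreal l * (ennpowr (u x) (1/S) * ennpowr (\<phi> x) (1/b))"
    proof (rule AE_lborel_le_of_AE_lebesgue_le)
      show "AE x in lebesgue. ennreal \<bar>f x\<bar> \<le> ennreal l * (ennpowr (u x) (1/S) * ennpowr (\<phi> x) (1/b))"
        using u(3)
      proof eventually_elim
        case (elim x)
        have "ennreal l * h x \<le> ennreal l * (ennpowr (u x) (1/S) * ennpowr (\<phi> x) (1/b))"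
          by (intro mult_left_mono elim) simp
        then show ?case by (simp add: h_def l_cancel)
      qed
    qed measurable
    have Mf: "fractional_maximal \<alpha> f x \<le> ennreal l * ennpowr (ennreal A * u x) (1/S)" for x
    proof -
      have "fractional_maximal \<alpha> f x \<le> ennreal l * ennpowr (maxop u x) (1/S)"
        by (rule fractional_maximal_le_maxop[OF u(1,2) S(1) Sb b(2) u(4) f_le])
      also have "\<dots> \<le> ennreal l * ennpowr (ennreal A * u x) (1/S)"
        using S(1) by (intro mult_left_mono ennpowr_mono u(5)) auto
      finally show ?thesis .
    qed
    have "wnorm q w (fractional_maximal \<alpha> f) \<le> ennreal (K2 * l)"
      unfolding wnorm_def
    proof (rule vnorm_le_of_AE_finite[OF _ q_fin])
      obtain E where "(\<integral>\<^sup>+x\<in>{x. r x \<noteq> \<infinity>}. ennpowr (u x * v x / 12) (enn2real (r x)) \<partial>lebesgue) + E \<le> 1"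
        using u(6) unfolding unit_ball_def by blast
      then have int: "(\<integral>\<^sup>+x\<in>{x. r x \<noteq> \<infinity>}. ennpowr (u x * v x / 12) (enn2real (r x)) \<partial>lebesgue) \<le> 1"
        by (rule ennreal_add_le_imp_le)
      have "(\<integral>\<^sup>+x. ennpowr (fractional_maximal \<alpha> f x * w x / ennreal (K2 * l)) (eq x) \<partial>lebesgue)
        \<le> (\<integral>\<^sup>+x\<in>{x. r x \<noteq> \<infinity>}. ennpowr (u x * v x / 12) (enn2real (r x)) \<partial>lebesgue)"
      proof (rule nn_integral_mono_AE)
        show "AE x in lebesgue. ennpowr (fractional_maximal \<alpha> f x * w x / ennreal (K2 * l)) (eq x)
          \<le> ennpowr (u x * v x / 12) (enn2real (r x)) * indicator {x. r x \<noteq> \<infinity>} x"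
          using q_eq
        proof eventually_elim
          case (elim x)
          have K2_eq: "ennreal (K2 * l) = ennpowr (ennreal (12 * A)) (1/S) * ennreal l"
          proof -
            have "ennpowr (ennreal (12 * A)) (1/S) = ennreal K2"
              unfolding K2_def using A by (intro ennpowr_ennreal) simp
            then show ?thesis using K(2) l(2) by (simp only: ennreal_mult less_imp_le)
          qed
          have wv: "w x = ennpowr (v x) (1/S)" using S(1) by (simp add: v_def ennpowr_ennpowr)
          have "fractional_maximal \<alpha> f x * w x / ennreal (K2 * l)
            \<le> ennreal l * ennpowr (ennreal A * u x) (1/S) * w x / ennreal (K2 * l)"
            by (intro divide_right_mono_ennreal mult_right_mono Mf) simp
          also have "\<dots> = (ennreal l * (1 / ennreal l)) * (ennpowr (ennreal A * u x) (1/S) * ennpowr (v x) (1/S) * inverse (ennpowr (ennreal (12 * A)) (1/S)))"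
          proof -
            have "inverse (ennreal (K2 * l)) = inverse (ennpowr (ennreal (12 * A)) (1/S)) * (1 / ennreal l)"
              unfolding K2_eq using l(2) A by (subst ennreal_inverse_mult) (auto simp: divide_ennreal_def less_top[symmetric])
            then show ?thesis unfolding wv divide_ennreal_def[of _ "ennreal (K2 * l)"] by (simp only: mult_ac)
          qed
          also have "\<dots> = ennpowr (ennreal A * u x * v x / ennreal (12 * A)) (1/S)"
            using S(1) l_cancel[of 1] by (simp add: ennpowr_mult ennpowr_inverse divide_ennreal_def)
          also have "ennreal A * u x * v x / ennreal (12 * A) = u x * v x / 12"
          proof -
            have "ennreal A / ennreal (12 * A) = inverse 12"
            proof -
              have "ennreal A / ennreal (12 * A) = ennreal (A / (12 * A))"
                using A by (intro divide_ennreal) auto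
              also have "A / (12 * A) = inverse 12" using A by simp
              also have "ennreal (inverse 12) = inverse (ennreal 12)" by (intro inverse_ennreal[symmetric]) simp
              finally show ?thesis by simp
            qed
            then show ?thesis unfolding divide_ennreal_def by (metis mult.assoc mult.commute)
          qed
          finally have "ennpowr (fractional_maximal \<alpha> f x * w x / ennreal (K2 * l)) (eq x)
            \<le> ennpowr (ennpowr (u x * v x / 12) (1/S)) (eq x)"
            using elim by (intro ennpowr_mono) auto
          then show ?case using elim by (simp add: ennpowr_ennpowr)
        qed
      qed
      then show "(\<integral>\<^sup>+x. ennpowr (fractional_maximal \<alpha> f x * w x / ennreal (K2 * l)) (enn2real (q x)) \<partial>lebesgue) \<le> 1"
        using int unfolding eq_def by (rule order_trans)
    qed (use K l in auto)
    also have "\<dots> \<le> ennreal (K * l)" using K l by (intro ennreal_leI mult_right_mono) auto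
    finally show ?thesis using integ I by simp
  qed
  show ?thesis
  proof (intro exI[of _ K] ballI conjI)
    fix f assume f: "f \<in> Lspace p w"
    then have fin: "wnorm p w (\<lambda>x. ennreal \<bar>f x\<bar>) < \<infinity>" by (simp add: Lspace_def)
    then obtain l where "wnorm p w (\<lambda>x. ennreal \<bar>f x\<bar>) < ennreal l" "0 < l"
    proof (cases "wnorm p w (\<lambda>x. ennreal \<bar>f x\<bar>)")
      case (real t)
      then show ?thesis by (intro that[of "t + 1"]) (auto simp: ennreal_lessI)
    qed simp
    then show "AE x in lebesgue. integrable lebesgue (fractional_kernel \<alpha> f x)" using norms[OF f] by blast
    show "wnorm q w (\<lambda>x. ennreal \<bar>fractional_integral \<alpha> f x\<bar>) \<le> ennreal K * wnorm p w (\<lambda>x. ennreal \<bar>f x\<bar>)"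
      using norms[OF f] K fin by (intro ennreal_le_mult_of_forall_greater) auto
    show "wnorm q w (fractional_maximal \<alpha> f) \<le> ennreal K * wnorm p w (\<lambda>x. ennreal \<bar>f x\<bar>)"
      using norms[OF f] K fin by (intro ennreal_le_mult_of_forall_greater) auto
  qed
qed

end
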